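(* Let $0<\lambda<1$ and $n\ge 2$. Consider the system $$\frac{dx}{dt}=-\lambda^{-1}y-x-x^2+\varepsilon\sum_{i+j=0}^n a_{i,j}x^iy^j,\qquad \frac{dy}{dt}=x+y+2xy+3\lambda x^2+2\lambda x^3+\varepsilon\sum_{i+j=0}^n b_{i,j}x^iy^j,$$ with real coefficients $a_{i,j},b_{i,j}$ and $0<|\varepsilon|\ll 1$, and let $I(h)$ be its Abelian integral. Then: (i) (upper bound) For every choice of the coefficients such that $I\not\equiv 0$, the function $I(h)$ has at most $n-1$ zeros in $(0,+\infty)$ counted with multiplicities, and consequently the number of limit cycles of the system bifurcating from the period annulus $\bigcup_{h>0}\Gamma_h$ is at most $n-1$, counted with multiplicities. (ii) (sharpness) There exist coefficients $a_{i,j},b_{i,j}$ with $I\not\equiv 0$ for which $n-1$ limit cycles bifurcate from the period annulus.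
   Context: For $0<\lambda<1$ put $$H(x,y)=\tfrac12x^2+\lambda x^3+\tfrac12\lambda x^4+\tfrac12\lambda^{-1}y^2+xy+x^2y .$$ For $\varepsilon=0$ the system is $\dot x=-\partial H/\partial y$, $\dot y=\partial H/\partial x$; it has a center at the origin, surrounded by the periodic orbits $\Gamma_h=\{(x,y):H(x,y)=h\}$, $h\in(0,+\infty)$, oriented by the flow (counterclockwise). Abelian integral: with $f=\sum_{i+j=0}^n a_{i,j}x^iy^j$ and $g=\sum_{i+j=0}^n b_{i,j}x^iy^j$ (sums over all $i,j\ge0$ with $i+j\le n$), $$I(h)=\oint_{\Gamma_h} g\,dx-f\,dy,\qquad h\in(0,+\infty).$$ A limit cycle is an isolated closed orbit. Let $T=\{(s,-\lambda s-\lambda s^2): s>0\}$, an arc transversal to the unperturbed flow which meets each $\Gamma_h$ exactly once; parametrize $T$ by the value $h$ of $H$. The multiplicity of a limit cycle meeting $T$ is the multiplicity of the corresponding zero of the displacement function (return map minus identity) on $T$. "At most $N$ limit cycles bifurcate from the period annulus" (for fixed coefficients) means: for every compact interval $[a,b]\subset(0,+\infty)$ there is $\varepsilon_0>0$ such that for all $0<|\varepsilon|<\varepsilon_0$ the system has at most $N$ limit cycles, counted with multiplicities, that meet $T$ at a point with $H\in[a,b]$. "$N$ limit cycles bifurcate from the period annulus" means: there are a compact interval $[a,b]\subset(0,+\infty)$ and $\varepsilon_0>0$ such that for all $0<|\varepsilon|<\varepsilon_0$ the system has at least $N$ limit cycles meeting $T$ at points with $H\in[a,b]$. *)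

theory Defs
  imports "HOL-Analysis.Analysis" "HOL-Library.Extended_Nat"
begin

section \<open>Planar systems, closed orbits and limit cycles\<close>

definition solves_on :: "(real \<times> real \<Rightarrow> real \<times> real) \<Rightarrow> (real \<Rightarrow> real \<times> real) \<Rightarrow> real set \<Rightarrow> bool" where
  "solves_on X \<gamma> J \<longleftrightarrow> (\<forall>t\<in>J. (\<gamma> has_vector_derivative X (\<gamma> t)) (at t within J))"

definition closed_orbit :: "(real \<times> real \<Rightarrow> real \<times> real) \<Rightarrow> (real \<times> real) set \<Rightarrow> bool" where
  "closed_orbit X C \<longleftrightarrow> (\<exists>\<gamma> p. 0 < p \<and> solves_on X \<gamma> UNIV \<and> (\<forall>t. \<gamma> (t + p) = \<gamma> t) \<and>
      (\<exists>t. \<gamma> t \<noteq> \<gamma> 0) \<and> C = range \<gamma>)"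

definition limit_cycle :: "(real \<times> real \<Rightarrow> real \<times> real) \<Rightarrow> (real \<times> real) set \<Rightarrow> bool" where
  "limit_cycle X C \<longleftrightarrow> closed_orbit X C \<and>
      (\<exists>U. open U \<and> C \<subseteq> U \<and> (\<forall>C'. closed_orbit X C' \<and> C' \<subseteq> U \<longrightarrow> C' = C))"

text \<open>
  The multiplicity is the number of leading derivatives (starting with the function itself) that
  vanish at the point: it is 0 at a point that is not a zero, and infinite at a flat zero.
\<close>

definition zero_mult :: "(real \<Rightarrow> real) \<Rightarrow> real \<Rightarrow> enat" where
  "zero_mult \<phi> c = Sup {enat k | k. \<forall>j<k. (deriv ^^ j) \<phi> c = 0}"

section \<open>The perturbed Hamiltonian system\<close>

definition Ham :: "real \<Rightarrow> real \<times> real \<Rightarrow> real" where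
  "Ham lam = (\<lambda>(x, y). x^2 / 2 + lam * x^3 + lam * x^4 / 2 + y^2 / (2 * lam) + x * y + x^2 * y)"

definition bipoly :: "nat \<Rightarrow> (nat \<Rightarrow> nat \<Rightarrow> real) \<Rightarrow> real \<times> real \<Rightarrow> real" where
  "bipoly n c = (\<lambda>(x, y). \<Sum>(i, j)\<in>{(i, j). i + j \<le> n}. c i j * x^i * y^j)"

definition field0 :: "real \<Rightarrow> real \<times> real \<Rightarrow> real \<times> real" where
  "field0 lam = (\<lambda>(x, y). (- y / lam - x - x^2, x + y + 2 * x * y + 3 * lam * x^2 + 2 * lam * x^3))"

definition pert_field ::
  "real \<Rightarrow> nat \<Rightarrow> (nat \<Rightarrow> nat \<Rightarrow> real) \<Rightarrow> (nat \<Rightarrow> nat \<Rightarrow> real) \<Rightarrow> real \<Rightarrow> real \<times> real \<Rightarrow> real \<times> real" where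
  "pert_field lam n a b eps z = field0 lam z + eps *\<^sub>R (bipoly n a z, bipoly n b z)"

definition Gam :: "real \<Rightarrow> real \<Rightarrow> (real \<times> real) set" where
  "Gam lam h = {z. Ham lam z = h}"

section \<open>The Abelian integral\<close>

text \<open>The integral of the 1-form \<open>P dx + Q dy\<close> along \<open>\<gamma>\<close> restricted to \<open>[0, p]\<close>.\<close>

definition line_integral ::
  "(real \<times> real \<Rightarrow> real) \<Rightarrow> (real \<times> real \<Rightarrow> real) \<Rightarrow> (real \<Rightarrow> real \<times> real) \<Rightarrow> real \<Rightarrow> real" where
  "line_integral P Q \<gamma> p = integral {0..p}
     (\<lambda>t. P (\<gamma> t) * fst (vector_derivative \<gamma> (at t)) + Q (\<gamma> t) * snd (vector_derivative \<gamma> (at t)))"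

text \<open>
  \<open>Gam lam h\<close> is traversed exactly once, by a solution of the unperturbed system; this fixes the
  orientation. The value does not depend on the starting point of the solution.
\<close>

definition abelian_integral ::
  "real \<Rightarrow> nat \<Rightarrow> (nat \<Rightarrow> nat \<Rightarrow> real) \<Rightarrow> (nat \<Rightarrow> nat \<Rightarrow> real) \<Rightarrow> real \<Rightarrow> real" where
  "abelian_integral lam n a b h = (THE v. \<exists>\<gamma> p. 0 < p \<and> solves_on (field0 lam) \<gamma> UNIV \<and>
      \<gamma> p = \<gamma> 0 \<and> inj_on \<gamma> {0..<p} \<and> \<gamma> ` {0..p} = Gam lam h \<and>
      v = line_integral (bipoly n b) (\<lambda>z. - bipoly n a z) \<gamma> p)"

section \<open>Return map, displacement function and multiplicity of limit cycles\<close>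

definition Transv :: "real \<Rightarrow> (real \<times> real) set" where
  "Transv lam = {(s, - lam * s - lam * s^2) | s. s > 0}"

text \<open>First return to the arc \<open>Transv lam\<close>, which is parametrized by the value of \<open>Ham lam\<close>.\<close>

definition first_return :: "real \<Rightarrow> (real \<times> real \<Rightarrow> real \<times> real) \<Rightarrow> real \<Rightarrow> real \<Rightarrow> bool" where
  "first_return lam X h h' \<longleftrightarrow> (\<exists>\<gamma> \<tau>. 0 < \<tau> \<and> solves_on X \<gamma> {0..\<tau>} \<and>
      \<gamma> 0 \<in> Transv lam \<and> Ham lam (\<gamma> 0) = h \<and>
      (\<forall>t. 0 < t \<and> t < \<tau> \<longrightarrow> \<gamma> t \<notin> Transv lam) \<and>
      \<gamma> \<tau> \<in> Transv lam \<and> Ham lam (\<gamma> \<tau>) = h')"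

definition return_map :: "real \<Rightarrow> (real \<times> real \<Rightarrow> real \<times> real) \<Rightarrow> real \<Rightarrow> real" where
  "return_map lam X h = (THE h'. first_return lam X h h')"

definition displacement :: "real \<Rightarrow> (real \<times> real \<Rightarrow> real \<times> real) \<Rightarrow> real \<Rightarrow> real" where
  "displacement lam X h = return_map lam X h - h"

definition cycle_mult :: "real \<Rightarrow> (real \<times> real \<Rightarrow> real \<times> real) \<Rightarrow> (real \<times> real) set \<Rightarrow> enat" where
  "cycle_mult lam X C = zero_mult (displacement lam X) (THE h. \<exists>z \<in> C \<inter> Transv lam. Ham lam z = h)"

definition cycles_meeting ::
  "real \<Rightarrow> (real \<times> real \<Rightarrow> real \<times> real) \<Rightarrow> real \<Rightarrow> real \<Rightarrow> (real \<times> real) set set" where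
  "cycles_meeting lam X A B =
     {C. limit_cycle X C \<and> (\<exists>z \<in> C \<inter> Transv lam. Ham lam z \<in> {A..B})}"

section \<open>Bifurcation from the period annulus\<close>

text \<open>
  The requirement that each multiplicity is at least 1 says that every limit cycle counted is
  a zero of the displacement function, so that none is lost in the sum.
\<close>

definition at_most_bifurcate ::
  "real \<Rightarrow> nat \<Rightarrow> (nat \<Rightarrow> nat \<Rightarrow> real) \<Rightarrow> (nat \<Rightarrow> nat \<Rightarrow> real) \<Rightarrow> nat \<Rightarrow> bool" where
  "at_most_bifurcate lam n a b N \<longleftrightarrow>
     (\<forall>A B. 0 < A \<and> A \<le> B \<longrightarrow> (\<exists>eps0>0. \<forall>eps. 0 < \<bar>eps\<bar> \<and> \<bar>eps\<bar> < eps0 \<longrightarrow>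
        (let X = pert_field lam n a b eps; S = cycles_meeting lam X A B in
          finite S \<and> (\<forall>C\<in>S. 1 \<le> cycle_mult lam X C) \<and> (\<Sum>C\<in>S. cycle_mult lam X C) \<le> enat N)))"

definition at_least_bifurcate ::
  "real \<Rightarrow> nat \<Rightarrow> (nat \<Rightarrow> nat \<Rightarrow> real) \<Rightarrow> (nat \<Rightarrow> nat \<Rightarrow> real) \<Rightarrow> nat \<Rightarrow> bool" where
  "at_least_bifurcate lam n a b N \<longleftrightarrow>
     (\<exists>A B. 0 < A \<and> A < B \<and> (\<exists>eps0>0. \<forall>eps. 0 < \<bar>eps\<bar> \<and> \<bar>eps\<bar> < eps0 \<longrightarrow>
        (\<exists>F \<subseteq> cycles_meeting lam (pert_field lam n a b eps) A B. finite F \<and> card F = N)))"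

end

theory Submission
  imports Defs "HOL-Complex_Analysis.Complex_Analysis"
begin

text \<open>
  Completing the square turns \<open>H\<close> into \<open>\<bar>z\<bar>\<^sup>2 / 2\<close> for a polynomial coordinate \<open>z\<close> in which the
  unperturbed system is a harmonic oscillator. Hence every \<open>\<Gamma>\<^sub>h\<close> is a circle in these coordinates,
  and \<open>I h = h * Q h\<close> with a polynomial \<open>Q\<close> of degree at most \<open>n - 1\<close>: in the radius \<open>R\<close> the
  integral is an even polynomial without constant term, and its coefficient of degree \<open>2 n + 2\<close> is a
  multiple of the integral of \<open>sin * cos ^ (2 n + 1)\<close>.

  In polar coordinates the perturbed system becomes a scalar equation for \<open>dR/d\<theta>\<close>. Picard iteration
  with complex initial values shows that the displacement function extends holomorphically to a
  complex neighbourhood of a given interval \<open>[A, B]\<close> and equals \<open>- eps * (h * Q h) + O(eps\<^sup>2)\<close> there.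
  After division by \<open>h\<close>, Cauchy's estimate makes its derivative of order \<open>degree Q\<close> nonzero on
  \<open>[A, B]\<close>, and Rolle's theorem bounds the zeros counted with multiplicities. A closed orbit through
  the transversal is a zero of the displacement function because a spiral arc together with the
  segment between its ends can be crossed in one direction only. For the sharpness, the functions
  \<open>g = y ^ j\<close> yield polynomials \<open>Q\<close> of degree exactly \<open>j - 1\<close>, so that \<open>Q\<close> is arbitrary.
\<close>

section \<open>Counting zeros with multiplicity\<close>

text \<open>Multiplicities involve derivatives of the displacement function, and a sup bound on a
  complex neighbourhood controls all of them at once, without differentiating the flow again and
  again in the initial value. The bound \<open>n - 1\<close> has two sources: the vanishing top
  coefficient, which keeps the degree of \<open>h * Q h\<close> at \<open>n\<close> instead of
  \<open>n + 1\<close>, and the zero at the centre \<open>h = 0\<close>, which lies outside the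
  annulus. The other obstacle is global. Of a closed orbit only one point on the transversal is
  known; the rest of it may leave the annulus where the angle increases, and may meet the
  transversal many times. Hence one turn does not show that the orbit closes up. The trapping
  argument needs uniqueness along the spiral arc and the direction of the field on the segment,
  which lies in the annulus. Conversely, a zero of the displacement function gives a limit cycle
  only if other closed orbits stay away: a closed orbit inside the annulus turns with speed bounded
  below, hence meets the transversal, and there the zeros are finite in number.\<close>

lemma zero_mult_le:
  assumes "(deriv ^^ d) \<phi> c \<noteq> 0"
  shows "zero_mult \<phi> c \<le> enat d"
  unfolding zero_mult_def
proof (rule Sup_least, safe)
  fix k assume "\<forall>j<k. (deriv ^^ j) \<phi> c = 0"
  then show "enat k \<le> enat d" using assms by (auto simp: not_less[symmetric])
qed

lemma zero_mult_ge:
  assumes "\<And>j. j < k \<Longrightarrow> (deriv ^^ j) \<phi> c = 0"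
  shows "enat k \<le> zero_mult \<phi> c"
  unfolding zero_mult_def using assms by (intro Sup_upper) auto

lemma zero_mult_mono:
  assumes "\<And>k. \<forall>j<k. (deriv ^^ j) \<phi> c = 0 \<Longrightarrow> \<forall>j<k. (deriv ^^ j) \<psi> c = 0"
  shows "zero_mult \<phi> c \<le> zero_mult \<psi> c"
  unfolding zero_mult_def using assms by (intro Sup_subset_mono) blast

text \<open>Only an inequality: where \<open>\<phi>\<close> does not vanish the left side is 0,
  whatever its derivative does. The 1 accounts for the value of \<open>\<phi>\<close>
  itself.\<close>

lemma zero_mult_deriv: "zero_mult \<phi> c \<le> 1 + zero_mult (deriv \<phi>) c"
  unfolding zero_mult_def[of \<phi>]
proof (rule Sup_least, safe)
  fix k assume k: "\<forall>j<k. (deriv ^^ j) \<phi> c = 0"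
  show "enat k \<le> 1 + zero_mult (deriv \<phi>) c"
  proof (cases k)
    case 0
    then show ?thesis by (simp add: zero_enat_def[symmetric])
  next
    case (Suc m)
    have "enat m \<le> zero_mult (deriv \<phi>) c"
      using k Suc by (intro zero_mult_ge) (auto simp: funpow_Suc_right simp del: funpow.simps)
    moreover have "enat k = 1 + enat m" using Suc by (simp add: one_enat_def)
    ultimately show ?thesis by (simp add: add_left_mono)
  qed
qed

lemma zero_mult_eq_0: "\<phi> c \<noteq> 0 \<Longrightarrow> zero_mult \<phi> c = 0"
  using zero_mult_le[of 0 \<phi> c] by (simp add: zero_enat_def[symmetric])

lemma zero_mult_pos: "\<phi> c = 0 \<Longrightarrow> 1 \<le> zero_mult \<phi> c"
  using zero_mult_ge[of 1 \<phi> c] by (simp add: one_enat_def)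

text \<open>Rolle points are placed strictly between consecutive zeros, so they avoid
  \<open>F\<close> and can be counted besides the multiplicities that the derivative inherits at
  \<open>F\<close>. The clause \<open>\<exists>f\<in>F. g < f\<close> is the induction invariant: it
  keeps all old points below the largest zero so far, hence different from the next one.\<close>

lemma interlacing_zeros_of_derivative:
  fixes \<phi> \<psi> :: "real \<Rightarrow> real"
  assumes "finite F" "F \<subseteq> {A..B}" "\<And>x. x \<in> F \<Longrightarrow> \<phi> x = 0"
    and d: "\<And>x. x \<in> {A..B} \<Longrightarrow> (\<phi> has_real_derivative \<psi> x) (at x)"
  shows "\<exists>G. finite G \<and> G \<subseteq> {A..B} \<and> (\<forall>g\<in>G. \<psi> g = 0 \<and> (\<exists>f\<in>F. g < f)) \<and>
           G \<inter> F = {} \<and> card F \<le> card G + 1"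
  using assms(1-3)
proof (induction F rule: finite_linorder_max_induct)
  case empty
  show ?case by (rule exI[of _ "{}"]) simp
next
  case (insert b F)
  then obtain G where G: "finite G" "G \<subseteq> {A..B}" "\<forall>g\<in>G. \<psi> g = 0 \<and> (\<exists>f\<in>F. g < f)"
    "G \<inter> F = {}" "card F \<le> card G + 1" by auto
  show ?case
  proof (cases "F = {}")
    case True
    then show ?thesis by (intro exI[of _ "{}"]) simp
  next
    case False
    define m where "m = Max F"
    have m: "m \<in> F" "m < b" "\<And>f. f \<in> F \<Longrightarrow> f \<le> m"
      using False insert by (auto simp: m_def)
    have AB: "A \<le> m" "b \<le> B" using m insert.prems by auto
    have "\<exists>z. m < z \<and> z < b \<and> (\<lambda>h. h * \<psi> z) = (\<lambda>v. 0)"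
    proof (rule Rolle_deriv)
      show "m < b" by (rule m)
      show "\<phi> m = \<phi> b" using m insert.prems by simp
      show "continuous_on {m..b} \<phi>"
        by (rule DERIV_continuous_on[where D = \<psi>]) (use AB in \<open>auto intro!: has_field_derivative_at_within d\<close>)
      show "(\<phi> has_derivative (\<lambda>h. h * \<psi> x)) (at x)" if "m < x" "x < b" for x
        using d[of x] AB that by (simp add: has_field_derivative_def mult.commute[of _ "\<psi> x"])
    qed
    then obtain \<xi> where \<xi>: "m < \<xi>" "\<xi> < b" "\<psi> \<xi> = 0" by (auto dest: fun_cong[where x = 1])
    have "\<xi> \<notin> G" using G(3) m(3) \<xi> by force
    moreover have "\<xi> \<notin> F" using m(3) \<xi> by force
    moreover have "b \<notin> G" using G(3) m(2,3) by force
    moreover have "b \<notin> F" using insert by auto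
    ultimately show ?thesis using G AB \<xi> insert.hyps m
      by (intro exI[of _ "insert \<xi> G"]) auto
  qed
qed

text \<open>Induction on \<open>d\<close>: passing to the derivative lowers each multiplicity by at
  most one and creates a zero in each gap between neighbouring zeros. With \<open>k\<close> zeros,
  at most \<open>k\<close> units are lost and at least \<open>k - 1\<close> gained, so the total
  drops by at most one.\<close>

theorem sum_zero_mult_le:
  fixes \<phi> :: "real \<Rightarrow> real"
  assumes "\<And>j x. x \<in> {A..B} \<Longrightarrow> ((deriv ^^ j) \<phi> has_real_derivative (deriv ^^ Suc j) \<phi> x) (at x)"
    and "\<And>x. x \<in> {A..B} \<Longrightarrow> (deriv ^^ d) \<phi> x \<noteq> 0"
  shows "finite {x \<in> {A..B}. \<phi> x = 0} \<and> (\<Sum>x\<in>{x \<in> {A..B}. \<phi> x = 0}. zero_mult \<phi> x) \<le> enat d"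
  using assms
proof (induction d arbitrary: \<phi>)
  case 0
  then have "{x \<in> {A..B}. \<phi> x = 0} = {}" by auto
  then show ?case by (simp only:) simp
next
  case (Suc d)
  define \<psi> where "\<psi> = deriv \<phi>"
  define Z where "Z = {x \<in> {A..B}. \<phi> x = 0}"
  define Z' where "Z' = {x \<in> {A..B}. \<psi> x = 0}"
  have Z': "finite Z'" "(\<Sum>x\<in>Z'. zero_mult \<psi> x) \<le> enat d"
    using Suc.IH[of \<psi>] Suc.prems(1)[of _ "Suc _"] Suc.prems(2)
    by (auto simp: Z'_def \<psi>_def funpow_swap1)
  \<comment> \<open>The zero set is not yet known to be finite, so the estimate is made for finite
    subsets. Since every zero has multiplicity at least 1, it bounds their cardinality, and
    finiteness follows.\<close>
  have key: "(\<Sum>x\<in>F. zero_mult \<phi> x) \<le> enat (Suc d)" if F: "finite F" "F \<subseteq> Z" for F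
  proof -
    have "\<exists>G. finite G \<and> G \<subseteq> {A..B} \<and> (\<forall>g\<in>G. \<psi> g = 0 \<and> (\<exists>f\<in>F. g < f)) \<and>
        G \<inter> F = {} \<and> card F \<le> card G + 1"
    proof (rule interlacing_zeros_of_derivative)
      show "(\<phi> has_real_derivative \<psi> x) (at x)" if "x \<in> {A..B}" for x
        using Suc.prems(1)[OF that, of 0] by (simp add: \<psi>_def)
    qed (use F in \<open>auto simp: Z_def\<close>)
    then obtain G where G: "finite G" "G \<subseteq> Z'" "G \<inter> F = {}" "card F \<le> card G + 1"
      unfolding Z'_def by blast
    have "(\<Sum>x\<in>F. zero_mult \<phi> x) \<le> (\<Sum>x\<in>F. 1 + zero_mult \<psi> x)"
      unfolding \<psi>_def by (intro sum_mono zero_mult_deriv)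
    also have "\<dots> = of_nat (card F) + (\<Sum>x\<in>F. zero_mult \<psi> x)"
      by (simp add: sum.distrib)
    also have "(\<Sum>x\<in>F. zero_mult \<psi> x) = (\<Sum>x\<in>F \<inter> Z'. zero_mult \<psi> x)"
      using F by (intro sum.mono_neutral_right) (auto simp: Z_def Z'_def intro!: zero_mult_eq_0)
    finally have step: "(\<Sum>x\<in>F. zero_mult \<phi> x) \<le> of_nat (card F) + (\<Sum>x\<in>F \<inter> Z'. zero_mult \<psi> x)" .
    have cF: "of_nat (card F) \<le> (1::enat) + of_nat (card G)"
      using G(4) by (simp add: of_nat_eq_enat one_enat_def)
    have cG: "of_nat (card G) \<le> (\<Sum>x\<in>G. zero_mult \<psi> x)"
      using sum_mono[of G "\<lambda>_. 1::enat" "zero_mult \<psi>"] G(2) by (auto simp: Z'_def intro!: zero_mult_pos)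
    note step
    also have "of_nat (card F) + (\<Sum>x\<in>F \<inter> Z'. zero_mult \<psi> x) \<le>
        1 + (\<Sum>x\<in>G. zero_mult \<psi> x) + (\<Sum>x\<in>F \<inter> Z'. zero_mult \<psi> x)"
      by (intro add_right_mono order_trans[OF cF] add_left_mono cG)
    also have "\<dots> = 1 + (\<Sum>x\<in>G \<union> (F \<inter> Z'). zero_mult \<psi> x)"
      using F G by (subst sum.union_disjoint) (auto simp: add.assoc)
    also have "\<dots> \<le> 1 + (\<Sum>x\<in>Z'. zero_mult \<psi> x)"
      using G Z' by (intro add_left_mono sum_mono2) auto
    also have "\<dots> \<le> 1 + enat d" by (intro add_left_mono Z')
    finally show ?thesis by (simp add: one_enat_def)
  qed
  have "card F \<le> Suc d" if F: "finite F" "F \<subseteq> Z" for F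
  proof -
    have "of_nat (card F) \<le> (\<Sum>x\<in>F. zero_mult \<phi> x)"
      using sum_mono[of F "\<lambda>_. 1::enat" "zero_mult \<phi>"] F(2) by (auto simp: Z_def intro!: zero_mult_pos)
    then show ?thesis using key[OF F] by (metis enat_ord_simps(1) of_nat_eq_enat order_trans)
  qed
  then have "finite Z" by (meson finite_if_finite_subsets_card_bdd)
  then show ?case using key[of Z] by (simp add: Z_def)
qed

text \<open>Along the real axis the imaginary part of \<open>f\<close> is identically zero, so its
  derivative vanishes too and the complex derivative is real. This lets estimates for complex
  derivatives speak about the real \<open>deriv\<close> inside \<open>zero_mult\<close>.\<close>

lemma deriv_of_real_restriction:
  fixes f :: "complex \<Rightarrow> complex" and \<phi> :: "real \<Rightarrow> real"
  assumes "f holomorphic_on S" "open S"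
    and eq: "\<And>x. complex_of_real x \<in> S \<Longrightarrow> of_real (\<phi> x) = f (of_real x)"
    and x: "complex_of_real x \<in> S"
  shows "(\<phi> has_real_derivative deriv \<phi> x) (at x) \<and> of_real (deriv \<phi> x) = deriv f (of_real x)"
proof -
  have "(f has_field_derivative deriv f (of_real x)) (at (of_real x))"
    using assms(1,2) x by (meson holomorphic_derivI)
  then have f: "((\<lambda>t. f (of_real t)) has_vector_derivative deriv f (of_real x)) (at x)"
    using has_vector_derivative_real_field by blast
  have "open (complex_of_real -` S)" using assms(2) by (intro open_vimage) auto
  have f': "((\<lambda>t. complex_of_real (\<phi> t)) has_vector_derivative deriv f (of_real x)) (at x)"
    by (rule has_vector_derivative_transform_within_open[OF f \<open>open (complex_of_real -` S)\<close>])
      (use x eq in auto)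
  have re: "(\<phi> has_real_derivative Re (deriv f (of_real x))) (at x)"
    using bounded_linear.has_vector_derivative[OF bounded_linear_Re f']
    by (simp add: has_real_derivative_iff_has_vector_derivative)
  have "((\<lambda>t. 0::real) has_vector_derivative Im (deriv f (of_real x))) (at x)"
    using bounded_linear.has_vector_derivative[OF bounded_linear_Im f'] by simp
  then have "Im (deriv f (of_real x)) = 0"
    by (metis has_vector_derivative_const vector_derivative_unique_at)
  moreover have "deriv \<phi> x = Re (deriv f (of_real x))" using re by (rule DERIV_imp_deriv)
  ultimately show ?thesis using re by (auto simp: complex_eq_iff)
qed

lemma higher_deriv_of_real_restriction:
  fixes f :: "complex \<Rightarrow> complex" and \<phi> :: "real \<Rightarrow> real"
  assumes "f holomorphic_on S" "open S"
    and "\<And>x. complex_of_real x \<in> S \<Longrightarrow> of_real (\<phi> x) = f (of_real x)"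
    and "complex_of_real x \<in> S"
  shows "((deriv ^^ j) \<phi> has_real_derivative (deriv ^^ Suc j) \<phi> x) (at x) \<and>
         of_real ((deriv ^^ j) \<phi> x) = (deriv ^^ j) f (of_real x)"
  using assms
proof (induction j arbitrary: f \<phi>)
  case 0
  then show ?case using deriv_of_real_restriction[of f S \<phi> x] by auto
next
  case (Suc j)
  have "of_real (deriv \<phi> y) = deriv f (of_real y)" if "complex_of_real y \<in> S" for y
    using deriv_of_real_restriction[of f S \<phi> y] Suc.prems that by auto
  then show ?case
    using Suc.IH[of "deriv f" "deriv \<phi>"] Suc.prems
    by (simp add: funpow_swap1 holomorphic_deriv)
qed

lemma higher_deriv_poly: "(deriv ^^ k) (poly (p :: complex poly)) = poly ((pderiv ^^ k) p)"
proof (induction k arbitrary: p)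
  case (Suc k)
  have "deriv (poly p) = poly (pderiv p)" by (auto intro!: DERIV_imp_deriv)
  then show ?case using Suc[of "pderiv p"] by (simp add: funpow_swap1)
qed simp

lemma higher_pderiv_degree:
  fixes p :: "'a::{field_char_0} poly"
  assumes "p \<noteq> 0"
  shows "\<exists>c. c \<noteq> 0 \<and> (pderiv ^^ degree p) p = [:c:]"
  using assms
proof (induction "degree p" arbitrary: p)
  case 0
  then obtain c where "p = [:c:]" by (metis degree_eq_zeroE)
  then show ?case using 0 by auto
next
  case (Suc d)
  have "degree (pderiv p) = d" using Suc.hyps(2) by (simp add: degree_pderiv)
  moreover have "pderiv p \<noteq> 0" using Suc.hyps(2) by (simp add: pderiv_eq_0_iff)
  ultimately show ?case using Suc.hyps(1)[of "pderiv p"] Suc.hyps(2)[symmetric]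
    by (simp add: funpow_Suc_right del: funpow.simps)
qed


text \<open>
  Dividing by \<open>z\<close> removes the zero of \<open>z * Q z\<close> at the origin; afterwards the derivative of order
  \<^term>\<open>degree Q\<close> is close to a nonzero constant on the whole interval.
\<close>

theorem sum_zero_mult_le_degree:
  fixes Q :: "real poly" and A B r :: real
  assumes "0 < r" "r < A" "Q \<noteq> 0"
  defines "N \<equiv> (\<Union>x\<in>{A..B}. ball (complex_of_real x) r)"
  shows "\<exists>\<eta>>0. \<forall>\<phi> f c. c \<noteq> 0 \<longrightarrow> f holomorphic_on N \<longrightarrow>
     (\<forall>x. complex_of_real x \<in> N \<longrightarrow> of_real (\<phi> x) = f (of_real x)) \<longrightarrow>
     (\<forall>z\<in>N. norm (of_real c * f z - z * poly (map_poly of_real Q) z) < \<eta>) \<longrightarrow>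
     finite {x \<in> {A..B}. \<phi> x = 0} \<and>
     (\<Sum>x\<in>{x \<in> {A..B}. \<phi> x = 0}. zero_mult \<phi> x) \<le> enat (degree Q)"
proof -
  define d where "d = degree Q"
  define Qc where "Qc = map_poly complex_of_real Q"
  have Qc: "Qc \<noteq> 0" "degree Qc = d"
    using \<open>Q \<noteq> 0\<close> by (auto simp: Qc_def d_def map_poly_eq_0_iff degree_map_poly)
  obtain k where k: "k \<noteq> 0" "(pderiv ^^ d) Qc = [:k:]"
    using higher_pderiv_degree[OF Qc(1)] Qc(2) by auto
  have dQ: "(deriv ^^ d) (poly Qc) z = k" for z
    using k(2) by (simp add: higher_deriv_poly)
  \<comment> \<open>Cauchy's estimate of order \<open>d\<close> on a disc of radius
    \<open>r\<close>, for a function bounded by \<open>\<eta> / (A - r)\<close>, then gives exactly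
    half of \<open>norm k\<close>. The factor \<open>A - r\<close> is the lower bound of
    \<open>norm z\<close> on \<open>N\<close>, lost in the division by \<open>z\<close>.\<close>
  define \<eta> where "\<eta> = norm k * r ^ d * (A - r) / (2 * fact d)"
  have "\<eta> > 0" using assms(1-3) k by (simp add: \<eta>_def)
  have oN: "open N" by (auto simp: N_def)
  have AB: "complex_of_real x \<in> N" if "x \<in> {A..B}" for x
    using that \<open>0 < r\<close> by (auto simp: N_def intro!: bexI[of _ x])
  have Nge: "A - r \<le> norm z" if zN: "z \<in> N" for z
  proof -
    obtain x where x: "x \<in> {A..B}" "dist (complex_of_real x) z < r"
      using zN unfolding N_def UN_iff mem_ball by blast
    have "x \<le> norm z + r"
      using norm_triangle_sub[of "complex_of_real x" z] x assms by (auto simp: dist_norm)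
    then show ?thesis using x by auto
  qed
  have N0: "z \<noteq> 0" if "z \<in> N" for z using Nge[OF that] \<open>r < A\<close> by auto
  show ?thesis
  proof (intro exI[of _ \<eta>] conjI allI impI, fact)
    fix \<phi> :: "real \<Rightarrow> real" and f :: "complex \<Rightarrow> complex" and c :: real
    assume c: "c \<noteq> 0" and f: "f holomorphic_on N"
      and eq: "\<forall>x. complex_of_real x \<in> N \<longrightarrow> of_real (\<phi> x) = f (of_real x)"
      and bd: "\<forall>z\<in>N. norm (of_real c * f z - z * poly (map_poly of_real Q) z) < \<eta>"
    \<comment> \<open>\<open>c\<close> is a normalising factor: it is \<open>- 1 / eps\<close> for
      the displacement function and 1 for the Abelian integral.\<close>
    define u where "u z = of_real c / z" for z :: complex
    define E where "E z = f z * u z" for z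
    define g where "g x = \<phi> x * (c / x)" for x
    have u: "u holomorphic_on N" unfolding u_def by (intro holomorphic_intros) (use N0 in auto)
    have E: "E holomorphic_on N" unfolding E_def by (intro holomorphic_intros f u)
    have Eg: "of_real (g x) = E (of_real x)" if "complex_of_real x \<in> N" for x
      using eq that by (simp add: E_def g_def u_def)
    have close: "norm (E z - poly Qc z) \<le> \<eta> / (A - r)" if "z \<in> N" for z
    proof -
      have "E z - poly Qc z = (of_real c * f z - z * poly Qc z) / z"
        using N0[OF that] by (simp add: E_def u_def field_simps)
      also have "norm \<dots> \<le> \<eta> / (A - r)"
        unfolding norm_divide using bd that Nge[OF that] assms(1-3) \<open>\<eta> > 0\<close>
        by (intro frac_le) (auto simp: Qc_def less_imp_le)
      finally show ?thesis .
    qed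
    have g: "((deriv ^^ j) g has_real_derivative (deriv ^^ Suc j) g x) (at x) \<and>
         of_real ((deriv ^^ j) g x) = (deriv ^^ j) E (of_real x)" if "x \<in> {A..B}" for j x
      by (rule higher_deriv_of_real_restriction[OF E oN Eg AB[OF that]])
    have ne: "(deriv ^^ d) g x \<noteq> 0" if x: "x \<in> {A..B}" for x
    proof
      assume "(deriv ^^ d) g x = 0"
      then have E0: "(deriv ^^ d) E (of_real x) = 0" using g[OF x, of d] by simp
      have sub: "ball (complex_of_real x) r \<subseteq> N" using x by (auto simp: N_def)
      have "norm ((deriv ^^ d) (\<lambda>z. E z - poly Qc z) (of_real x)) \<le> fact d * (\<eta> / (A - r)) / r ^ d"
      proof (cases "d = 0")
        case True
        then show ?thesis using close[OF AB[OF x]] by simp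
      next
        case False
        \<comment> \<open>The closed disc of radius \<open>r\<close> need not lie in
          \<open>N\<close>, so the estimate is made for every \<open>s < r\<close>, and then
          \<open>s\<close> tends to \<open>r\<close>.\<close>
        have ev: "norm ((deriv ^^ d) (\<lambda>z. E z - poly Qc z) (of_real x)) \<le> fact d * (\<eta> / (A - r)) / s ^ d"
          if s: "0 < s" "s < r" for s
        proof (rule Cauchy_inequality)
          show "(\<lambda>z. E z - poly Qc z) holomorphic_on ball (of_real x) s"
            by (intro holomorphic_intros holomorphic_on_subset[OF E]) (use s sub in auto)
          show "continuous_on (cball (of_real x) s) (\<lambda>z. E z - poly Qc z)"
            by (intro continuous_intros holomorphic_on_imp_continuous_on holomorphic_on_subset[OF E])
              (use s sub in force)
          show "norm (E z - poly Qc z) \<le> \<eta> / (A - r)" if "norm (of_real x - z) = s" for z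
            using close sub that s by (force simp: dist_norm)
        qed (use s in auto)
        show ?thesis
        proof (rule tendsto_lowerbound)
          show "((\<lambda>s. fact d * (\<eta> / (A - r)) / s ^ d) \<longlongrightarrow> fact d * (\<eta> / (A - r)) / r ^ d) (at_left r)"
            using \<open>0 < r\<close> by (intro tendsto_intros) auto
          show "\<forall>\<^sub>F s in at_left r. norm ((deriv ^^ d) (\<lambda>z. E z - poly Qc z) (of_real x)) \<le>
              fact d * (\<eta> / (A - r)) / s ^ d"
            using ev \<open>0 < r\<close> eventually_at_left[of 0 r] by auto
        qed simp
      qed
      also have "(deriv ^^ d) (\<lambda>z. E z - poly Qc z) (of_real x) = - k"
        by (subst higher_deriv_diff[OF E _ oN AB[OF x]]) (auto simp: dQ E0 intro!: holomorphic_intros)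
      also have "fact d * (\<eta> / (A - r)) / r ^ d = norm k / 2"
        using assms(1-3) by (simp add: \<eta>_def field_simps)
      finally show False using k by simp
    qed
    \<comment> \<open>By the Leibniz rule a holomorphic factor cannot destroy vanishing derivatives,
      so passing from \<open>\<phi>\<close> to \<open>g\<close> loses no multiplicity.\<close>
    have mult: "zero_mult \<phi> x \<le> zero_mult g x" if x: "x \<in> {A..B}" for x
    proof (rule zero_mult_mono, intro allI impI)
      fix m j assume m: "\<forall>j<m. (deriv ^^ j) \<phi> x = 0" and j: "j < m"
      have f0: "(deriv ^^ i) f (of_real x) = 0" if "i < m" for i
        using higher_deriv_of_real_restriction[OF f oN _ AB[OF x], of \<phi> i] eq m that
        by (metis of_real_0)
      have "(deriv ^^ j) E (of_real x) = 0"
        unfolding E_def using higher_deriv_mult[OF f u oN AB[OF x], of j] f0 j by auto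
      then show "(deriv ^^ j) g x = 0" using g[OF x, of j] by simp
    qed
    have Z: "{x \<in> {A..B}. \<phi> x = 0} = {x \<in> {A..B}. g x = 0}"
      using c assms(1-3) by (auto simp: g_def)
    have "finite {x \<in> {A..B}. g x = 0} \<and> (\<Sum>x\<in>{x \<in> {A..B}. g x = 0}. zero_mult g x) \<le> enat d"
      by (rule sum_zero_mult_le) (use g ne in auto)
    moreover have "(\<Sum>x\<in>{x \<in> {A..B}. g x = 0}. zero_mult \<phi> x) \<le> (\<Sum>x\<in>{x \<in> {A..B}. g x = 0}. zero_mult g x)"
      by (intro sum_mono mult) auto
    ultimately show "finite {x \<in> {A..B}. \<phi> x = 0}"
      "(\<Sum>x\<in>{x \<in> {A..B}. \<phi> x = 0}. zero_mult \<phi> x) \<le> enat (degree Q)"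
      unfolding Z d_def by auto
  qed
qed

section \<open>Holomorphic dependence on the initial value\<close>

text \<open>Only the initial value is complex; the time \<open>\<theta>\<close> stays real.
  Solutions start in \<open>V\<close> and move by at most \<open>T * m\<close>, which by
  \<open>near\<close> keeps them in \<open>W\<close>, where the equation is controlled. The
  condition \<open>T * L \<le> 1 / 2\<close> makes the Picard map a contraction on the whole
  interval at once, and \<open>real\<close> returns real solutions for real initial values.\<close>

locale picard =
  fixes \<kappa> \<kappa>' :: "complex \<Rightarrow> real \<Rightarrow> complex" and W V :: "complex set" and T m L :: real
  assumes T: "0 < T"
    and V: "open V" "convex V"
    and near: "\<And>R R'. R \<in> V \<Longrightarrow> norm (R' - R) \<le> T * m \<Longrightarrow> R' \<in> W"
    and cont: "continuous_on (W \<times> {-T..T}) (\<lambda>(R, \<theta>). \<kappa> R \<theta>)"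
    and cont': "continuous_on (W \<times> {-T..T}) (\<lambda>(R, \<theta>). \<kappa>' R \<theta>)"
    and der: "\<And>R \<theta>. R \<in> W \<Longrightarrow> \<theta> \<in> {-T..T} \<Longrightarrow> ((\<lambda>R. \<kappa> R \<theta>) has_field_derivative \<kappa>' R \<theta>) (at R)"
    and bound: "\<And>R \<theta>. R \<in> W \<Longrightarrow> \<theta> \<in> {-T..T} \<Longrightarrow> norm (\<kappa> R \<theta>) \<le> m"
    and lip: "\<And>R R' \<theta>. R \<in> W \<Longrightarrow> R' \<in> W \<Longrightarrow> \<theta> \<in> {-T..T} \<Longrightarrow> norm (\<kappa> R \<theta> - \<kappa> R' \<theta>) \<le> L * norm (R - R')"
    and m: "0 \<le> m" and L: "0 \<le> L" "T * L \<le> 1 / 2"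
    and real: "\<And>R \<theta>. R \<in> W \<Longrightarrow> \<theta> \<in> {-T..T} \<Longrightarrow> R \<in> \<real> \<Longrightarrow> \<kappa> R \<theta> \<in> \<real>"
begin

text \<open>
  The substitution \<open>s = \<theta> \<sigma>\<close> puts all Picard integrals on the fixed interval \<open>[0, 1]\<close>, and covers
  negative \<open>\<theta>\<close> as well.
\<close>

primrec iter :: "nat \<Rightarrow> real \<Rightarrow> complex \<Rightarrow> complex" where
  "iter 0 = (\<lambda>\<theta> R. R)"
| "iter (Suc k) = (\<lambda>\<theta> R. R + of_real \<theta> * integral (cbox 0 1) (\<lambda>\<sigma>. \<kappa> (iter k (\<theta> * \<sigma>) R) (\<theta> * \<sigma>)))"

text \<open>The formal derivative of \<open>iter\<close> in the initial value, obtained by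
  differentiating under the integral sign.\<close>

primrec diter :: "nat \<Rightarrow> real \<Rightarrow> complex \<Rightarrow> complex" where
  "diter 0 = (\<lambda>\<theta> R. 1)"
| "diter (Suc k) = (\<lambda>\<theta> R. 1 + of_real \<theta> * integral (cbox 0 1)
     (\<lambda>\<sigma>. \<kappa>' (iter k (\<theta> * \<sigma>) R) (\<theta> * \<sigma>) * diter k (\<theta> * \<sigma>) R))"

lemma scaled_in: "\<theta> \<in> {-T..T} \<Longrightarrow> \<sigma> \<in> cbox 0 1 \<Longrightarrow> \<theta> * \<sigma> \<in> {-T..T}" for \<theta> \<sigma> :: real
proof -
  assume "\<theta> \<in> {-T..T}" "\<sigma> \<in> cbox 0 1"
  then have "\<bar>\<theta>\<bar> * \<bar>\<sigma>\<bar> \<le> T * 1" using T by (intro mult_mono) (auto simp: cbox_interval)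
  then show ?thesis by (auto simp: abs_mult[symmetric] abs_le_iff)
qed

lemma norm_scaled_integral_le:
  assumes "\<theta> \<in> {-T..T}" "continuous_on (cbox 0 1) g" "\<And>\<sigma>. \<sigma> \<in> cbox 0 1 \<Longrightarrow> norm (g \<sigma>) \<le> B" "0 \<le> B"
  shows "norm (of_real \<theta> * integral (cbox 0 (1::real)) g :: complex) \<le> T * B"
proof -
  have "norm (integral (cbox 0 1) g) \<le> B"
    using integral_bound[of 0 1 g B] assms by auto
  then have "\<bar>\<theta>\<bar> * norm (integral (cbox 0 1) g) \<le> T * B"
    using assms T by (intro mult_mono) auto
  then show ?thesis by (simp add: norm_mult)
qed

lemma continuous_on_scaled:
  assumes c: "continuous_on ({-T..T} \<times> V) (\<lambda>(\<theta>, R). f \<theta> R)"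
    and f: "\<forall>\<theta>\<in>{-T..T}. \<forall>R\<in>V. f \<theta> R \<in> W"
    and g: "continuous_on (W \<times> {-T..T}) (\<lambda>(R, \<theta>). g R \<theta>)"
  shows "continuous_on ({-T..T} \<times> V) (\<lambda>(\<theta>, R). g (f \<theta> R) \<theta>)"
proof -
  have "continuous_on ({-T..T} \<times> V) (\<lambda>x. (\<lambda>(R, \<theta>). g R \<theta>) ((\<lambda>(\<theta>, R). f \<theta> R) x, fst x))"
    by (rule continuous_on_compose2[OF g]) (use f in \<open>auto intro!: continuous_intros c\<close>)
  then show ?thesis by (simp add: case_prod_unfold)
qed

text \<open>The forms in which continuity of the integrand is used: jointly, after integration, in
  \<open>\<sigma>\<close> alone for integrability, and in the initial value together with
  \<open>\<sigma>\<close> for differentiation under the integral.\<close>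

lemma continuous_on_scaled_integral:
  assumes c: "continuous_on ({-T..T} \<times> V) (\<lambda>(\<theta>, R). f \<theta> R :: complex)"
  shows "continuous_on (({-T..T} \<times> V) \<times> cbox 0 1) (\<lambda>((\<theta>, R), \<sigma>). f (\<theta> * \<sigma>) R)" (is ?A)
    and "continuous_on ({-T..T} \<times> V) (\<lambda>(\<theta>, R). of_real \<theta> * integral (cbox 0 1) (\<lambda>\<sigma>. f (\<theta> * \<sigma>) R))" (is ?B)
    and "\<theta> \<in> {-T..T} \<Longrightarrow> R \<in> V \<Longrightarrow> continuous_on (cbox 0 1) (\<lambda>\<sigma>. f (\<theta> * \<sigma>) R)"
    and "\<theta> \<in> {-T..T} \<Longrightarrow> continuous_on (V \<times> cbox 0 1) (\<lambda>(R, \<sigma>). f (\<theta> * \<sigma>) R)"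
proof -
  have "continuous_on (({-T..T} \<times> V) \<times> cbox 0 1) (\<lambda>x. (\<lambda>(\<theta>, R). f \<theta> R) (fst (fst x) * snd x, snd (fst x)))"
    by (rule continuous_on_compose2[OF c]) (use scaled_in in \<open>auto intro!: continuous_intros\<close>)
  then show A: ?A by (simp add: case_prod_unfold)
  have "continuous_on ({-T..T} \<times> V) (\<lambda>x. integral (cbox 0 1) ((\<lambda>(\<theta>, R) \<sigma>. f (\<theta> * \<sigma>) R) x))"
    using A by (intro integral_continuous_on_param) (simp add: case_prod_unfold)
  then show ?B
    by (auto simp: case_prod_unfold intro!: continuous_intros)
  show "continuous_on (cbox 0 1) (\<lambda>\<sigma>. f (\<theta> * \<sigma>) R)" if "\<theta> \<in> {-T..T}" "R \<in> V"
  proof -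
    have "continuous_on (cbox 0 1) (\<lambda>\<sigma>. (\<lambda>((\<theta>, R), \<sigma>). f (\<theta> * \<sigma>) R) ((\<theta>, R), \<sigma>))"
      by (rule continuous_on_compose2[OF A continuous_on_Pair[OF continuous_on_const continuous_on_id]])
        (use that in auto)
    then show ?thesis by simp
  qed
  show "continuous_on (V \<times> cbox 0 1) (\<lambda>(R, \<sigma>). f (\<theta> * \<sigma>) R)" if "\<theta> \<in> {-T..T}"
  proof -
    have "continuous_on (V \<times> cbox 0 1) (\<lambda>x. (\<lambda>((\<theta>, R), \<sigma>). f (\<theta> * \<sigma>) R) ((\<theta>, fst x), snd x))"
      by (rule continuous_on_compose2[OF A]) (use that in \<open>auto intro!: continuous_intros\<close>)
    then show ?thesis by (simp add: case_prod_unfold)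
  qed
qed

text \<open>One induction for all three properties: the next integrand is controlled only if the
  present iterate is continuous and stays in \<open>W\<close>, which the distance bound
  provides.\<close>

lemma iter_props:
  "continuous_on ({-T..T} \<times> V) (\<lambda>(\<theta>, R). iter k \<theta> R) \<and>
   (\<forall>\<theta>\<in>{-T..T}. \<forall>R\<in>V. norm (iter k \<theta> R - R) \<le> T * m \<and> (R \<in> \<real> \<longrightarrow> iter k \<theta> R \<in> \<real>))"
proof (induction k)
  case 0
  show ?case using T m by (auto simp: case_prod_unfold intro!: continuous_intros)
next
  case (Suc k)
  then have c: "continuous_on ({-T..T} \<times> V) (\<lambda>(\<theta>, R). iter k \<theta> R)"
    and W: "\<forall>\<theta>\<in>{-T..T}. \<forall>R\<in>V. iter k \<theta> R \<in> W"
    and re: "\<And>\<theta> R. \<theta> \<in> {-T..T} \<Longrightarrow> R \<in> V \<Longrightarrow> R \<in> \<real> \<Longrightarrow> iter k \<theta> R \<in> \<real>"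
    using near by auto
  note k = continuous_on_scaled[OF c W cont]
  note ks = continuous_on_scaled_integral[OF k]
  have "norm (iter (Suc k) \<theta> R - R) \<le> T * m" if "\<theta> \<in> {-T..T}" "R \<in> V" for \<theta> R
  proof -
    have "norm (of_real \<theta> * integral (cbox 0 1) (\<lambda>\<sigma>. \<kappa> (iter k (\<theta> * \<sigma>) R) (\<theta> * \<sigma>))) \<le> T * m"
      by (intro norm_scaled_integral_le that ks(3) m bound W[rule_format] scaled_in)
    then show ?thesis by simp
  qed
  moreover have "iter (Suc k) \<theta> R \<in> \<real>" if "\<theta> \<in> {-T..T}" "R \<in> V" "R \<in> \<real>" for \<theta> R
  proof -
    have "integral (cbox 0 1) (\<lambda>\<sigma>. \<kappa> (iter k (\<theta> * \<sigma>) R) (\<theta> * \<sigma>)) =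
        integral (cbox 0 1) (\<lambda>\<sigma>. complex_of_real (Re (\<kappa> (iter k (\<theta> * \<sigma>) R) (\<theta> * \<sigma>))))"
      by (intro integral_cong of_real_Re[symmetric] real W[rule_format] re) (use scaled_in that in auto)
    also have "\<dots> = of_real (integral (cbox 0 1) (\<lambda>\<sigma>. Re (\<kappa> (iter k (\<theta> * \<sigma>) R) (\<theta> * \<sigma>))))"
      using integral_linear[OF integrable_continuous bounded_linear_of_real, OF continuous_on_Re[OF ks(3)[OF that(1,2)]]]
      by (simp add: o_def)
    finally show ?thesis using that by simp
  qed
  moreover have "continuous_on ({-T..T} \<times> V) (\<lambda>(\<theta>, R). iter (Suc k) \<theta> R)"
    using continuous_on_add[OF continuous_on_snd[OF continuous_on_id] ks(2)]
    by (simp add: case_prod_unfold)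
  ultimately show ?case by auto
qed

lemma iter_in: "\<forall>\<theta>\<in>{-T..T}. \<forall>R\<in>V. iter k \<theta> R \<in> W"
  using iter_props[of k] near by auto

lemma continuous_iter: "continuous_on ({-T..T} \<times> V) (\<lambda>(\<theta>, R). iter k \<theta> R)"
  using iter_props[of k] by auto

lemma diter:
  "continuous_on ({-T..T} \<times> V) (\<lambda>(\<theta>, R). diter k \<theta> R) \<and>
   (\<forall>\<theta>\<in>{-T..T}. \<forall>R\<in>V. (iter k \<theta> has_field_derivative diter k \<theta> R) (at R))"
proof (induction k)
  case 0
  show ?case by (auto simp: case_prod_unfold intro!: continuous_intros derivative_eq_intros)
next
  case (Suc k)
  then have c: "continuous_on ({-T..T} \<times> V) (\<lambda>(\<theta>, R). diter k \<theta> R)" by auto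
  have "continuous_on ({-T..T} \<times> V) (\<lambda>(\<theta>, R). \<kappa>' (iter k \<theta> R) \<theta> * diter k \<theta> R)"
    using continuous_on_mult[OF continuous_on_scaled[OF continuous_iter iter_in cont'] c]
    by (simp add: case_prod_unfold)
  note ks = continuous_on_scaled_integral[OF this]
  note js = continuous_on_scaled_integral[OF continuous_on_scaled[OF continuous_iter[of k] iter_in cont]]
  have "(iter (Suc k) \<theta> has_field_derivative diter (Suc k) \<theta> R) (at R)"
    if "\<theta> \<in> {-T..T}" "R \<in> V" for \<theta> R
  proof -
    have "((\<lambda>R. integral (cbox 0 1) (\<lambda>\<sigma>. \<kappa> (iter k (\<theta> * \<sigma>) R) (\<theta> * \<sigma>))) has_field_derivative
        integral (cbox 0 1) (\<lambda>\<sigma>. \<kappa>' (iter k (\<theta> * \<sigma>) R) (\<theta> * \<sigma>) * diter k (\<theta> * \<sigma>) R)) (at R within V)"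
    proof (rule leibniz_rule_field_derivative)
      fix R \<sigma> assume R: "R \<in> V" "\<sigma> \<in> cbox 0 (1::real)"
      have s: "\<theta> * \<sigma> \<in> {-T..T}" using scaled_in that R by blast
      have "((\<lambda>R. \<kappa> R (\<theta> * \<sigma>)) has_field_derivative \<kappa>' (iter k (\<theta> * \<sigma>) R) (\<theta> * \<sigma>)) (at (iter k (\<theta> * \<sigma>) R))"
        by (intro der iter_in[rule_format] s R)
      moreover have "(iter k (\<theta> * \<sigma>) has_field_derivative diter k (\<theta> * \<sigma>) R) (at R within V)"
        by (rule has_field_derivative_at_within[OF Suc[THEN conjunct2, rule_format, OF s R(1)]])
      ultimately show "((\<lambda>R. \<kappa> (iter k (\<theta> * \<sigma>) R) (\<theta> * \<sigma>)) has_field_derivative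
          \<kappa>' (iter k (\<theta> * \<sigma>) R) (\<theta> * \<sigma>) * diter k (\<theta> * \<sigma>) R) (at R within V)"
        by (rule DERIV_chain2)
    qed (use that V js(3) ks(4) in \<open>auto intro!: integrable_continuous_interval\<close>)
    then have "((\<lambda>R. integral (cbox 0 1) (\<lambda>\<sigma>. \<kappa> (iter k (\<theta> * \<sigma>) R) (\<theta> * \<sigma>))) has_field_derivative
        integral (cbox 0 1) (\<lambda>\<sigma>. \<kappa>' (iter k (\<theta> * \<sigma>) R) (\<theta> * \<sigma>) * diter k (\<theta> * \<sigma>) R)) (at R)"
      unfolding at_within_open[OF that(2) V(1)] .
    then show ?thesis by (auto intro!: derivative_eq_intros)
  qed
  moreover have "continuous_on ({-T..T} \<times> V) (\<lambda>(\<theta>, R). diter (Suc k) \<theta> R)"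
    using continuous_on_add[OF continuous_on_const ks(2)] by (simp add: case_prod_unfold)
  ultimately show ?case by auto
qed

lemma holomorphic_iter: "\<theta> \<in> {-T..T} \<Longrightarrow> iter k \<theta> holomorphic_on V"
  unfolding holomorphic_on_def
  using diter[of k] by (meson field_differentiable_at_within field_differentiable_def)

text \<open>The contraction property of the Picard map: for a fixed initial value it halves the sup
  distance over \<open>\<theta>\<close>, because \<open>T * L \<le> 1 / 2\<close>.\<close>

lemma norm_kappa_integral_diff:
  assumes f: "continuous_on ({-T..T} \<times> V) (\<lambda>(\<theta>, R). f \<theta> R)" "\<forall>\<theta>\<in>{-T..T}. \<forall>R\<in>V. f \<theta> R \<in> W"
    and g: "continuous_on ({-T..T} \<times> V) (\<lambda>(\<theta>, R). g \<theta> R)" "\<forall>\<theta>\<in>{-T..T}. \<forall>R\<in>V. g \<theta> R \<in> W"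
    and fg: "\<And>\<theta>. \<theta> \<in> {-T..T} \<Longrightarrow> norm (f \<theta> R - g \<theta> R) \<le> B" and "\<theta> \<in> {-T..T}" "R \<in> V"
  shows "norm (of_real \<theta> * integral (cbox 0 1) (\<lambda>\<sigma>. \<kappa> (f (\<theta> * \<sigma>) R) (\<theta> * \<sigma>)) -
    of_real \<theta> * integral (cbox 0 1) (\<lambda>\<sigma>. \<kappa> (g (\<theta> * \<sigma>) R) (\<theta> * \<sigma>))) \<le> B / 2"
proof -
  have "0 \<le> B" using order_trans[OF norm_ge_zero fg[of 0]] T by simp
  note cf = continuous_on_scaled_integral(3)[OF continuous_on_scaled[OF f cont] assms(6,7)]
  note cg = continuous_on_scaled_integral(3)[OF continuous_on_scaled[OF g cont] assms(6,7)]
  have "norm (of_real \<theta> * integral (cbox 0 1)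
      (\<lambda>\<sigma>. \<kappa> (f (\<theta> * \<sigma>) R) (\<theta> * \<sigma>) - \<kappa> (g (\<theta> * \<sigma>) R) (\<theta> * \<sigma>))) \<le> T * (L * B)"
  proof (rule norm_scaled_integral_le)
    fix \<sigma> :: real assume "\<sigma> \<in> cbox 0 1"
    then have s: "\<theta> * \<sigma> \<in> {-T..T}" using scaled_in assms(6) by blast
    have "norm (\<kappa> (f (\<theta> * \<sigma>) R) (\<theta> * \<sigma>) - \<kappa> (g (\<theta> * \<sigma>) R) (\<theta> * \<sigma>)) \<le> L * norm (f (\<theta> * \<sigma>) R - g (\<theta> * \<sigma>) R)"
      using s assms by (intro lip) auto
    also have "\<dots> \<le> L * B" using L fg[OF s] by (intro mult_left_mono) auto
    finally show "norm (\<kappa> (f (\<theta> * \<sigma>) R) (\<theta> * \<sigma>) - \<kappa> (g (\<theta> * \<sigma>) R) (\<theta> * \<sigma>)) \<le> L * B" .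
  qed (use assms L \<open>0 \<le> B\<close> cf cg in \<open>auto intro!: continuous_intros\<close>)
  also have "T * (L * B) = (T * L) * B" by simp
  also have "\<dots> \<le> 1 / 2 * B" using L \<open>0 \<le> B\<close> by (intro mult_right_mono) auto
  finally show ?thesis
    using cf cg by (subst (asm) integral_diff) (auto intro!: integrable_continuous_interval simp: right_diff_distrib)
qed

lemma iter_step:
  assumes "\<theta> \<in> {-T..T}" "R \<in> V"
  shows "norm (iter (Suc k) \<theta> R - iter k \<theta> R) \<le> T * m * (1 / 2) ^ k"
  using assms(1)
proof (induction k arbitrary: \<theta>)
  case 0
  then show ?case using iter_props[of 1] assms by auto
next
  case (Suc k)
  from norm_kappa_integral_diff[OF continuous_iter[of "Suc k"] iter_in continuous_iter[of k] iter_in Suc.IH Suc.prems assms(2)]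
  show ?case by simp
qed

text \<open>The limit of the iterates as a telescoping series, so that the Weierstrass test with the
  geometric majorant of \<open>iter_step\<close> gives uniform convergence.\<close>

definition sol :: "real \<Rightarrow> complex \<Rightarrow> complex" where
  "sol \<theta> R = R + (\<Sum>i. iter (Suc i) \<theta> R - iter i \<theta> R)"

lemma uniform_limit_iter:
  "uniform_limit ({-T..T} \<times> V) (\<lambda>k (\<theta>, R). iter k \<theta> R) (\<lambda>(\<theta>, R). sol \<theta> R) sequentially"
proof -
  have "uniform_limit ({-T..T} \<times> V) (\<lambda>n x. \<Sum>i<n. (\<lambda>i (\<theta>, R). iter (Suc i) \<theta> R - iter i \<theta> R) i x)
      (\<lambda>x. suminf (\<lambda>i. (\<lambda>i (\<theta>, R). iter (Suc i) \<theta> R - iter i \<theta> R) i x)) sequentially"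
    by (rule Weierstrass_m_test[where M = "\<lambda>k. T * m * (1 / 2) ^ k"])
      (use iter_step in \<open>auto simp del: iter.simps intro!: summable_mult summable_geometric\<close>)
  then have "uniform_limit ({-T..T} \<times> V) (\<lambda>n x. snd x + (\<Sum>i<n. (\<lambda>i (\<theta>, R). iter (Suc i) \<theta> R - iter i \<theta> R) i x))
      (\<lambda>x. snd x + suminf (\<lambda>i. (\<lambda>i (\<theta>, R). iter (Suc i) \<theta> R - iter i \<theta> R) i x)) sequentially"
    by (intro uniform_limit_intros)
  moreover have "R + (\<Sum>i<n. iter (Suc i) \<theta> R - iter i \<theta> R) = iter n \<theta> R" for n \<theta> R
    using sum_lessThan_telescope[of "\<lambda>i. iter i \<theta> R" n] by (simp del: iter.simps(2))
  ultimately show ?thesis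
    by (simp add: case_prod_unfold sol_def[abs_def] del: iter.simps(2))
qed

lemma tendsto_iter: "\<theta> \<in> {-T..T} \<Longrightarrow> R \<in> V \<Longrightarrow> (\<lambda>k. iter k \<theta> R) \<longlonglongrightarrow> sol \<theta> R"
  using tendsto_uniform_limitI[OF uniform_limit_iter, of "(\<theta>, R)"] by auto

lemma continuous_sol: "continuous_on ({-T..T} \<times> V) (\<lambda>(\<theta>, R). sol \<theta> R)"
  by (rule uniform_limit_theorem[OF always_eventually[OF allI[OF continuous_iter]] uniform_limit_iter]) simp

lemma norm_sol_diff: "\<theta> \<in> {-T..T} \<Longrightarrow> R \<in> V \<Longrightarrow> norm (sol \<theta> R - R) \<le> T * m"
proof (rule tendsto_upperbound)
  assume *: "\<theta> \<in> {-T..T}" "R \<in> V"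
  show "(\<lambda>k. norm (iter k \<theta> R - R)) \<longlonglongrightarrow> norm (sol \<theta> R - R)"
    by (intro tendsto_intros tendsto_iter *)
  show "\<forall>\<^sub>F k in sequentially. norm (iter k \<theta> R - R) \<le> T * m"
    using iter_props * by (intro always_eventually) blast
qed simp

lemma sol_in: "\<forall>\<theta>\<in>{-T..T}. \<forall>R\<in>V. sol \<theta> R \<in> W"
  using norm_sol_diff near by blast

lemma sol_real: "\<theta> \<in> {-T..T} \<Longrightarrow> R \<in> V \<Longrightarrow> R \<in> \<real> \<Longrightarrow> sol \<theta> R \<in> \<real>"
proof (rule Lim_in_closed_set[OF closed_complex_Reals _ _ tendsto_iter])
  assume "\<theta> \<in> {-T..T}" "R \<in> V" "R \<in> \<real>"
  then show "\<forall>\<^sub>F k in sequentially. iter k \<theta> R \<in> \<real>"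
    using iter_props by (intro always_eventually) blast
qed auto

lemma holomorphic_sol:
  assumes "\<theta> \<in> {-T..T}" shows "sol \<theta> holomorphic_on V"
proof (rule holomorphic_uniform_sequence[OF V(1) holomorphic_iter[OF assms]])
  fix z assume "z \<in> V"
  then obtain d where d: "d > 0" "cball z d \<subseteq> V" using V open_contains_cball by blast
  have "uniform_limit V (\<lambda>k. iter k \<theta>) (sol \<theta>) sequentially"
    using uniform_limit_compose'[OF uniform_limit_iter, of "\<lambda>R. (\<theta>, R)" V] assms by auto
  then show "\<exists>d>0. cball z d \<subseteq> V \<and> uniform_limit (cball z d) (\<lambda>k. iter k \<theta>) (sol \<theta>) sequentially"
    using d uniform_limit_on_subset by blast
qed

text \<open>Both sides are limits of \<open>iter (Suc k) \<theta> R\<close>; for the right side the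
  contraction estimate carries uniform convergence through the integral.\<close>

lemma sol_integral_eq:
  assumes "\<theta> \<in> {-T..T}" "R \<in> V"
  shows "sol \<theta> R = R + of_real \<theta> * integral (cbox 0 1) (\<lambda>\<sigma>. \<kappa> (sol (\<theta> * \<sigma>) R) (\<theta> * \<sigma>))" (is "_ = ?r")
proof -
  have "(\<lambda>k. iter (Suc k) \<theta> R) \<longlonglongrightarrow> ?r"
  proof (rule metric_LIMSEQ_I)
    fix e :: real assume "e > 0"
    then have "\<forall>\<^sub>F k in sequentially. \<forall>x\<in>{-T..T} \<times> V. dist ((\<lambda>(\<theta>, R). iter k \<theta> R) x) ((\<lambda>(\<theta>, R). sol \<theta> R) x) < e"
      using uniform_limit_iter by (auto simp: uniform_limit_iff)
    then obtain N where "\<And>k x. k \<ge> N \<Longrightarrow> x \<in> {-T..T} \<times> V \<Longrightarrow>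
        dist ((\<lambda>(\<theta>, R). iter k \<theta> R) x) ((\<lambda>(\<theta>, R). sol \<theta> R) x) < e"
      unfolding eventually_sequentially by blast
    from this[of _ "(_, R)"] have N: "\<And>k \<theta>. k \<ge> N \<Longrightarrow> \<theta> \<in> {-T..T} \<Longrightarrow> norm (iter k \<theta> R - sol \<theta> R) < e"
      using assms(2) by (simp add: dist_norm)
    have "dist (iter (Suc k) \<theta> R) ?r < e" if "k \<ge> N" for k
    proof -
      have "norm (of_real \<theta> * integral (cbox 0 1) (\<lambda>\<sigma>. \<kappa> (iter k (\<theta> * \<sigma>) R) (\<theta> * \<sigma>)) -
         of_real \<theta> * integral (cbox 0 1) (\<lambda>\<sigma>. \<kappa> (sol (\<theta> * \<sigma>) R) (\<theta> * \<sigma>))) \<le> e / 2"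
        by (rule norm_kappa_integral_diff[OF continuous_iter iter_in continuous_sol sol_in _ assms])
          (use N[OF that] in \<open>auto intro: less_imp_le\<close>)
      then show ?thesis using \<open>e > 0\<close> by (simp add: dist_norm)
    qed
    then show "\<exists>N. \<forall>k\<ge>N. dist (iter (Suc k) \<theta> R) ?r < e" by blast
  qed
  moreover have "(\<lambda>k. iter (Suc k) \<theta> R) \<longlonglongrightarrow> sol \<theta> R"
    using tendsto_iter[OF assms] by (rule LIMSEQ_Suc)
  ultimately show ?thesis using LIMSEQ_unique by blast
qed

lemma sol_0: "R \<in> V \<Longrightarrow> sol 0 R = R"
  using sol_integral_eq[of 0 R] T by simp

lemma sol_ode:
  assumes "\<theta> \<in> {-T..T}" "R \<in> V"
  shows "((\<lambda>\<theta>. sol \<theta> R) has_vector_derivative \<kappa> (sol \<theta> R) \<theta>) (at \<theta> within {-T..T})"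
proof -
  define g where "g s = \<kappa> (sol s R) s" for s
  have g: "continuous_on {-T..T} g"
    unfolding g_def
    using continuous_on_compose2[OF continuous_on_scaled[OF continuous_sol sol_in cont]
        continuous_on_Pair[OF continuous_on_id continuous_on_const[of _ R]]] assms
    by auto
  \<comment> \<open>The antiderivative starts at \<open>-T\<close>, so that it serves positive and
    negative \<open>\<theta>\<close> alike; the substitution \<open>s = \<theta> * \<sigma>\<close>
    is undone below.\<close>
  define G where "G \<theta> = integral {-T..\<theta>} g" for \<theta>
  have G: "(G has_vector_derivative g s) (at s within {-T..T})" if "s \<in> {-T..T}" for s
    unfolding G_def by (rule integral_has_vector_derivative[OF g that])
  have eq: "sol \<theta> R = R + (G \<theta> - G 0)" if \<theta>: "\<theta> \<in> {-T..T}" for \<theta>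
  proof -
    have "((\<lambda>\<sigma>. of_real \<theta> * g (\<theta> * \<sigma>)) has_integral (G (\<theta> * 1) - G (\<theta> * 0))) {0..1}"
    proof (rule fundamental_theorem_of_calculus)
      fix \<sigma> :: real assume \<sigma>: "\<sigma> \<in> {0..1}"
      have s: "(\<lambda>\<sigma>. \<theta> * \<sigma>) ` {0..1} \<subseteq> {-T..T}" using scaled_in[OF \<theta>] by auto
      have 1: "((\<lambda>\<sigma>. \<theta> * \<sigma>) has_vector_derivative \<theta>) (at \<sigma> within {0..1})"
        by (auto intro!: derivative_eq_intros)
      have 2: "(G has_vector_derivative g (\<theta> * \<sigma>)) (at (\<theta> * \<sigma>) within (\<lambda>\<sigma>. \<theta> * \<sigma>) ` {0..1})"
        using s scaled_in[OF \<theta>] \<sigma> by (intro has_vector_derivative_within_subset[OF G]) auto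
      show "((\<lambda>\<sigma>. G (\<theta> * \<sigma>)) has_vector_derivative of_real \<theta> * g (\<theta> * \<sigma>)) (at \<sigma> within {0..1})"
        using vector_diff_chain_within[OF 1 2] by (simp add: o_def scaleR_conv_of_real)
    qed simp
    then have "integral {0..1} (\<lambda>\<sigma>. of_real \<theta> * g (\<theta> * \<sigma>)) = G \<theta> - G 0" by (metis integral_unique mult.right_neutral mult_zero_right)
    then show ?thesis using sol_integral_eq[OF \<theta> assms(2)] by (simp add: g_def del: mult_eq_0_iff)
  qed
  have "((\<lambda>\<theta>. R + (G \<theta> - G 0)) has_vector_derivative g \<theta>) (at \<theta> within {-T..T})"
    using G[OF assms(1)] by (auto intro!: derivative_eq_intros)
  then have "((\<lambda>\<theta>. sol \<theta> R) has_vector_derivative g \<theta>) (at \<theta> within {-T..T})"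
    by (rule has_vector_derivative_transform[OF assms(1), rotated]) (simp add: eq)
  then show ?thesis by (simp add: g_def)
qed

end

section \<open>Polynomials with continuous coefficients\<close>

text \<open>Polynomials in the radius whose coefficients depend on the angle. The uniform degree
  bound allows integration over the angle coefficient by coefficient.\<close>

definition poly_family :: "nat \<Rightarrow> (real \<Rightarrow> real poly) \<Rightarrow> bool" where
  "poly_family N p \<longleftrightarrow> (\<forall>\<theta>. degree (p \<theta>) \<le> N) \<and> (\<forall>k. continuous_on UNIV (\<lambda>\<theta>. coeff (p \<theta>) k))"

lemma poly_familyD:
  assumes "poly_family N p"
  shows "degree (p \<theta>) \<le> N" "continuous_on A (\<lambda>\<theta>. coeff (p \<theta>) k)"
  using assms continuous_on_subset[of UNIV _ A] by (auto simp: poly_family_def)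

lemma poly_family_mono: "poly_family N p \<Longrightarrow> N \<le> M \<Longrightarrow> poly_family M p"
  by (auto simp: poly_family_def intro: order_trans)

lemma poly_family_pCons:
  "continuous_on UNIV c \<Longrightarrow> poly_family N p \<Longrightarrow> poly_family (Suc N) (\<lambda>\<theta>. pCons (c \<theta>) (p \<theta>))"
  unfolding poly_family_def
proof safe
  fix k assume "continuous_on UNIV c" "\<forall>k. continuous_on UNIV (\<lambda>\<theta>. coeff (p \<theta>) k)"
  then show "continuous_on UNIV (\<lambda>\<theta>. coeff (pCons (c \<theta>) (p \<theta>)) k)" by (cases k) auto
qed (auto intro!: order_trans[OF degree_pCons_le])

lemma poly_family_constant:
  assumes "continuous_on UNIV c" shows "poly_family N (\<lambda>\<theta>. [:c \<theta>:])"
  unfolding poly_family_def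
proof safe
  fix k show "continuous_on UNIV (\<lambda>\<theta>. coeff [:c \<theta>:] k)" using assms by (cases k) auto
qed auto

lemma poly_family_0: "poly_family N (\<lambda>\<theta>. 0)"
  by (auto simp: poly_family_def)

lemma poly_family_smult:
  "continuous_on UNIV c \<Longrightarrow> poly_family N p \<Longrightarrow> poly_family N (\<lambda>\<theta>. smult (c \<theta>) (p \<theta>))"
  by (auto simp: poly_family_def intro!: continuous_intros order_trans[OF degree_smult_le])

lemma poly_family_add:
  "poly_family N p \<Longrightarrow> poly_family N q \<Longrightarrow> poly_family N (\<lambda>\<theta>. p \<theta> + q \<theta>)"
  by (auto simp: poly_family_def intro!: continuous_intros degree_add_le)

lemma poly_family_diff:
  "poly_family N p \<Longrightarrow> poly_family N q \<Longrightarrow> poly_family N (\<lambda>\<theta>. p \<theta> - q \<theta>)"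
  by (auto simp: poly_family_def intro!: continuous_intros degree_diff_le)

lemma poly_family_mult:
  "poly_family N p \<Longrightarrow> poly_family M q \<Longrightarrow> poly_family (N + M) (\<lambda>\<theta>. p \<theta> * q \<theta>)"
  by (auto simp: poly_family_def coeff_mult intro!: continuous_intros
      order_trans[OF degree_mult_le] add_mono)

lemma poly_family_power: "poly_family N p \<Longrightarrow> poly_family (N * i) (\<lambda>\<theta>. p \<theta> ^ i)"
proof (induction i)
  case 0
  then show ?case by (auto simp: poly_family_def)
next
  case (Suc i)
  then show ?case using poly_family_mult[of N p "N * i"] by simp
qed

lemma poly_family_sum:
  assumes "\<And>i. i \<in> A \<Longrightarrow> poly_family N (p i)"
  shows "poly_family N (\<lambda>\<theta>. \<Sum>i\<in>A. p i \<theta>)"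
proof (cases "finite A")
  case True
  then show ?thesis using assms
    by (auto simp: poly_family_def coeff_sum intro!: continuous_intros degree_sum_le)
qed (simp add: poly_family_0)

lemma poly_eq_sum_coeff:
  fixes x :: "'a::comm_semiring_1"
  assumes "degree p \<le> N" shows "poly p x = (\<Sum>k\<le>N. coeff p k * x ^ k)"
  unfolding poly_altdef using assms by (intro sum.mono_neutral_left) (auto simp: coeff_eq_0)

lemma poly_family_continuous:
  assumes "poly_family N p" shows "continuous_on A (\<lambda>\<theta>. poly (p \<theta>) x)"
  by (subst poly_eq_sum_coeff[OF poly_familyD(1)[OF assms]])
    (intro continuous_intros poly_familyD(2)[OF assms])

lemma poly_family_integral:
  assumes "poly_family N p"
  shows "integral {u..v} (\<lambda>\<theta>. poly (p \<theta>) x) = (\<Sum>k\<le>N. integral {u..v} (\<lambda>\<theta>. coeff (p \<theta>) k) * x ^ k)"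
proof -
  have "(\<lambda>\<theta>. coeff (p \<theta>) k * x ^ k) integrable_on {u..v}" for k
    by (intro integrable_continuous_interval continuous_intros poly_familyD(2)[OF assms])
  then show ?thesis
    by (subst poly_eq_sum_coeff[OF poly_familyD(1)[OF assms]]) (simp add: integral_sum)
qed

lemma coeff_mult_top:
  assumes "degree p \<le> d" "degree q \<le> e"
  shows "coeff (p * q) (d + e) = coeff p d * (coeff q e :: 'a::comm_semiring_1)"
proof -
  have "coeff (p * q) (d + e) = (\<Sum>i\<le>d + e. coeff p i * coeff q (d + e - i))" by (simp add: coeff_mult)
  also have "\<dots> = (\<Sum>i\<in>{d}. coeff p i * coeff q (d + e - i))"
  proof (rule sum.mono_neutral_right)
    show "\<forall>i\<in>{..d + e} - {d}. coeff p i * coeff q (d + e - i) = 0"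
    proof
      fix i assume "i \<in> {..d + e} - {d}"
      then have "degree p < i \<or> degree q < d + e - i" using assms by auto
      then show "coeff p i * coeff q (d + e - i) = 0" by (auto simp: coeff_eq_0)
    qed
  qed auto
  finally show ?thesis by simp
qed

lemma coeff_power_top:
  assumes "degree p \<le> d"
  shows "coeff (p ^ n) (d * n) = (coeff p d ^ n :: 'a::comm_semiring_1)"
proof (induction n)
  case (Suc n)
  have "degree (p ^ n) \<le> d * n" using degree_power_le[of p n] assms
    by (meson le_trans mult_le_mono1)
  then show ?case using coeff_mult_top[OF assms, of "p ^ n" "d * n"] Suc by simp
qed simp

text \<open>For an antiderivative \<open>G\<close> the difference \<open>G (x + T) - G x\<close> has
  derivative 0, so the integral over a period does not depend on its starting point. It serves both
  the change from time to angle and the shift of the angle by \<open>pi\<close>.\<close>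

lemma periodic_integral_affine:
  fixes f :: "real \<Rightarrow> real"
  assumes c: "continuous_on UNIV f" and per: "\<And>x. f (x + T) = f x" and "w > 0" "T > 0"
  shows "integral {0..T / w} (\<lambda>t. f (w * t + s)) = integral {0..T} f / w"
proof -
  obtain G where G: "\<And>x. (G has_vector_derivative f x) (at x)"
    using einterval_antiderivative[of "-\<infinity>" \<infinity> f] c
    by (auto simp: continuous_on_eq_continuous_at)
  have "\<forall>x. ((\<lambda>x. G (x + T) - G x) has_real_derivative 0) (at x)"
  proof
    fix x
    have "((\<lambda>x. G (x + T)) has_real_derivative f (x + T)) (at x)"
      using G[of "x + T"] by (simp add: has_real_derivative_iff_has_vector_derivative[symmetric] DERIV_shift)
    then show "((\<lambda>x. G (x + T) - G x) has_real_derivative 0) (at x)"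
      using G[of x] per[of x] by (auto simp: has_real_derivative_iff_has_vector_derivative[symmetric] intro!: derivative_eq_intros)
  qed
  note K = DERIV_isconst_all[OF this, of s 0]
  have "(f has_integral (G T - G 0)) {0..T}"
    using \<open>T > 0\<close> by (intro fundamental_theorem_of_calculus has_vector_derivative_at_within[OF G]) auto
  moreover have "((\<lambda>t. f (w * t + s)) has_integral (G (w * (T / w) + s) / w - G (w * 0 + s) / w)) {0..T / w}"
  proof (rule fundamental_theorem_of_calculus)
    fix t :: real
    have "((\<lambda>t. G (w * t + s)) has_real_derivative f (w * t + s) * w) (at t)"
      by (rule DERIV_chain2[where f = G and g = "\<lambda>t. w * t + s"])
        (use G[of "w * t + s"] in \<open>auto simp: has_real_derivative_iff_has_vector_derivative[symmetric] intro!: derivative_eq_intros\<close>)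
    from DERIV_cdivide[OF this, of w] have "((\<lambda>t. G (w * t + s) / w) has_real_derivative f (w * t + s)) (at t)"
      using \<open>w > 0\<close> by simp
    then show "((\<lambda>t. G (w * t + s) / w) has_vector_derivative f (w * t + s)) (at t within {0..T / w})"
      by (simp add: has_real_derivative_iff_has_vector_derivative has_vector_derivative_at_within)
  qed (use assms in auto)
  ultimately show ?thesis using K \<open>w > 0\<close>
    by (simp add: integral_unique diff_divide_distrib[symmetric] add.commute)
qed

text \<open>A triangular system with one polynomial of each degree: subtracting a multiple of
  \<open>B m\<close> removes the coefficient of degree \<open>m\<close>.\<close>

lemma poly_basis:
  fixes P :: "'a::field poly"
  assumes "\<And>j. j < m \<Longrightarrow> degree (B j) = j \<and> B j \<noteq> 0" "P = 0 \<or> degree P < m"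
  shows "\<exists>c. P = (\<Sum>j<m. smult (c j) (B j))"
  using assms
proof (induction m arbitrary: P)
  case (Suc m)
  define k where "k = coeff P m / coeff (B m) m"
  have Bm: "degree (B m) = m" "coeff (B m) m \<noteq> 0" using Suc.prems(1)[of m] leading_coeff_neq_0[of "B m"] by auto
  have "degree P \<le> m" using Suc.prems(2) by auto
  then have d: "degree (P - smult k (B m)) \<le> m" by (intro degree_diff_le) (auto simp: Bm)
  have "coeff (P - smult k (B m)) m = 0" using Bm by (simp add: k_def)
  then have "P - smult k (B m) = 0 \<or> degree (P - smult k (B m)) < m"
    using d by (metis le_neq_implies_less leading_coeff_0_iff)
  then obtain c where c: "P - smult k (B m) = (\<Sum>j<m. smult (c j) (B j))"
    using Suc.IH[of "P - smult k (B m)"] Suc.prems(1) by auto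
  have "P = (\<Sum>j<Suc m. smult ((c(m := k)) j) (B j))"
    using c by (simp add: algebra_simps)
  then show ?case by blast
qed simp

section \<open>The perturbed oscillator\<close>

lemma has_vector_derivative_prod_iff:
  fixes \<gamma> :: "real \<Rightarrow> real \<times> real"
  shows "(\<gamma> has_vector_derivative D) (at t within S) \<longleftrightarrow>
    ((\<lambda>t. fst (\<gamma> t)) has_real_derivative fst D) (at t within S) \<and>
    ((\<lambda>t. snd (\<gamma> t)) has_real_derivative snd D) (at t within S)" (is "?L \<longleftrightarrow> ?R")
proof
  assume ?L
  then show ?R
    using bounded_linear.has_vector_derivative[OF bounded_linear_fst, of \<gamma> D]
      bounded_linear.has_vector_derivative[OF bounded_linear_snd, of \<gamma> D]
    by (simp add: has_real_derivative_iff_has_vector_derivative)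
next
  assume ?R
  then show ?L
    using has_vector_derivative_Pair[of "\<lambda>t. fst (\<gamma> t)" "fst D" t S "\<lambda>t. snd (\<gamma> t)" "snd D"]
    by (simp add: has_real_derivative_iff_has_vector_derivative)
qed

locale perturbed_oscillator =
  fixes lam :: real and n :: nat and a b :: "nat \<Rightarrow> nat \<Rightarrow> real"
  assumes lam: "0 < lam" "lam < 1"
begin

definition al :: real where "al = sqrt (1 - lam)"
definition be :: real where "be = sqrt lam"
definition om :: real where "om = al / be"

lemma al: "al > 0" "al\<^sup>2 = 1 - lam" and be: "be > 0" "be\<^sup>2 = lam" and om: "om > 0"
  using lam by (auto simp: al_def be_def om_def)

text \<open>
  Completing the square, \<open>2 H = (al x)\<^sup>2 + ((y + lam x + lam x\<^sup>2) / be)\<^sup>2\<close>. In the coordinate \<open>zc\<close> the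
  unperturbed system is the harmonic oscillator \<open>z' = \<i> om z\<close> and \<open>H = \<bar>z\<bar>\<^sup>2 / 2\<close>.
\<close>

definition zc :: "real \<times> real \<Rightarrow> complex" where
  "zc = (\<lambda>(x, y). Complex (al * x) ((y + lam * x + lam * x\<^sup>2) / be))"

definition unz :: "complex \<Rightarrow> real \<times> real" where
  "unz z = (Re z / al, be * Im z - lam * (Re z / al) - lam * (Re z / al)\<^sup>2)"

text \<open>Negative \<open>R\<close> is allowed: a point has the two descriptions
  (\<open>R\<close>, \<open>\<theta>\<close>) and (\<open>- R\<close>,
  \<open>\<theta> + pi\<close>), and this symmetry makes the Abelian integral even in
  \<open>R\<close>.\<close>

definition pos :: "real \<Rightarrow> real \<Rightarrow> real \<times> real" where
  "pos R \<theta> = unz (of_real R * cis \<theta>)"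

lemma zc_unz [simp]: "zc (unz z) = z" and unz_zc [simp]: "unz (zc p) = p"
  using al be by (auto simp: zc_def unz_def complex_eq_iff split: prod.splits)

lemma zc_pos [simp]: "zc (pos R \<theta>) = of_real R * cis \<theta>"
  by (simp add: pos_def)

lemma zc_eq_iff: "zc p = zc q \<longleftrightarrow> p = q"
  by (metis unz_zc)

lemma Ham_zc: "Ham lam p = (norm (zc p))\<^sup>2 / 2"
proof (cases p)
  case (Pair x y)
  have "(norm (zc p))\<^sup>2 = al\<^sup>2 * x\<^sup>2 + (y + lam * x + lam * x\<^sup>2)\<^sup>2 / be\<^sup>2"
    by (simp add: zc_def Pair cmod_power2 power_mult_distrib power_divide)
  then show ?thesis unfolding al be Ham_def Pair using lam
    by (simp add: field_simps power2_eq_square) algebra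
qed

lemma Ham_pos: "Ham lam (pos R \<theta>) = R\<^sup>2 / 2"
  by (simp add: Ham_zc norm_mult)

lemma Transv_zc: "p \<in> Transv lam \<longleftrightarrow> (\<exists>R>0. zc p = of_real R)"
proof
  assume "p \<in> Transv lam"
  then show "\<exists>R>0. zc p = of_real R"
    using al by (auto simp: Transv_def zc_def complex_eq_iff)
next
  assume "\<exists>R>0. zc p = of_real R"
  then obtain R where R: "R > 0" "p = unz (of_real R)" by (metis unz_zc)
  then show "p \<in> Transv lam" using al by (auto simp: Transv_def unz_def intro!: exI[of _ "R / al"])
qed

text \<open>\<open>Fz\<close> and \<open>Gz\<close> are the components of the perturbation pushed
  forward by \<open>zc\<close>. The factor \<open>lam * (1 + 2 * x)\<close> in \<open>Gz\<close> is
  the derivative of \<open>lam * x + lam * x\<^sup>2\<close>.\<close>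

definition Fz :: "real \<times> real \<Rightarrow> real" where "Fz p = al * bipoly n a p"
definition Gz :: "real \<times> real \<Rightarrow> real" where
  "Gz p = (bipoly n b p + lam * (1 + 2 * fst p) * bipoly n a p) / be"

definition zfield :: "real \<Rightarrow> complex \<Rightarrow> complex" where
  "zfield eps z = \<i> * om * z + eps * Complex (Fz (unz z)) (Gz (unz z))"

lemma pert_field_0: "pert_field lam n a b 0 = field0 lam"
  by (auto simp: pert_field_def fun_eq_iff zero_prod_def)

text \<open>An equivalence, since solutions are transported in both directions. For the way back,
  \<open>x\<close> is differentiable first, and \<open>y\<close> is then recovered by subtracting a
  function of \<open>x\<close>.\<close>

lemma zc_has_vector_derivative:
  "(\<gamma> has_vector_derivative pert_field lam n a b eps (\<gamma> t)) (at t within S) \<longleftrightarrow>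
   ((\<lambda>t. zc (\<gamma> t)) has_vector_derivative zfield eps (zc (\<gamma> t))) (at t within S)" (is "?L \<longleftrightarrow> ?R")
proof -
  define x y where "x = (\<lambda>t. fst (\<gamma> t))" and "y = (\<lambda>t. snd (\<gamma> t))"
  define x' y' where "x' = fst (pert_field lam n a b eps (\<gamma> t))" and "y' = snd (pert_field lam n a b eps (\<gamma> t))"
  have g: "\<gamma> t = (x t, y t)" for t by (simp add: x_def y_def)
  have x': "x' = - y t / lam - x t - (x t)\<^sup>2 + eps * bipoly n a (\<gamma> t)"
    and y': "y' = x t + y t + 2 * x t * y t + 3 * lam * (x t)\<^sup>2 + 2 * lam * (x t)^3 + eps * bipoly n b (\<gamma> t)"
    by (auto simp: x'_def y'_def pert_field_def field0_def g)
  have zf: "zfield eps (zc (\<gamma> t)) = Complex (al * x') ((y' + lam * x' + lam * (2 * x t * x')) / be)"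
  proof -
    have "Re (zfield eps (zc (\<gamma> t))) = - om * ((y t + lam * x t + lam * (x t)\<^sup>2) / be) + eps * Fz (\<gamma> t)"
      by (simp add: zfield_def) (simp add: zc_def g)
    also have "\<dots> = - (al / be\<^sup>2) * (y t + lam * x t + lam * (x t)\<^sup>2) + eps * Fz (\<gamma> t)"
      using be(1) by (simp add: om_def field_simps power2_eq_square)
    also have "\<dots> = al * x'"
      unfolding x' be(2) Fz_def using lam by (simp add: field_simps)
    finally have 1: "Re (zfield eps (zc (\<gamma> t))) = al * x'" .
    have "Im (zfield eps (zc (\<gamma> t))) = om * (al * x t) + eps * Gz (\<gamma> t)"
      by (simp add: zfield_def) (simp add: zc_def g)
    also have "\<dots> = (al\<^sup>2 * x t) / be + eps * Gz (\<gamma> t)"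
      by (simp add: om_def power2_eq_square)
    also have "\<dots> = ((1 - lam) * x t + eps * (bipoly n b (\<gamma> t) + lam * (1 + 2 * x t) * bipoly n a (\<gamma> t))) / be"
      unfolding al(2) Gz_def using be(1) by (simp add: x_def field_simps)
    also have "(1 - lam) * x t + eps * (bipoly n b (\<gamma> t) + lam * (1 + 2 * x t) * bipoly n a (\<gamma> t)) =
        y' + lam * x' + lam * (2 * x t * x')"
      unfolding x' y' using lam by (simp add: field_simps power2_eq_square power3_eq_cube)
    finally show ?thesis using 1 by (simp add: complex_eq_iff)
  qed
  have R: "?R \<longleftrightarrow> ((\<lambda>t. al * x t) has_real_derivative al * x') (at t within S) \<and>
      ((\<lambda>t. (y t + lam * x t + lam * (x t)\<^sup>2) / be) has_real_derivative
        (y' + lam * x' + lam * (2 * x t * x')) / be) (at t within S)"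
    unfolding has_vector_derivative_complex_iff zf by (simp add: zc_def g)
  have L: "?L \<longleftrightarrow> (x has_real_derivative x') (at t within S) \<and> (y has_real_derivative y') (at t within S)"
    unfolding has_vector_derivative_prod_iff by (simp add: x_def y_def x'_def y'_def)
  show ?thesis
  proof
    assume ?L
    then show ?R unfolding L R using al be
      by (auto intro!: derivative_eq_intros)
  next
    assume ?R
    then have r: "((\<lambda>t. al * x t) has_real_derivative al * x') (at t within S)"
      "((\<lambda>t. (y t + lam * x t + lam * (x t)\<^sup>2) / be) has_real_derivative
        (y' + lam * x' + lam * (2 * x t * x')) / be) (at t within S)"
      unfolding R by auto
    note 1 = DERIV_cdivide[OF r(1), of al] and 2 = DERIV_cmult[OF r(2), of be]
    from 1 have x: "(x has_real_derivative x') (at t within S)" using al by simp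
    have "((\<lambda>t. y t + lam * x t + lam * (x t)\<^sup>2 - (lam * x t + lam * (x t)\<^sup>2)) has_real_derivative
        y' + lam * x' + lam * (2 * x t * x') - (lam * x' + lam * (2 * x t * x'))) (at t within S)"
      using 2 be(1) x by (intro DERIV_diff) (auto intro!: derivative_eq_intros)
    then show ?L unfolding L using x by simp
  qed
qed

section \<open>The perturbation as a polynomial in the radius\<close>

definition Xp :: "real \<Rightarrow> real poly" where "Xp \<theta> = [:0, cos \<theta> / al:]"
definition Yp :: "real \<Rightarrow> real poly" where
  "Yp \<theta> = [:0, be * sin \<theta> - lam * (cos \<theta> / al), - lam * (cos \<theta> / al)\<^sup>2:]"
definition bp :: "(nat \<Rightarrow> nat \<Rightarrow> real) \<Rightarrow> real \<Rightarrow> real poly" where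
  "bp c \<theta> = (\<Sum>(i, j)\<in>{(i, j). i + j \<le> n}. smult (c i j) (Xp \<theta> ^ i * Yp \<theta> ^ j))"
definition Fp :: "real \<Rightarrow> real poly" where "Fp \<theta> = smult al (bp a \<theta>)"
definition Gp :: "real \<Rightarrow> real poly" where
  "Gp \<theta> = smult (1 / be) (bp b \<theta> + smult lam ([:1, 2 * cos \<theta> / al:] * bp a \<theta>))"

text \<open>In polar coordinates, \<open>R' = eps * pp \<theta> R\<close> and \<open>\<theta>' = om + eps * qp \<theta> R / R\<close>.\<close>

definition pp :: "real \<Rightarrow> real poly" where "pp \<theta> = smult (cos \<theta>) (Fp \<theta>) + smult (sin \<theta>) (Gp \<theta>)"
definition qp :: "real \<Rightarrow> real poly" where "qp \<theta> = smult (cos \<theta>) (Gp \<theta>) - smult (sin \<theta>) (Fp \<theta>)"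

lemma bipoly_pos: "bipoly n c (pos R \<theta>) = poly (bp c \<theta>) R"
proof -
  have "poly (Xp \<theta>) R = fst (pos R \<theta>)" "poly (Yp \<theta>) R = snd (pos R \<theta>)"
    by (simp_all add: Xp_def Yp_def pos_def unz_def algebra_simps power2_eq_square)
  then show ?thesis
    by (simp add: bipoly_def bp_def poly_sum case_prod_unfold mult.assoc)
qed

lemma Fz_pos: "Fz (pos R \<theta>) = poly (Fp \<theta>) R"
  by (simp add: Fz_def Fp_def bipoly_pos)

lemma Gz_pos: "Gz (pos R \<theta>) = poly (Gp \<theta>) R"
proof -
  have "fst (pos R \<theta>) = R * (cos \<theta> / al)" by (simp add: pos_def unz_def)
  then show ?thesis by (simp add: Gz_def Gp_def bipoly_pos field_simps)
qed

lemma poly_family_X: "poly_family 1 Xp" and poly_family_Y: "poly_family 2 Yp"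
proof -
  have "poly_family (Suc 0) (\<lambda>\<theta>. pCons 0 [:cos \<theta> / al:])"
    using al by (intro poly_family_pCons) (auto intro!: poly_family_constant continuous_intros)
  then show "poly_family 1 Xp" by (simp add: Xp_def[abs_def])
  have "poly_family (Suc (Suc 0)) (\<lambda>\<theta>. pCons 0 (pCons (be * sin \<theta> - lam * (cos \<theta> / al)) [:- lam * (cos \<theta> / al)\<^sup>2:]))"
    using al by (intro poly_family_pCons) (auto intro!: poly_family_constant continuous_intros)
  then show "poly_family 2 Yp" by (simp add: Yp_def[abs_def] numeral_2_eq_2)
qed

lemma finite_index: "finite {(i, j). i + j \<le> (n::nat)}"
  by (rule finite_subset[of _ "{..n} \<times> {..n}"]) auto

lemma poly_family_XY: "poly_family (i + 2 * j) (\<lambda>\<theta>. Xp \<theta> ^ i * Yp \<theta> ^ j)"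
  using poly_family_mult[OF poly_family_power[OF poly_family_X, of i] poly_family_power[OF poly_family_Y, of j]]
  by simp

lemma poly_family_bp: "poly_family (2 * n) (bp c)"
  unfolding bp_def[abs_def] case_prod_unfold
proof (intro poly_family_sum poly_family_smult)
  fix p assume "p \<in> {p. fst p + snd p \<le> n}"
  then show "poly_family (2 * n) (\<lambda>\<theta>. Xp \<theta> ^ fst p * Yp \<theta> ^ snd p)"
    by (intro poly_family_mono[OF poly_family_XY]) auto
qed auto

lemma poly_family_F: "poly_family (2 * n + 1) Fp"
  unfolding Fp_def[abs_def]
  by (intro poly_family_smult poly_family_mono[OF poly_family_bp]) auto

lemma poly_family_lin: "poly_family 1 (\<lambda>\<theta>. [:1, 2 * cos \<theta> / al:])"
proof -
  have "poly_family (Suc 0) (\<lambda>\<theta>. pCons 1 [:2 * cos \<theta> / al:])"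
    using al by (intro poly_family_pCons) (auto intro!: poly_family_constant continuous_intros)
  then show ?thesis by simp
qed

lemma poly_family_G: "poly_family (2 * n + 1) Gp"
  unfolding Gp_def[abs_def]
  using poly_family_mult[OF poly_family_lin poly_family_bp[of a]]
  by (intro poly_family_smult poly_family_add poly_family_mono[OF poly_family_bp]) (auto simp: add.commute)

lemma poly_family_p: "poly_family (2 * n + 1) pp" and poly_family_q: "poly_family (2 * n + 1) qp"
  unfolding pp_def[abs_def] qp_def[abs_def]
  by (intro poly_family_smult poly_family_add poly_family_diff poly_family_F poly_family_G continuous_intros)+

end

section \<open>The Abelian integral\<close>

context perturbed_oscillator
begin

text \<open>In the frame rotating with frequency \<open>om\<close> the solution is constant: the
  real and imaginary parts of \<open>zc (\<gamma> t) * cis (- (om * t))\<close> have derivative 0.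
  The case \<open>R = 0\<close> is the equilibrium.\<close>

lemma field0_solution:
  assumes "solves_on (field0 lam) \<gamma> UNIV"
  shows "\<exists>R \<phi>. R \<ge> 0 \<and> (\<forall>t. \<gamma> t = pos R (om * t + \<phi>))"
proof -
  define u v where "u t = Re (zc (\<gamma> t))" and "v t = Im (zc (\<gamma> t))" for t
  have "((\<lambda>t. zc (\<gamma> t)) has_vector_derivative zfield 0 (zc (\<gamma> t))) (at t)" for t
    using assms zc_has_vector_derivative[of \<gamma> 0 t UNIV] by (simp add: solves_on_def pert_field_0)
  then have d: "(u has_real_derivative - om * v t) (at t)" "(v has_real_derivative om * u t) (at t)" for t
    unfolding has_vector_derivative_complex_iff by (simp_all add: u_def[abs_def] v_def[abs_def] zfield_def)
  have A: "\<forall>t. ((\<lambda>t. u t * cos (om * t) + v t * sin (om * t)) has_real_derivative 0) (at t)"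
    by (auto intro!: derivative_eq_intros d)
  have B: "\<forall>t. ((\<lambda>t. v t * cos (om * t) - u t * sin (om * t)) has_real_derivative 0) (at t)"
    by (auto intro!: derivative_eq_intros d)
  have z: "zc (\<gamma> t) = zc (\<gamma> 0) * cis (om * t)" for t
  proof -
    have "zc (\<gamma> t) * cis (- (om * t)) = zc (\<gamma> 0)"
      using DERIV_isconst_all[OF A, of t 0] DERIV_isconst_all[OF B, of t 0]
      by (simp add: complex_eq_iff u_def v_def)
    then have "zc (\<gamma> 0) * cis (om * t) = zc (\<gamma> t) * (cis (- (om * t)) * cis (om * t))" by (simp add: mult.assoc)
    then show ?thesis by (simp add: cis_mult)
  qed
  have "zc (\<gamma> t) = zc (pos (norm (zc (\<gamma> 0))) (om * t + Arg (zc (\<gamma> 0))))" for t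
  proof -
    have "zc (\<gamma> 0) = of_real (norm (zc (\<gamma> 0))) * cis (Arg (zc (\<gamma> 0)))"
      using rcis_cmod_Arg[of "zc (\<gamma> 0)"] by (simp add: rcis_def)
    then have "zc (\<gamma> t) = of_real (norm (zc (\<gamma> 0))) * cis (Arg (zc (\<gamma> 0))) * cis (om * t)"
      using z[of t] by simp
    then show ?thesis by (simp add: mult.assoc cis_mult add.commute)
  qed
  then have "\<forall>t. \<gamma> t = pos (norm (zc (\<gamma> 0))) (om * t + Arg (zc (\<gamma> 0)))" unfolding zc_eq_iff by (rule allI)
  then show ?thesis using norm_ge_zero by blast
qed

lemma solves_field0: "solves_on (field0 lam) (\<lambda>t. pos R (om * t + \<phi>)) UNIV"
proof -
  have "((\<lambda>t. zc (pos R (om * t + \<phi>))) has_vector_derivative zfield 0 (zc (pos R (om * t + \<phi>)))) (at t)" for t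
    unfolding has_vector_derivative_complex_iff
    by (auto simp: zfield_def intro!: derivative_eq_intros)
  then show ?thesis
    using zc_has_vector_derivative[of "\<lambda>t. pos R (om * t + \<phi>)" 0 _ UNIV] by (simp add: solves_on_def pert_field_0)
qed

lemma pos_eq_iff: "R > 0 \<Longrightarrow> pos R \<theta> = pos R \<theta>' \<longleftrightarrow> (\<exists>k::int. \<theta> = \<theta>' + 2 * pi * k)"
  using sin_cos_eq_iff[of \<theta> \<theta>'] by (subst zc_eq_iff[symmetric]) (auto simp: complex_eq_iff)

lemma pp_periodic: "pp (\<theta> + 2 * pi) = pp \<theta>"
  by (simp add: pp_def Fp_def Gp_def bp_def Xp_def Yp_def)

text \<open>Both sides are the derivative of \<open>Ham lam\<close> along the perturbation: the left
  side from \<open>Ham lam = R\<^sup>2 / 2\<close>, the right side because the unperturbed field is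
  Hamiltonian. So the radial component of the perturbation is, up to sign and the factor
  \<open>R\<close>, the integrand of the Abelian integral.\<close>

lemma poly_p_eq: "R * poly (pp \<theta>) R =
    bipoly n a (pos R \<theta>) * snd (field0 lam (pos R \<theta>)) - bipoly n b (pos R \<theta>) * fst (field0 lam (pos R \<theta>))"
proof -
  obtain x y where xy: "pos R \<theta> = (x, y)" by fastforce
  have "of_real R * cis \<theta> = Complex (al * x) ((y + lam * x + lam * x\<^sup>2) / be)"
    by (metis (no_types, lifting) xy zc_pos zc_def case_prod_conv)
  then have uv: "R * cos \<theta> = al * x" "R * sin \<theta> = (y + lam * x + lam * x\<^sup>2) / be"
    by (simp_all add: complex_eq_iff)
  have "R * poly (pp \<theta>) R = R * cos \<theta> * Fz (x, y) + R * sin \<theta> * Gz (x, y)"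
    using Fz_pos[of R \<theta>] Gz_pos[of R \<theta>] by (simp add: pp_def xy algebra_simps)
  also have "\<dots> = al\<^sup>2 * x * bipoly n a (x, y) + (y + lam * x + lam * x\<^sup>2) / be\<^sup>2 *
      (bipoly n b (x, y) + lam * (1 + 2 * x) * bipoly n a (x, y))"
    unfolding uv by (simp add: Fz_def Gz_def power2_eq_square)
  also have "\<dots> = bipoly n a (x, y) * snd (field0 lam (x, y)) - bipoly n b (x, y) * fst (field0 lam (x, y))"
    unfolding al be field0_def using lam by (simp add: field_simps power2_eq_square power3_eq_cube)
  finally show ?thesis unfolding xy .
qed

lemma line_integral_pos:
  "line_integral (bipoly n b) (\<lambda>z. - bipoly n a z) (\<lambda>t. pos R (om * t + \<phi>)) (2 * pi / om) =
    - (R / om) * integral {0..2 * pi} (\<lambda>\<theta>. poly (pp \<theta>) R)"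
proof -
  have vd: "vector_derivative (\<lambda>t. pos R (om * t + \<phi>)) (at t) = field0 lam (pos R (om * t + \<phi>))" for t
    using solves_field0[of R \<phi>] by (auto simp: solves_on_def intro!: vector_derivative_at)
  have "bipoly n b (pos R \<theta>) * fst (field0 lam (pos R \<theta>)) + - bipoly n a (pos R \<theta>) * snd (field0 lam (pos R \<theta>))
      = - R * poly (pp \<theta>) R" for \<theta>
    using poly_p_eq[of R \<theta>] by simp
  then have "line_integral (bipoly n b) (\<lambda>z. - bipoly n a z) (\<lambda>t. pos R (om * t + \<phi>)) (2 * pi / om) =
     integral {0..2 * pi / om} (\<lambda>t. - R * poly (pp (om * t + \<phi>)) R)"
    unfolding line_integral_def vd by simp
  also have "\<dots> = integral {0..2 * pi} (\<lambda>\<theta>. - R * poly (pp \<theta>) R) / om"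
    by (rule periodic_integral_affine)
      (auto intro!: continuous_intros poly_family_continuous[OF poly_family_p] simp: om pp_periodic)
  finally show ?thesis by simp
qed

text \<open>Every admissible traversal is a uniform rotation. Its radius is fixed by
  \<open>h\<close>, its phase drops out by periodicity, and injectivity on \<open>{0..<p}\<close>
  makes it a single turn; so the definite description has exactly one value.\<close>

lemma abelian_integral_eq:
  assumes "h > 0"
  shows "abelian_integral lam n a b h = - (sqrt (2 * h) / om) * integral {0..2 * pi} (\<lambda>\<theta>. poly (pp \<theta>) (sqrt (2 * h)))"
  unfolding abelian_integral_def
proof (rule the_equality)
  define R where "R = sqrt (2 * h)"
  have R: "R > 0" "R\<^sup>2 / 2 = h" using assms by (auto simp: R_def)
  define \<gamma> where "\<gamma> = (\<lambda>t. pos R (om * t + 0))"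
  define p where "p = 2 * pi / om"
  have p: "p > 0" "om * p = 2 * pi" using om by (auto simp: p_def)
  have inj: "inj_on \<gamma> {0..<p}"
  proof (rule inj_onI)
    fix s t assume st: "s \<in> {0..<p}" "t \<in> {0..<p}" "\<gamma> s = \<gamma> t"
    then obtain k :: int where k: "om * s = om * t + 2 * pi * k"
      using pos_eq_iff[OF R(1)] by (auto simp: \<gamma>_def)
    then have "om * s = om * (t + p * k)" using p by (simp add: algebra_simps)
    then have e: "s - t = p * k" using om by simp
    have "\<bar>p * k\<bar> < p * 1" using st unfolding e[symmetric] by auto
    then have "\<bar>k\<bar> < 1" using p by (simp add: abs_mult)
    then show "s = t" using e by simp
  qed
  have "\<gamma> ` {0..p} = Gam lam h"
  proof
    show "\<gamma> ` {0..p} \<subseteq> Gam lam h" using R by (auto simp: \<gamma>_def Gam_def Ham_pos)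
    show "Gam lam h \<subseteq> \<gamma> ` {0..p}"
    proof
      fix q assume "q \<in> Gam lam h"
      then have "(norm (zc q))\<^sup>2 = R\<^sup>2" using R by (simp add: Gam_def Ham_zc)
      then have nq: "norm (zc q) = R" using R by (simp add: power2_eq_iff_nonneg)
      have "zc q = zc (pos R (Arg2pi (zc q)))"
        using Arg2pi_eq[of "zc q"] nq R by (auto simp: cis_conv_exp)
      then have "q = \<gamma> (Arg2pi (zc q) / om)" using om unfolding zc_eq_iff by (simp add: \<gamma>_def)
      moreover have "Arg2pi (zc q) / om \<in> {0..p}"
        using Arg2pi[of "zc q"] om by (auto simp: p_def divide_right_mono)
      ultimately show "q \<in> \<gamma> ` {0..p}" by blast
    qed
  qed
  moreover have "\<gamma> p = \<gamma> 0" using pos_eq_iff[OF R(1), of "2 * pi" 0] p by (auto simp: \<gamma>_def intro!: exI[of _ 1])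
  moreover have "solves_on (field0 lam) \<gamma> UNIV" unfolding \<gamma>_def by (rule solves_field0)
  moreover have "- (R / om) * integral {0..2 * pi} (\<lambda>\<theta>. poly (pp \<theta>) R) =
      line_integral (bipoly n b) (\<lambda>z. - bipoly n a z) \<gamma> p"
    unfolding \<gamma>_def p_def line_integral_pos ..
  ultimately show "\<exists>\<gamma> p. 0 < p \<and> solves_on (field0 lam) \<gamma> UNIV \<and>
      \<gamma> p = \<gamma> 0 \<and> inj_on \<gamma> {0..<p} \<and> \<gamma> ` {0..p} = Gam lam h \<and>
      - (sqrt (2 * h) / om) * integral {0..2 * pi} (\<lambda>\<theta>. poly (pp \<theta>) (sqrt (2 * h))) =
      line_integral (bipoly n b) (\<lambda>z. - bipoly n a z) \<gamma> p"
    using inj p(1) unfolding R_def[symmetric] by blast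
next
  fix v
  assume "\<exists>\<gamma> p. 0 < p \<and> solves_on (field0 lam) \<gamma> UNIV \<and>
      \<gamma> p = \<gamma> 0 \<and> inj_on \<gamma> {0..<p} \<and> \<gamma> ` {0..p} = Gam lam h \<and>
      v = line_integral (bipoly n b) (\<lambda>z. - bipoly n a z) \<gamma> p"
  then obtain \<gamma> p where p: "0 < p" and sol: "solves_on (field0 lam) \<gamma> UNIV"
    and per: "\<gamma> p = \<gamma> 0" and inj: "inj_on \<gamma> {0..<p}" and im: "\<gamma> ` {0..p} = Gam lam h"
    and v: "v = line_integral (bipoly n b) (\<lambda>z. - bipoly n a z) \<gamma> p" by blast
  obtain R \<phi> where R0: "R \<ge> 0" and g: "\<And>t. \<gamma> t = pos R (om * t + \<phi>)" using field0_solution[OF sol] by blast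
  have "\<gamma> 0 \<in> Gam lam h" using im p by auto
  then have "R\<^sup>2 / 2 = h" by (simp add: Gam_def g Ham_pos)
  then have R: "R = sqrt (2 * h)" using R0 by (auto intro!: real_sqrt_unique[symmetric])
  then have Rpos: "R > 0" using assms by simp
  obtain k :: int where k: "om * p = 2 * pi * k"
    using per pos_eq_iff[OF Rpos] by (auto simp: g)
  have "om * p > 0" using om p by simp
  then have "k \<ge> 1" using k by (simp add: zero_less_mult_iff)
  \<comment> \<open>With two or more turns the point of time 0 would be visited again at
    \<open>2 * pi / om < p\<close>, against injectivity.\<close>
  have "k = 1"
  proof (rule ccontr)
    assume "k \<noteq> 1"
    then have "real_of_int k > 1" using \<open>k \<ge> 1\<close> by simp
    then have "2 * pi * 1 < om * p" unfolding k by (intro mult_strict_left_mono) auto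
    then have "2 * pi / om \<in> {0..<p}" using om by (auto simp: field_simps)
    moreover have "\<gamma> (2 * pi / om) = \<gamma> 0"
      using pos_eq_iff[OF Rpos, of "2 * pi + \<phi>" \<phi>] om by (auto simp: g intro!: exI[of _ 1])
    ultimately have "2 * pi / om = 0" using p by (intro inj_onD[OF inj]) auto
    then show False using om by simp
  qed
  then have "p = 2 * pi / om" using k om by (simp add: field_simps)
  moreover have "\<gamma> = (\<lambda>t. pos R (om * t + \<phi>))" using g by auto
  ultimately show "v = - (sqrt (2 * h) / om) * integral {0..2 * pi} (\<lambda>\<theta>. poly (pp \<theta>) (sqrt (2 * h)))"
    unfolding v using line_integral_pos R by simp
qed

definition mom :: "nat \<Rightarrow> real" where "mom k = integral {0..2 * pi} (\<lambda>\<theta>. coeff (pp \<theta>) k)"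

text \<open>The quotient of the Abelian integral by \<open>h\<close>. With
  \<open>R = sqrt (2 * h)\<close> one has \<open>R * R ^ (2 * j + 1) = (2 * h) ^ (j + 1)\<close>,
  which explains the power of 2; the minus sign comes from the form
  \<open>g dx - f dy\<close>.\<close>

definition Q :: "real poly" where "Q = (\<Sum>j<n. monom (- mom (2 * j + 1) * 2 ^ (j + 1) / om) j)"

lemma coeff_Q: "coeff Q j = (if j < n then - mom (2 * j + 1) * 2 ^ (j + 1) / om else 0)"
  by (simp add: Q_def coeff_sum if_distrib[of "\<lambda>x. coeff x _"] coeff_monom)

lemma degree_Q: "degree Q \<le> n - 1"
  by (rule degree_le) (auto simp: coeff_Q)

text \<open>Changing (\<open>R\<close>, \<open>\<theta>\<close>) to (\<open>- R\<close>,
  \<open>\<theta> + pi\<close>) keeps the point but reverses the radial direction. Hence the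
  coefficients of even degree change sign under the shift by \<open>pi\<close>, and their integrals
  vanish.\<close>

lemma coeff_pp_shift: "coeff (pp (\<theta> + pi)) k = (- 1) ^ (k + 1) * coeff (pp \<theta>) k"
proof -
  have pos: "pos (- R) (\<theta> + pi) = pos R \<theta>" for R
    by (simp add: pos_def complex_eq_iff) (simp add: unz_def)
  have "poly (pcompose (pp (\<theta> + pi)) [:0, - 1:]) R = poly (- pp \<theta>) R" for R
    using Fz_pos[of "- R" "\<theta> + pi"] Gz_pos[of "- R" "\<theta> + pi"] Fz_pos[of R \<theta>] Gz_pos[of R \<theta>]
    by (simp add: poly_pcompose pp_def pos)
  then have "pcompose (pp (\<theta> + pi)) [:0, - 1:] = - pp \<theta>" by (simp add: poly_eq_poly_eq_iff[symmetric] fun_eq_iff)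
  then have "(- 1) ^ k * coeff (pp (\<theta> + pi)) k = - coeff (pp \<theta>) k"
    using coeff_pcompose_linear[of "pp (\<theta> + pi)" "- 1" k] by simp
  then have "(- 1) ^ k * ((- 1) ^ k * coeff (pp (\<theta> + pi)) k) = (- 1) ^ k * (- coeff (pp \<theta>) k)" by simp
  then show ?thesis by (simp add: mult.assoc[symmetric] power_mult_distrib[symmetric])
qed

lemma mom_even: "even k \<Longrightarrow> mom k = 0"
proof -
  assume "even k"
  have "integral {0..2 * pi / 1} (\<lambda>\<theta>. coeff (pp (1 * \<theta> + pi)) k) = integral {0..2 * pi} (\<lambda>\<theta>. coeff (pp \<theta>) k) / 1"
    by (rule periodic_integral_affine)
      (auto intro!: poly_familyD(2)[OF poly_family_p] simp: pp_periodic)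
  then show ?thesis using \<open>even k\<close> by (simp add: coeff_pp_shift mom_def)
qed

lemma integral_sin_cos_power: "integral {0..2 * pi} (\<lambda>\<theta>. sin \<theta> * cos \<theta> ^ m) = 0"
proof -
  have "((\<lambda>\<theta>. sin \<theta> * cos \<theta> ^ m) has_integral (- (cos (2 * pi) ^ Suc m) / Suc m - (- (cos 0 ^ Suc m) / Suc m))) {0..2 * pi}"
  proof (rule fundamental_theorem_of_calculus)
    fix \<theta> :: real
    have "((\<lambda>\<theta>. - (cos \<theta> ^ Suc m) / Suc m) has_real_derivative sin \<theta> * cos \<theta> ^ m) (at \<theta> within {0..2 * pi})"
      by (auto intro!: derivative_eq_intros simp del: power_Suc of_nat_Suc)
    then show "((\<lambda>\<theta>. - (cos \<theta> ^ Suc m) / Suc m) has_vector_derivative sin \<theta> * cos \<theta> ^ m) (at \<theta> within {0..2 * pi})"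
      by (simp add: has_real_derivative_iff_has_vector_derivative)
  qed simp
  then show ?thesis by (simp add: integral_unique)
qed

text \<open>Degree \<open>2 * n + 1\<close> in \<open>R\<close> is reached only by the product of
  \<open>2 * lam * x\<close> with the monomial \<open>y ^ n\<close> of the first component, and
  there only by the quadratic part of \<open>y\<close>. This leaves a multiple of
  \<open>sin \<theta> * cos \<theta> ^ (2 * n + 1)\<close>, which has the periodic antiderivative of
  \<open>integral_sin_cos_power\<close>.\<close>

lemma mom_top: "mom (2 * n + 1) = 0"
proof -
  have d: "degree (bp c \<theta>) \<le> 2 * n" for c \<theta> by (rule poly_familyD(1)[OF poly_family_bp])
  have c: "coeff (bp a \<theta>) (2 * n) = a 0 n * (- lam * (cos \<theta> / al)\<^sup>2) ^ n" for \<theta>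
  proof -
    have "coeff (bp a \<theta>) (2 * n) = (\<Sum>(i, j)\<in>{(i, j). i + j \<le> n}. a i j * coeff (Xp \<theta> ^ i * Yp \<theta> ^ j) (2 * n))"
      by (simp add: bp_def coeff_sum case_prod_unfold)
    also have "\<dots> = (\<Sum>(i, j)\<in>{(0, n)}. a i j * coeff (Xp \<theta> ^ i * Yp \<theta> ^ j) (2 * n))"
    proof (rule sum.mono_neutral_right[OF finite_index])
      show "\<forall>p\<in>{(i, j). i + j \<le> n} - {(0, n)}. (case p of (i, j) \<Rightarrow> a i j * coeff (Xp \<theta> ^ i * Yp \<theta> ^ j) (2 * n)) = 0"
      proof
        fix p assume p: "p \<in> {(i, j). i + j \<le> n} - {(0, n)}"
        obtain i j where ij: "p = (i, j)" by fastforce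
        have "degree (Xp \<theta> ^ i * Yp \<theta> ^ j) \<le> i + 2 * j" by (rule poly_familyD(1)[OF poly_family_XY])
        also have "\<dots> < 2 * n" using p ij by (cases "j = n") auto
        finally show "(case p of (i, j) \<Rightarrow> a i j * coeff (Xp \<theta> ^ i * Yp \<theta> ^ j) (2 * n)) = 0"
          using ij by (simp add: coeff_eq_0)
      qed
    qed auto
    also have "\<dots> = a 0 n * coeff (Yp \<theta> ^ n) (2 * n)" by simp
    also have "coeff (Yp \<theta> ^ n) (2 * n) = coeff (Yp \<theta>) 2 ^ n"
      by (rule coeff_power_top) (rule poly_familyD(1)[OF poly_family_Y])
    also have "coeff (Yp \<theta>) 2 = - lam * (cos \<theta> / al)\<^sup>2" by (simp add: Yp_def numeral_2_eq_2)
    finally show ?thesis .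
  qed
  have z: "coeff (bp c \<theta>) (2 * n + 1) = 0" for c \<theta> using d[of c \<theta>] by (intro coeff_eq_0) auto
  have "coeff (pp \<theta>) (2 * n + 1) = (2 * lam / (be * al) * a 0 n * (- lam / al\<^sup>2) ^ n) * (sin \<theta> * cos \<theta> ^ (2 * n + 1))" for \<theta>
  proof -
    have "coeff ([:1, 2 * cos \<theta> / al:] * bp a \<theta>) (1 + 2 * n) = coeff [:1, 2 * cos \<theta> / al:] 1 * coeff (bp a \<theta>) (2 * n)"
      by (rule coeff_mult_top) (auto intro: d)
    then have "coeff (pp \<theta>) (2 * n + 1) = sin \<theta> * (lam * (2 * cos \<theta> / al * coeff (bp a \<theta>) (2 * n)) / be)"
      using z[of a \<theta>] z[of b \<theta>] by (simp add: pp_def Fp_def Gp_def)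
    also have "\<dots> = (2 * lam / (be * al) * a 0 n * (- lam / al\<^sup>2) ^ n) * (sin \<theta> * cos \<theta> ^ (2 * n + 1))"
    proof -
      have "- lam * (cos \<theta> / al)\<^sup>2 = (- lam / al\<^sup>2) * (cos \<theta>)\<^sup>2" by (simp add: power_divide)
      then have "(- lam * (cos \<theta> / al)\<^sup>2) ^ n = (- lam / al\<^sup>2) ^ n * cos \<theta> ^ (2 * n)"
        by (simp only: power_mult_distrib power_mult)
      then show ?thesis unfolding c by (simp add: mult_ac)
    qed
    finally show ?thesis .
  qed
  then show ?thesis unfolding mom_def by (simp add: integral_sin_cos_power del: power_Suc)
qed

text \<open>Over a general field, because it is applied to real \<open>R\<close> for the Abelian
  integral and to complex \<open>R\<close> for the extended displacement function.\<close>

lemma sum_mom_eq_Q: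
  fixes R :: "'a::real_field"
  shows "(\<Sum>k\<le>2 * n + 1. of_real (mom k) * R ^ k) * R / of_real om = - (R\<^sup>2 / 2 * poly (map_poly of_real Q) (R\<^sup>2 / 2))"
proof -
  have "(\<Sum>k\<le>2 * n + 1. of_real (mom k) * R ^ k) = (\<Sum>j\<le>n. of_real (mom (2 * j + 1)) * R ^ (2 * j + 1))"
    using sum.in_pairs_0[of "\<lambda>k. of_real (mom k) * R ^ k" n] by (simp add: mom_even)
  also have "\<dots> = (\<Sum>j<n. of_real (mom (2 * j + 1)) * R ^ (2 * j + 1))"
    unfolding lessThan_Suc_atMost[symmetric] using mom_top by simp
  finally have "(\<Sum>k\<le>2 * n + 1. of_real (mom k) * R ^ k) * R / of_real om =
      (\<Sum>j<n. of_real (mom (2 * j + 1)) * R ^ (2 * j + 1) * R / of_real om)"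
    by (simp add: sum_distrib_right sum_divide_distrib)
  also have "\<dots> = (\<Sum>j<n. - (R\<^sup>2 / 2 * (of_real (coeff Q j) * (R\<^sup>2 / 2) ^ j)))"
  proof (intro sum.cong refl)
    fix j assume "j \<in> {..<n}"
    have "R ^ (2 * j + 1) * R = R\<^sup>2 * (R\<^sup>2) ^ j" 
    proof -
      have "R ^ (2 * j + 1) * R = R ^ (2 + 2 * j)" by simp
      then show ?thesis by (simp only: power_add power_mult)
    qed
    then have "of_real (mom (2 * j + 1)) * R ^ (2 * j + 1) * R / of_real om =
        of_real (mom (2 * j + 1)) * (R\<^sup>2 * (R\<^sup>2) ^ j) / of_real om" by (simp add: mult.assoc)
    also have "\<dots> = - (R\<^sup>2 / 2 * (of_real (coeff Q j) * (R\<^sup>2 / 2) ^ j))"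
      using \<open>j \<in> {..<n}\<close> by (simp add: coeff_Q power_divide)
    finally show "of_real (mom (2 * j + 1)) * R ^ (2 * j + 1) * R / of_real om =
        - (R\<^sup>2 / 2 * (of_real (coeff Q j) * (R\<^sup>2 / 2) ^ j))" .
  qed
  also have "\<dots> = - (R\<^sup>2 / 2 * (\<Sum>j<n. of_real (coeff Q j) * (R\<^sup>2 / 2) ^ j))"
    by (simp add: sum_distrib_left sum_negf)
  also have "(\<Sum>j<n. of_real (coeff Q j) * (R\<^sup>2 / 2) ^ j) = (\<Sum>j\<le>n. of_real (coeff Q j) * (R\<^sup>2 / 2) ^ j)"
    unfolding lessThan_Suc_atMost[symmetric] by (simp add: coeff_Q)
  also have "\<dots> = poly (map_poly of_real Q) (R\<^sup>2 / 2)"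
    using degree_Q by (subst poly_eq_sum_coeff[of _ n]) (auto simp: coeff_map_poly degree_map_poly)
  finally show ?thesis .
qed

lemma abelian_integral_poly:
  assumes "h > 0" shows "abelian_integral lam n a b h = h * poly Q h"
proof -
  have "abelian_integral lam n a b h = - ((\<Sum>k\<le>2 * n + 1. mom k * sqrt (2 * h) ^ k) * sqrt (2 * h) / om)"
    unfolding abelian_integral_eq[OF assms] poly_family_integral[OF poly_family_p] mom_def by simp
  then show ?thesis using sum_mom_eq_Q[of "sqrt (2 * h)"] assms by simp
qed

end

section \<open>Uniqueness and polar solutions\<close>

text \<open>Lipschitz on each ball, with a constant depending on the ball. Unlike a global Lipschitz
  condition this is stable under products, hence available for polynomial fields, and it suffices
  because a solution is bounded on a compact time interval.\<close>

definition lip_bounded :: "('a::real_normed_vector \<Rightarrow> 'b::real_normed_vector) \<Rightarrow> bool" where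
  "lip_bounded f \<longleftrightarrow> (\<forall>B. \<exists>L\<ge>0. \<forall>z w. norm z \<le> B \<longrightarrow> norm w \<le> B \<longrightarrow> norm (f z - f w) \<le> L * norm (z - w))"

lemma lip_boundedD:
  assumes "lip_bounded f"
  shows "\<exists>L\<ge>0. \<forall>z w. norm z \<le> B \<longrightarrow> norm w \<le> B \<longrightarrow> norm (f z - f w) \<le> L * norm (z - w)"
  using assms unfolding lip_bounded_def by blast

lemma lip_bounded_const: "lip_bounded (\<lambda>z. c)"
  unfolding lip_bounded_def by (intro allI exI[of _ 0]) auto

lemma lip_bounded_linear: "bounded_linear f \<Longrightarrow> lip_bounded f"
  unfolding lip_bounded_def
proof
  fix B assume "bounded_linear f"
  then obtain K where K: "K \<ge> 0" "\<And>x. norm (f x) \<le> norm x * K" using bounded_linear.nonneg_bounded by blast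
  have "norm (f z - f w) \<le> K * norm (z - w)" for z w
    using K(2)[of "z - w"] by (simp add: linear_diff[OF bounded_linear.linear[OF \<open>bounded_linear f\<close>]] mult.commute)
  then show "\<exists>L\<ge>0. \<forall>z w. norm z \<le> B \<longrightarrow> norm w \<le> B \<longrightarrow> norm (f z - f w) \<le> L * norm (z - w)"
    using K(1) by blast
qed

lemma lip_bounded_add:
  assumes "lip_bounded f" "lip_bounded g" shows "lip_bounded (\<lambda>z. f z + g z)"
  unfolding lip_bounded_def
proof
  fix B
  obtain L M where L: "L \<ge> 0" "\<And>z w. norm z \<le> B \<Longrightarrow> norm w \<le> B \<Longrightarrow> norm (f z - f w) \<le> L * norm (z - w)"
    and M: "M \<ge> 0" "\<And>z w. norm z \<le> B \<Longrightarrow> norm w \<le> B \<Longrightarrow> norm (g z - g w) \<le> M * norm (z - w)"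
    using lip_boundedD[OF assms(1), of B] lip_boundedD[OF assms(2), of B] by blast
  have "norm (f z + g z - (f w + g w)) \<le> (L + M) * norm (z - w)" if "norm z \<le> B" "norm w \<le> B" for z w
    using norm_triangle_ineq[of "f z - f w" "g z - g w"] L(2)[OF that] M(2)[OF that] by (simp add: algebra_simps)
  then show "\<exists>K\<ge>0. \<forall>z w. norm z \<le> B \<longrightarrow> norm w \<le> B \<longrightarrow> norm (f z + g z - (f w + g w)) \<le> K * norm (z - w)"
    using L(1) M(1) by (intro exI[of _ "L + M"]) auto
qed

lemma lip_bounded_mult:
  fixes f g :: "'a::real_normed_vector \<Rightarrow> 'b::real_normed_algebra"
  assumes "lip_bounded f" "lip_bounded g" shows "lip_bounded (\<lambda>z. f z * g z)"
  unfolding lip_bounded_def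
proof
  fix B0 :: real
  define B where "B = max B0 0"
  have B: "B \<ge> 0" "B0 \<le> B" by (auto simp: B_def)
  obtain L M where L: "L \<ge> 0" "\<And>z w. norm z \<le> B \<Longrightarrow> norm w \<le> B \<Longrightarrow> norm (f z - f w) \<le> L * norm (z - w)"
    and M: "M \<ge> 0" "\<And>z w. norm z \<le> B \<Longrightarrow> norm w \<le> B \<Longrightarrow> norm (g z - g w) \<le> M * norm (z - w)"
    using lip_boundedD[OF assms(1), of B] lip_boundedD[OF assms(2), of B] by blast
  define Bf where "Bf = norm (f 0) + L * B"
  define Bg where "Bg = norm (g 0) + M * B"
  have bf: "norm (f z) \<le> Bf" if "norm z \<le> B" for z
  proof -
    have "norm (f z) \<le> norm (f 0) + norm (f z - f 0)" by (rule norm_triangle_sub)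
    also have "norm (f z - f 0) \<le> L * norm (z - 0)" using that B by (intro L) auto
    also have "L * norm (z - 0) \<le> L * B" using that L by (intro mult_left_mono) auto
    finally show ?thesis by (simp add: Bf_def)
  qed
  have bg: "norm (g z) \<le> Bg" if "norm z \<le> B" for z
  proof -
    have "norm (g z) \<le> norm (g 0) + norm (g z - g 0)" by (rule norm_triangle_sub)
    also have "norm (g z - g 0) \<le> M * norm (z - 0)" using that B by (intro M) auto
    also have "M * norm (z - 0) \<le> M * B" using that M by (intro mult_left_mono) auto
    finally show ?thesis by (simp add: Bg_def)
  qed
  have nn: "Bf \<ge> 0" "Bg \<ge> 0" using L M B by (auto simp: Bf_def Bg_def)
  have "norm (f z * g z - f w * g w) \<le> (Bf * M + L * Bg) * norm (z - w)" if zw: "norm z \<le> B" "norm w \<le> B" for z w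
  proof -
    have "f z * g z - f w * g w = f z * (g z - g w) + (f z - f w) * g w" by (simp add: algebra_simps)
    then have "norm (f z * g z - f w * g w) \<le> norm (f z * (g z - g w)) + norm ((f z - f w) * g w)"
      by (metis norm_triangle_ineq)
    also have "\<dots> \<le> norm (f z) * norm (g z - g w) + norm (f z - f w) * norm (g w)"
      by (intro add_mono norm_mult_ineq)
    also have "\<dots> \<le> Bf * (M * norm (z - w)) + (L * norm (z - w)) * Bg"
      using bf bg L M zw nn by (intro add_mono mult_mono) auto
    finally show ?thesis by (simp add: algebra_simps)
  qed
  then show "\<exists>K\<ge>0. \<forall>z w. norm z \<le> B0 \<longrightarrow> norm w \<le> B0 \<longrightarrow> norm (f z * g z - f w * g w) \<le> K * norm (z - w)"
    using L M nn B by (intro exI[of _ "Bf * M + L * Bg"]) auto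
qed

lemma lip_bounded_power:
  fixes f :: "'a::real_normed_vector \<Rightarrow> 'b::real_normed_algebra_1"
  shows "lip_bounded f \<Longrightarrow> lip_bounded (\<lambda>z. f z ^ k)"
  by (induction k) (auto intro: lip_bounded_const lip_bounded_mult)

lemma lip_bounded_sum:
  assumes "\<And>i. i \<in> A \<Longrightarrow> lip_bounded (f i)" shows "lip_bounded (\<lambda>z. \<Sum>i\<in>A. f i z)"
  using assms by (induction A rule: infinite_finite_induct) (auto intro: lip_bounded_const lip_bounded_add)

text \<open>Gronwall's argument for the squared distance \<open>D\<close>: from
  \<open>\<bar>D'\<bar> \<le> 2 * L * D\<close> the weighted function
  \<open>D t * exp (- (2 * L) * t)\<close> decreases and \<open>D t * exp (2 * L * t)\<close>
  increases, which settles the times after and before \<open>t0\<close>.\<close>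

theorem ode_unique:
  fixes X :: "'a::{real_inner} \<Rightarrow> 'a" and z1 z2 :: "real \<Rightarrow> 'a"
  assumes lip: "lip_bounded X"
    and z1: "\<And>t. t \<in> {u..v} \<Longrightarrow> (z1 has_vector_derivative X (z1 t)) (at t within {u..v})"
    and z2: "\<And>t. t \<in> {u..v} \<Longrightarrow> (z2 has_vector_derivative X (z2 t)) (at t within {u..v})"
    and t0: "t0 \<in> {u..v}" "z1 t0 = z2 t0" and t: "t \<in> {u..v}"
  shows "z1 t = z2 t"
proof -
  have c: "continuous_on {u..v} z1" "continuous_on {u..v} z2"
    using z1 z2 by (meson continuous_on_vector_derivative)+
  have "bounded (z1 ` {u..v})" "bounded (z2 ` {u..v})"
    using c by (auto intro!: compact_imp_bounded compact_continuous_image)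
  then obtain B1 B2 where B: "\<And>t. t \<in> {u..v} \<Longrightarrow> norm (z1 t) \<le> B1" "\<And>t. t \<in> {u..v} \<Longrightarrow> norm (z2 t) \<le> B2"
    unfolding bounded_iff by blast
  define B where "B = max B1 B2"
  have BB: "norm (z1 t) \<le> B" "norm (z2 t) \<le> B" if "t \<in> {u..v}" for t
    using B that by (auto simp: B_def intro: le_max_iff_disj[THEN iffD2])
  obtain L where L: "L \<ge> 0" "\<And>z w. norm z \<le> B \<Longrightarrow> norm w \<le> B \<Longrightarrow> norm (X z - X w) \<le> L * norm (z - w)"
    using lip_boundedD[OF lip, of B] by blast
  define w where "w t = z1 t - z2 t" for t
  define D where "D t = w t \<bullet> w t" for t
  define D' where "D' t = 2 * (w t \<bullet> (X (z1 t) - X (z2 t)))" for t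
  have D: "(D has_real_derivative D' t) (at t within {u..v})" if "t \<in> {u..v}" for t
  proof -
    have w: "(w has_vector_derivative (X (z1 t) - X (z2 t))) (at t within {u..v})"
      unfolding w_def using z1[OF that] z2[OF that] by (rule has_vector_derivative_diff)
    from bounded_bilinear.has_vector_derivative[OF bounded_bilinear_inner w w] show ?thesis
      unfolding D_def D'_def has_real_derivative_iff_has_vector_derivative
      by (simp add: inner_commute)
  qed
  have bd: "\<bar>D' t\<bar> \<le> 2 * L * D t" if "t \<in> {u..v}" for t
  proof -
    have "\<bar>w t \<bullet> (X (z1 t) - X (z2 t))\<bar> \<le> norm (w t) * norm (X (z1 t) - X (z2 t))" by (rule Cauchy_Schwarz_ineq2)
    also have "\<dots> \<le> norm (w t) * (L * norm (w t))"
      unfolding w_def using L BB[OF that] by (intro mult_left_mono) auto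
    finally show ?thesis by (simp add: D'_def D_def dot_square_norm power2_eq_square abs_mult mult_ac)
  qed
  have Dc: "continuous_on {u..v} D" by (rule DERIV_continuous_on[OF D])
  have Di: "(D has_real_derivative D' t) (at t)" if "u < t" "t < v" for t
    using D[of t] that at_within_Icc_at[of u t v] by simp
  have D0: "D t0 = 0" using t0 by (simp add: D_def w_def)
  have "D t \<le> 0"
  proof (cases "t0 \<le> t")
    case True
    have "D t * exp (- (2 * L) * t) \<le> D t0 * exp (- (2 * L) * t0)"
    proof (rule DERIV_nonpos_imp_decreasing_open[OF True])
      fix s assume s: "t0 < s" "s < t"
      then have s': "s \<in> {u..v}" "u < s" "s < v" using t0 t by auto
      have "((\<lambda>s. D s * exp (- (2 * L) * s)) has_real_derivative (D' s - 2 * L * D s) * exp (- (2 * L) * s)) (at s)"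
        using Di[OF s'(2,3)] by (auto intro!: derivative_eq_intros simp: algebra_simps)
      moreover have "(D' s - 2 * L * D s) * exp (- (2 * L) * s) \<le> 0"
        using bd[OF s'(1)] by (intro mult_nonpos_nonneg) auto
      ultimately show "\<exists>y. ((\<lambda>s. D s * exp (- (2 * L) * s)) has_real_derivative y) (at s) \<and> y \<le> 0" by blast
    next
      show "continuous_on {t0..t} (\<lambda>s. D s * exp (- (2 * L) * s))"
        using t0 t by (intro continuous_intros continuous_on_subset[OF Dc]) auto
    qed
    then have "D t * exp (- (2 * L) * t) \<le> 0" using D0 by simp
    then show ?thesis by (simp add: mult_le_0_iff)
  next
    case False
    then have le: "t \<le> t0" by simp
    have "D t * exp (2 * L * t) \<le> D t0 * exp (2 * L * t0)"
    proof (rule DERIV_nonneg_imp_increasing_open[OF le])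
      fix s assume s: "t < s" "s < t0"
      then have s': "s \<in> {u..v}" "u < s" "s < v" using t0 t by auto
      have "((\<lambda>s. D s * exp (2 * L * s)) has_real_derivative (D' s + 2 * L * D s) * exp (2 * L * s)) (at s)"
        using Di[OF s'(2,3)] by (auto intro!: derivative_eq_intros simp: algebra_simps)
      moreover have "(D' s + 2 * L * D s) * exp (2 * L * s) \<ge> 0"
        using bd[OF s'(1)] by (intro mult_nonneg_nonneg) auto
      ultimately show "\<exists>y. ((\<lambda>s. D s * exp (2 * L * s)) has_real_derivative y) (at s) \<and> 0 \<le> y" by blast
    next
      show "continuous_on {t..t0} (\<lambda>s. D s * exp (2 * L * s))"
        using t0 t by (intro continuous_intros continuous_on_subset[OF Dc]) auto
    qed
    then have "D t * exp (2 * L * t) \<le> 0" using D0 by simp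
    then show ?thesis by (simp add: mult_le_0_iff)
  qed
  then have "w t = 0" unfolding D_def by (metis inner_gt_zero_iff not_less)
  then show ?thesis by (simp add: w_def)
qed

corollary ode_unique_UNIV:
  fixes X :: "'a::{real_inner} \<Rightarrow> 'a"
  assumes "lip_bounded X"
    and "\<And>t. (z1 has_vector_derivative X (z1 t)) (at t)" "\<And>t. (z2 has_vector_derivative X (z2 t)) (at t)"
    and "z1 t0 = z2 t0"
  shows "z1 t = z2 t"
  using ode_unique[OF assms(1) has_vector_derivative_at_within[OF assms(2)]
      has_vector_derivative_at_within[OF assms(3)], where u = "min t t0" and v = "max t t0" and t = t and ?t0.0 = t0] assms(4)
  by auto

text \<open>The bound 10 is arbitrary here and below: it only has to exceed \<open>2 * pi\<close> with some room.\<close>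

lemma angle_as_function_of_time:
  fixes \<Omega> :: "real \<Rightarrow> real"
  assumes c: "continuous_on {-10<..<10} \<Omega>" and pos: "\<And>\<theta>. \<theta> \<in> {-10<..<10} \<Longrightarrow> \<Omega> \<theta> > 0"
  shows "\<exists>g \<tau> e. 0 < \<tau> \<and> 0 < e \<and> g 0 = 0 \<and> g \<tau> = 2 * pi \<and>
    (\<forall>t\<in>{-e<..<\<tau> + e}. g t \<in> {-10<..<10} \<and> (g has_real_derivative \<Omega> (g t)) (at t)) \<and>
    (\<forall>t\<in>{0<..<\<tau>}. g t \<in> {0<..<2 * pi}) \<and> (\<forall>\<theta>\<in>{0<..<2 * pi}. \<exists>t\<in>{0<..<\<tau>}. g t = \<theta>)"
proof -
  have ci: "isCont (\<lambda>\<theta>. 1 / \<Omega> \<theta>) \<theta>" if "-10 < \<theta>" "\<theta> < 10" for \<theta>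
  proof -
    have "isCont \<Omega> \<theta>" using c that by (simp add: continuous_on_eq_continuous_at)
    then show ?thesis using pos[of \<theta>] that by (intro continuous_intros) auto
  qed
  \<comment> \<open>Separation of variables: time is an antiderivative of
    \<open>1 / \<Omega>\<close> as a function of the angle, and \<open>g\<close> will be its
    inverse.\<close>
  obtain S where S: "\<And>\<theta>. -10 < \<theta> \<Longrightarrow> \<theta> < 10 \<Longrightarrow> (S has_vector_derivative 1 / \<Omega> \<theta>) (at \<theta>)"
    using einterval_antiderivative[of "ereal (-10)" "ereal 10" "\<lambda>\<theta>. 1 / \<Omega> \<theta>"] ci by auto
  define T where "T \<theta> = S \<theta> - S 0" for \<theta>
  have T: "(T has_real_derivative 1 / \<Omega> \<theta>) (at \<theta>)" if "-10 < \<theta>" "\<theta> < 10" for \<theta>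
    unfolding T_def using S[OF that]
    by (auto simp: has_real_derivative_iff_has_vector_derivative[symmetric] intro!: derivative_eq_intros)
  have mono: "T x < T y" if "-10 < x" "x < y" "y < 10" for x y
  proof (rule DERIV_pos_imp_increasing[OF \<open>x < y\<close>])
    fix s assume "x \<le> s" "s \<le> y"
    then have s: "-10 < s" "s < 10" using that by auto
    have "1 / \<Omega> s > 0" using pos[of s] s by auto
    then show "\<exists>d. (T has_real_derivative d) (at s) \<and> 0 < d" using T[OF s] by blast
  qed
  have mono_le: "x < y" if "-10 < x" "x < 10" "-10 < y" "y < 10" "T x < T y" for x y
    using mono[of y x] that by (cases x y rule: linorder_cases) auto
  have Tc: "isCont T \<theta>" if "-10 < \<theta>" "\<theta> < 10" for \<theta> using T[OF that] DERIV_isCont by blast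
  have p: "2 * pi < 8" "pi > 0" using pi_less_4 by auto
  \<comment> \<open>The inverse is taken on the compact interval from -9 to 9 inside the domain,
    where the intermediate value theorem and continuity of the inverse apply; since
    \<open>2 * pi < 8\<close>, a full turn fits in.\<close>
  define g where "g t = (THE \<theta>. -9 \<le> \<theta> \<and> \<theta> \<le> 9 \<and> T \<theta> = t)" for t
  have gT: "g (T \<theta>) = \<theta>" if "-9 \<le> \<theta>" "\<theta> \<le> 9" for \<theta>
    unfolding g_def
  proof (rule the_equality)
    fix x assume x: "-9 \<le> x \<and> x \<le> 9 \<and> T x = T \<theta>"
    then show "x = \<theta>" using mono[of x \<theta>] mono[of \<theta> x] that by (cases x \<theta> rule: linorder_cases) auto
  qed (use that in auto)
  have Tg: "-9 \<le> g t \<and> g t \<le> 9 \<and> T (g t) = t" if "T (-9) \<le> t" "t \<le> T 9" for t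
  proof -
    have "\<exists>x\<ge>-9. x \<le> 9 \<and> T x = t" by (rule IVT) (use that Tc in auto)
    then show ?thesis using gT by auto
  qed
  define \<tau> where "\<tau> = T (2 * pi)"
  \<comment> \<open>A reserve of time before and after the turn, for two-sided derivatives at its
    ends and for the overlap when periodic solutions are glued.\<close>
  define e where "e = min (- T (-9)) (T 9 - \<tau>)"
  have T0: "T 0 = 0" by (simp add: T_def)
  have \<tau>: "\<tau> > 0" using mono[of 0 "2 * pi"] p T0 by (simp add: \<tau>_def)
  have e: "e > 0" using mono[of "-9" 0] mono[of "2 * pi" 9] p T0 by (auto simp: e_def \<tau>_def)
  have in1: "T (-9) < t" "t < T 9" if "t \<in> {-e<..<\<tau> + e}" for t using that by (auto simp: e_def)
  have main: "g t \<in> {-10<..<10} \<and> (g has_real_derivative \<Omega> (g t)) (at t)" if t: "t \<in> {-e<..<\<tau> + e}" for t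
  proof -
    note i = in1[OF t]
    have gt: "-9 \<le> g t" "g t \<le> 9" "T (g t) = t" using Tg[of t] i by auto
    then have "-9 < g t" "g t < 9" using i by (auto simp: less_le)
    have "isCont g (T (g t))"
      by (rule isCont_inverse_function2[of "-9" _ 9]) (use gT Tc \<open>-9 < g t\<close> \<open>g t < 9\<close> in auto)
    have g10: "-10 < g t" "g t < 10" using gt by auto
    have "\<Omega> (g t) \<noteq> 0" using pos[of "g t"] g10 by auto
    with \<open>isCont g (T (g t))\<close> have "(g has_real_derivative inverse (1 / \<Omega> (g t))) (at t)"
      by (intro DERIV_inverse_function[of T _ g t "T (-9)" "T 9"])
        (use gt i Tg T[OF g10] in auto)
    then show ?thesis using gt by simp
  qed
  have "g t \<in> {0<..<2 * pi}" if t: "t \<in> {0<..<\<tau>}" for t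
  proof -
    have "t \<in> {-e<..<\<tau> + e}" using t e by auto
    note i = in1[OF this]
    have gt: "-9 \<le> g t" "g t \<le> 9" "T (g t) = t" using Tg[of t] i by auto
    then have "0 < g t" using mono_le[of 0 "g t"] t T0 by auto
    moreover have "g t < 2 * pi" using mono_le[of "g t" "2 * pi"] gt t p by (auto simp: \<tau>_def)
    ultimately show ?thesis by simp
  qed
  moreover have "\<exists>t\<in>{0<..<\<tau>}. g t = \<theta>" if th: "\<theta> \<in> {0<..<2 * pi}" for \<theta>
    using gT[of \<theta>] mono[of 0 \<theta>] mono[of \<theta> "2 * pi"] th p T0 by (intro bexI[of _ "T \<theta>"]) (auto simp: \<tau>_def)
  moreover have "g 0 = 0" using gT[of 0] T0 by simp
  moreover have "g \<tau> = 2 * pi" using gT[of "2 * pi"] p by (simp add: \<tau>_def)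
  ultimately show ?thesis using \<tau> e main by blast
qed

lemma lip_bounded_of_real:
  assumes "lip_bounded f" shows "lip_bounded (\<lambda>z. of_real (f z) :: 'b::real_normed_algebra_1)"
  unfolding lip_bounded_def of_real_diff[symmetric] norm_of_real
  using lip_boundedD[OF assms] by simp

section \<open>The perturbed field in polar coordinates\<close>

context perturbed_oscillator
begin

lemma lip_bounded_zfield: "lip_bounded (zfield eps)"
proof -
  note intros = lip_bounded_add lip_bounded_mult lip_bounded_const lip_bounded_power lip_bounded_sum
    lip_bounded_of_real lip_bounded_linear[OF bounded_linear_Re] lip_bounded_linear[OF bounded_linear_Im]
    lip_bounded_linear[OF bounded_linear_ident]
  have x: "lip_bounded (\<lambda>z. Re z * (1 / al))" by (intro intros)
  have "lip_bounded (\<lambda>z. be * Im z + (- lam) * (Re z * (1 / al)) + (- lam) * (Re z * (1 / al))\<^sup>2)" by (intro intros)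
  then have y: "lip_bounded (\<lambda>z. be * Im z - lam * (Re z / al) - lam * (Re z / al)\<^sup>2)" by simp
  have b: "lip_bounded (\<lambda>z. bipoly n c (unz z))" for c
    unfolding bipoly_def unz_def case_prod_unfold fst_conv snd_conv
    using x by (intro intros y) simp_all
  have F: "lip_bounded (\<lambda>z. Fz (unz z))" unfolding Fz_def by (intro intros b)
  have "lip_bounded (\<lambda>z. (bipoly n b (unz z) + lam * (1 + 2 * (Re z * (1 / al))) * bipoly n a (unz z)) * (1 / be))"
    by (intro intros b)
  then have G: "lip_bounded (\<lambda>z. Gz (unz z))" unfolding Gz_def by (simp add: unz_def)
  have "lip_bounded (\<lambda>z. \<i> * om * z + eps * (of_real (Fz (unz z)) + \<i> * of_real (Gz (unz z))))"
    by (intro intros F G)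
  then show ?thesis unfolding zfield_def[abs_def] by (simp add: Complex_eq)
qed

text \<open>The radius times the angular velocity, which keeps it polynomial in
  \<open>R\<close>.\<close>

definition Dn :: "real \<Rightarrow> real \<Rightarrow> real \<Rightarrow> real" where "Dn eps R \<theta> = om * R + eps * poly (qp \<theta>) R"

lemma zfield_polar:
  "zfield eps (of_real R * cis \<theta>) = Complex (eps * poly (pp \<theta>) R) (Dn eps R \<theta>) * cis \<theta>"
proof -
  define F G where "F = poly (Fp \<theta>) R" and "G = poly (Gp \<theta>) R"
  have FG: "Fz (unz (of_real R * cis \<theta>)) = F" "Gz (unz (of_real R * cis \<theta>)) = G"
    using Fz_pos Gz_pos by (simp_all add: pos_def F_def G_def)
  have pq: "poly (pp \<theta>) R = cos \<theta> * F + sin \<theta> * G" "poly (qp \<theta>) R = cos \<theta> * G - sin \<theta> * F"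
    by (simp_all add: pp_def qp_def F_def G_def)
  have 1: "cos \<theta> * cos \<theta> = 1 - sin \<theta> * sin \<theta>"
    using sin_cos_squared_add[of \<theta>] by (simp add: power2_eq_square algebra_simps)
  have "eps * F = (eps * (cos \<theta> * F + sin \<theta> * G)) * cos \<theta> - eps * (cos \<theta> * G - sin \<theta> * F) * sin \<theta>"
    using 1 by algebra
  moreover have "eps * G = (eps * (cos \<theta> * F + sin \<theta> * G)) * sin \<theta> + eps * (cos \<theta> * G - sin \<theta> * F) * cos \<theta>"
    using 1 by algebra
  ultimately show ?thesis
    unfolding zfield_def FG Dn_def pq by (simp add: complex_eq_iff algebra_simps)
qed

lemma solves_on_zc:
  "solves_on (pert_field lam n a b eps) \<gamma> J \<longleftrightarrow>
    (\<forall>t\<in>J. ((\<lambda>t. zc (\<gamma> t)) has_vector_derivative zfield eps (zc (\<gamma> t))) (at t within J))"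
  unfolding solves_on_def zc_has_vector_derivative ..

end

text \<open>An orbit written as a graph over the angle. Positivity of \<open>Dn\<close> is required
  on the whole annulus and not just along \<open>\<rho>\<close>, because the trapping argument uses
  the direction of the field on the segment between \<open>\<rho> 0\<close> and
  \<open>\<rho> (2 * pi)\<close>.\<close>

locale polar_orbit = perturbed_oscillator lam n a b for lam n a b +
  fixes eps r1 r2 :: real and \<rho> :: "real \<Rightarrow> real"
  assumes r1: "0 < r1"
    and \<rho>_in: "\<And>\<theta>. \<theta> \<in> {-10<..<10} \<Longrightarrow> \<rho> \<theta> \<in> {r1..r2}"
    and \<rho>_ode: "\<And>\<theta>. \<theta> \<in> {-10<..<10} \<Longrightarrow>
      (\<rho> has_real_derivative eps * poly (pp \<theta>) (\<rho> \<theta>) * \<rho> \<theta> / Dn eps (\<rho> \<theta>) \<theta>) (at \<theta>)"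
    and Dn_pos: "\<And>R \<theta>. R \<in> {r1..r2} \<Longrightarrow> \<theta> \<in> {-10<..<10} \<Longrightarrow> Dn eps R \<theta> > 0"
begin

lemma \<rho>_pos: "\<theta> \<in> {-10<..<10} \<Longrightarrow> \<rho> \<theta> > 0"
  using \<rho>_in[of \<theta>] r1 by auto

lemma \<rho>_cont: "\<theta> \<in> {-10<..<10} \<Longrightarrow> isCont \<rho> \<theta>"
  using \<rho>_ode DERIV_isCont by blast

definition curve :: "real \<Rightarrow> complex" where "curve \<theta> = of_real (\<rho> \<theta>) * cis \<theta>"

lemma two_pi_in: "2 * pi \<in> {-10<..<10}" "\<theta> \<in> {0..2 * pi} \<Longrightarrow> \<theta> \<in> {-10<..<10}"
proof -
  have "0 < pi" "2 * pi < 10" using pi_less_4 pi_gt_zero by auto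
  then show "2 * pi \<in> {-10<..<10}" "\<theta> \<in> {0..2 * pi} \<Longrightarrow> \<theta> \<in> {-10<..<10}"
    unfolding atLeastAtMost_iff greaterThanLessThan_iff by linarith+
qed

text \<open>Return from angle to time: the angle is run through with speed
  \<open>Dn eps (\<rho> \<theta>) \<theta> / \<rho> \<theta>\<close>, which turns the graph into a
  solution of the autonomous system.\<close>

lemma orbit_exists:
  "\<exists>g \<tau> e. 0 < \<tau> \<and> 0 < e \<and> g 0 = 0 \<and> g \<tau> = 2 * pi \<and>
    (\<forall>t\<in>{-e<..<\<tau> + e}. ((\<lambda>t. curve (g t)) has_vector_derivative zfield eps (curve (g t))) (at t)) \<and>
    (\<forall>t\<in>{0<..<\<tau>}. g t \<in> {0<..<2 * pi}) \<and> (\<forall>\<theta>\<in>{0<..<2 * pi}. \<exists>t\<in>{0<..<\<tau>}. g t = \<theta>)"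
proof -
  define \<Omega> where "\<Omega> \<theta> = Dn eps (\<rho> \<theta>) \<theta> / \<rho> \<theta>" for \<theta>
  have cq: "continuous_on {-10<..<10} (\<lambda>\<theta>. poly (qp \<theta>) (\<rho> \<theta>))"
    unfolding poly_eq_sum_coeff[OF poly_familyD(1)[OF poly_family_q]]
    by (intro continuous_intros poly_familyD(2)[OF poly_family_q] continuous_at_imp_continuous_on ballI \<rho>_cont)
  have "continuous_on {-10<..<10} \<Omega>"
    unfolding \<Omega>_def Dn_def
    by (intro continuous_intros cq continuous_at_imp_continuous_on ballI \<rho>_cont) (use \<rho>_pos in force)+
  moreover have "\<Omega> \<theta> > 0" if "\<theta> \<in> {-10<..<10}" for \<theta>
    unfolding \<Omega>_def using that by (intro divide_pos_pos Dn_pos \<rho>_in \<rho>_pos)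
  ultimately obtain g \<tau> e where te: "0 < \<tau>" "0 < e" "g 0 = 0" "g \<tau> = 2 * pi"
    and g: "\<And>t. t \<in> {-e<..<\<tau> + e} \<Longrightarrow> g t \<in> {-10<..<10} \<and> (g has_real_derivative \<Omega> (g t)) (at t)"
    and g2: "\<forall>t\<in>{0<..<\<tau>}. g t \<in> {0<..<2 * pi}" "\<forall>\<theta>\<in>{0<..<2 * pi}. \<exists>t\<in>{0<..<\<tau>}. g t = \<theta>"
    using angle_as_function_of_time[of \<Omega>] by blast
  have "((\<lambda>t. curve (g t)) has_vector_derivative zfield eps (curve (g t))) (at t)" if t: "t \<in> {-e<..<\<tau> + e}" for t
  proof -
    define \<theta> where "\<theta> = g t"
    have th: "\<theta> \<in> {-10<..<10}" and gd: "(g has_real_derivative \<Omega> \<theta>) (at t)" using g[OF t] by (auto simp: \<theta>_def)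
    have "((\<lambda>t. \<rho> (g t)) has_real_derivative (eps * poly (pp \<theta>) (\<rho> \<theta>) * \<rho> \<theta> / Dn eps (\<rho> \<theta>) \<theta>) * \<Omega> \<theta>) (at t)"
      by (rule DERIV_chain2[OF _ gd]) (use \<rho>_ode[OF th] in \<open>simp add: \<theta>_def\<close>)
    moreover have "(eps * poly (pp \<theta>) (\<rho> \<theta>) * \<rho> \<theta> / Dn eps (\<rho> \<theta>) \<theta>) * \<Omega> \<theta> = eps * poly (pp \<theta>) (\<rho> \<theta>)"
      using Dn_pos[OF \<rho>_in[OF th] th] \<rho>_pos[OF th] by (simp add: \<Omega>_def)
    ultimately have rd: "((\<lambda>t. \<rho> (g t)) has_real_derivative eps * poly (pp \<theta>) (\<rho> \<theta>)) (at t)" by simp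
    have D: "Dn eps (\<rho> \<theta>) \<theta> = \<rho> (g t) * \<Omega> \<theta>" using \<rho>_pos[OF th] by (simp add: \<Omega>_def \<theta>_def)
    have zf: "zfield eps (curve (g t)) = Complex (eps * poly (pp \<theta>) (\<rho> \<theta>)) (\<rho> (g t) * \<Omega> \<theta>) * cis \<theta>"
      unfolding curve_def zfield_polar \<theta>_def[symmetric] D ..
    show ?thesis
      unfolding zf has_vector_derivative_complex_iff
      by (auto simp: curve_def \<theta>_def[symmetric] intro!: derivative_eq_intros rd gd)
  qed
  then show ?thesis using te g2 by blast
qed

end

section \<open>Return map and closed orbits\<close>

text \<open>Were the property to fail somewhere, it would hold at the infimum of the failures by
  \<open>left\<close>, or because this is \<open>a\<close>, and then beyond it by
  \<open>right\<close>, which is impossible.\<close>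

lemma real_interval_induct:
  fixes a :: real
  assumes "P a"
    and right: "\<And>t. a \<le> t \<Longrightarrow> P t \<Longrightarrow> eventually P (at_right t)"
    and left: "\<And>t. a < t \<Longrightarrow> eventually P (at_left t) \<Longrightarrow> P t"
    and "a \<le> t"
  shows "P t"
proof (rule ccontr)
  assume "\<not> P t"
  define S where "S = {s. a \<le> s \<and> \<not> P s}"
  define c where "c = Inf S"
  have S: "S \<noteq> {}" "bdd_below S" using \<open>\<not> P t\<close> \<open>a \<le> t\<close> by (auto simp: S_def)
  have "a \<le> c" unfolding c_def using S by (intro cInf_greatest) (auto simp: S_def)
  have below: "P s" if "a \<le> s" "s < c" for s
    using cInf_lower[OF _ S(2), of s] that by (force simp: c_def S_def)
  have "P c"
  proof (cases "a = c")
    case False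
    then have "a < c" using \<open>a \<le> c\<close> by simp
    then have "eventually P (at_left c)" using below by (auto simp: eventually_at_left[OF \<open>a < c\<close>])
    then show ?thesis using left \<open>a < c\<close> by blast
  qed (use \<open>P a\<close> in simp)
  then have "eventually P (at_right c)" using right \<open>a \<le> c\<close> by blast
  then obtain d where d: "d > c" "\<And>s. s > c \<Longrightarrow> s < d \<Longrightarrow> P s"
    using eventually_at_right[of c "c + 1"] by auto
  have "d \<le> s" if "s \<in> S" for s
  proof (rule ccontr)
    assume "\<not> d \<le> s"
    moreover have "c \<le> s" unfolding c_def using that S by (intro cInf_lower)
    ultimately have "P s" using d(2)[of s] \<open>P c\<close> by (cases "s = c") auto
    then show False using that by (simp add: S_def)
  qed
  then have "d \<le> c" unfolding c_def using S by (intro cInf_greatest) auto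
  then show False using d by simp
qed

text \<open>\<open>Arg2pi\<close> jumps at the positive axis, where \<open>Arg\<close> is
  continuous. The formula splits a function of \<open>Arg2pi\<close> near the transversal into two
  continuous branches, one for each side.\<close>

lemma Arg2pi_conv_Arg:
  assumes "w \<noteq> 0" shows "Arg2pi w = (if 0 \<le> Im w then Arg w else Arg w + 2 * pi)"
proof -
  have eq: "w = of_real (norm w) * exp (\<i> * of_real (Arg w))"
    using rcis_cmod_Arg[of w] by (simp add: rcis_def cis_conv_exp)
  have A: "- pi < Arg w" "Arg w \<le> pi" using Arg_bounded[of w] by auto
  have im: "Im w = norm w * sin (Arg w)" using rcis_cmod_Arg[of w] by (metis Im_rcis)
  show ?thesis
  proof (cases "0 \<le> Im w")
    case True
    have "0 \<le> Arg w"
    proof (rule ccontr)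
      assume "\<not> 0 \<le> Arg w"
      then have "sin (- Arg w) > 0" using A by (intro sin_gt_zero) auto
      then show False using im True assms by (simp add: zero_le_mult_iff)
    qed
    moreover have "Arg w < 2 * pi" using A pi_gt_zero by linarith
    ultimately show ?thesis using True eq assms
      by (simp, intro Arg2pi_unique[of "norm w"]) auto
  next
    case False
    have "Arg w < 0"
    proof (rule ccontr)
      assume "\<not> Arg w < 0"
      then have "sin (Arg w) \<ge> 0" using A by (intro sin_ge_zero) auto
      then show False using im False by simp
    qed
    have "cis (Arg w + 2 * pi) = cis (Arg w)" by (simp add: complex_eq_iff)
    then have "exp (\<i> * of_real (Arg w + 2 * pi)) = exp (\<i> * of_real (Arg w))"
      unfolding cis_conv_exp .
    then have "of_real (norm w) * exp (\<i> * of_real (Arg w + 2 * pi)) = w" using eq by simp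
    then have "Arg2pi w = Arg w + 2 * pi"
      using \<open>Arg w < 0\<close> A assms by (intro Arg2pi_unique[of "norm w"]) auto
    then show ?thesis using False by simp
  qed
qed

lemma has_vector_derivative_translate:
  assumes "(z has_vector_derivative D) (at (t + c))"
  shows "((\<lambda>t. z (t + c)) has_vector_derivative D) (at t)"
proof -
  have "((\<lambda>t. t + c) has_vector_derivative 1) (at t)" by (auto intro!: derivative_eq_intros)
  from vector_diff_chain_at[OF this assms] show ?thesis by (simp add: o_def)
qed

text \<open>The curve is repeated with the help of \<open>floor\<close>. Differentiability at the
  junctions comes from the overlap, where the curve just before time 0 agrees with the curve just
  before \<open>\<tau>\<close>.\<close>

lemma periodic_extension:
  fixes z0 :: "real \<Rightarrow> 'a::real_normed_vector"
  assumes "0 < \<tau>" "0 < e"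
    and d: "\<And>t. t \<in> {-e<..<\<tau> + e} \<Longrightarrow> (z0 has_vector_derivative X (z0 t)) (at t)"
    and per: "\<And>s. s \<in> {-e<..<e} \<Longrightarrow> z0 (s + \<tau>) = z0 s"
  shows "\<exists>z. (\<forall>t. (z has_vector_derivative X (z t)) (at t)) \<and> (\<forall>t. z (t + \<tau>) = z t) \<and>
    (\<forall>t\<in>{0..<\<tau>}. z t = z0 t) \<and> range z = z0 ` {0..<\<tau>}"
proof -
  define k where "k t = \<lfloor>t / \<tau>\<rfloor>" for t
  define z where "z t = z0 (t - \<tau> * k t)" for t
  have k: "t - \<tau> * k t \<in> {0..<\<tau>}" for t
  proof -
    have "of_int (k t) \<le> t / \<tau>" "t / \<tau> < of_int (k t) + 1" unfolding k_def by linarith+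
    then show ?thesis using \<open>0 < \<tau>\<close> by (simp add: field_simps)
  qed
  have kI: "k t = m" if "t - \<tau> * of_int m \<in> {0..<\<tau>}" for t m
    unfolding k_def using that \<open>0 < \<tau>\<close> by (intro floor_unique) (auto simp: field_simps)
  have der: "(z has_vector_derivative X (z t)) (at t)" for t
  proof -
    define m where "m = k t"
    define s where "s = t - \<tau> * m"
    have s: "0 \<le> s" "s < \<tau>" using k[of t] by (auto simp: s_def m_def)
    have "(z0 has_vector_derivative X (z0 s)) (at (t + - (\<tau> * m)))"
      using d[of s] s \<open>0 < e\<close> by (simp add: s_def)
    then have 1: "((\<lambda>t. z0 (t + - (\<tau> * m))) has_vector_derivative X (z0 s)) (at t)"
      by (rule has_vector_derivative_translate)
    \<comment> \<open>Within this distance of \<open>t\<close> the time stays in the same period, or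
      lies in the previous one and, after the shift, in the overlap.\<close>
    define d where "d = min (\<tau> - s) (min e \<tau>)"
    have d: "d > 0" using s assms by (auto simp: d_def)
    have "(z has_vector_derivative X (z0 s)) (at t)"
    proof (rule has_vector_derivative_transform_within_open[OF 1, of "ball t d"])
      fix u assume "u \<in> ball t d"
      then have u: "\<bar>t - u\<bar> < d" by (simp add: dist_real_def)
      show "z0 (u + - (\<tau> * m)) = z u"
      proof (cases "0 \<le> u - \<tau> * m")
        case True
        then have "k u = m" using u by (intro kI) (auto simp: s_def d_def)
        then show ?thesis by (simp add: z_def)
      next
        case False
        then have ku: "k u = m - 1" using u s by (intro kI) (auto simp: s_def d_def algebra_simps)
        have "u - \<tau> * m \<in> {-e<..<e}" using False u s \<open>0 < e\<close> by (auto simp: s_def d_def)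
        from per[OF this] show ?thesis by (simp add: z_def ku algebra_simps)
      qed
    qed (use d in auto)
    moreover have "z t = z0 s" by (simp add: z_def s_def m_def)
    ultimately show ?thesis by simp
  qed
  moreover have pz: "z (t + \<tau>) = z t" for t
  proof -
    have "k (t + \<tau>) = k t + 1" using k[of t] by (intro kI) (auto simp: algebra_simps)
    then show ?thesis by (simp add: z_def algebra_simps)
  qed
  moreover have z0: "z t = z0 t" if "t \<in> {0..<\<tau>}" for t
    using kI[of t 0] that by (simp add: z_def)
  moreover have "range z = z0 ` {0..<\<tau>}"
  proof
    show "range z \<subseteq> z0 ` {0..<\<tau>}" unfolding z_def using k by blast
    show "z0 ` {0..<\<tau>} \<subseteq> range z" using z0 by (metis image_subsetI rangeI)
  qed
  ultimately show ?thesis by blast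
qed

section \<open>One turn of the orbit: return map and trapping\<close>

context polar_orbit
begin

lemma Arg2pi_curve: "\<theta> \<in> {0..<2 * pi} \<Longrightarrow> Arg2pi (curve \<theta>) = \<theta>"
  using \<rho>_pos[of \<theta>] two_pi_in(2)[of \<theta>]
  by (intro Arg2pi_unique[of "\<rho> \<theta>"]) (auto simp: curve_def cis_conv_exp)

lemma norm_curve: "\<theta> \<in> {-10<..<10} \<Longrightarrow> norm (curve \<theta>) = \<rho> \<theta>"
  using \<rho>_pos[of \<theta>] by (simp add: curve_def norm_mult)

lemma curve_0: "curve 0 = of_real (\<rho> 0)" and curve_2pi: "curve (2 * pi) = of_real (\<rho> (2 * pi))"
  by (simp_all add: curve_def complex_eq_iff)

lemma \<rho>0: "\<rho> 0 > 0" and \<rho>2pi: "\<rho> (2 * pi) > 0"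
  using \<rho>_pos two_pi_in by auto

lemma curve_Transv: "\<theta> \<in> {0<..<2 * pi} \<Longrightarrow> unz (curve \<theta>) \<notin> Transv lam"
  using Arg2pi_curve[of \<theta>] by (auto simp: Transv_zc Arg2pi_of_real)

text \<open>At angles strictly between 0 and \<open>2 * pi\<close> the orbit misses the positive
  axis, so it returns after exactly one turn. Uniqueness of solutions carries this over to every
  witness of \<open>first_return\<close>, which makes the definite description meaningful.\<close>

lemma return_map_polar:
  "return_map lam (pert_field lam n a b eps) ((\<rho> 0)\<^sup>2 / 2) = (\<rho> (2 * pi))\<^sup>2 / 2"
  unfolding return_map_def
proof (rule the_equality)
  obtain g \<tau> e where te: "0 < \<tau>" "0 < e" "g 0 = 0" "g \<tau> = 2 * pi"
    and d: "\<forall>t\<in>{-e<..<\<tau> + e}. ((\<lambda>t. curve (g t)) has_vector_derivative zfield eps (curve (g t))) (at t)"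
    and g: "\<forall>t\<in>{0<..<\<tau>}. g t \<in> {0<..<2 * pi}"
    using orbit_exists by metis
  have dw: "((\<lambda>t. curve (g t)) has_vector_derivative zfield eps (curve (g t))) (at t within {0..\<tau>})" if "t \<in> {0..\<tau>}" for t
    by (rule has_vector_derivative_at_within[OF bspec[OF d]]) (use te that in auto)
  define \<gamma> where "\<gamma> t = unz (curve (g t))" for t
  have "solves_on (pert_field lam n a b eps) \<gamma> {0..\<tau>}"
    unfolding solves_on_zc \<gamma>_def using dw by simp
  moreover have "\<gamma> 0 \<in> Transv lam" "Ham lam (\<gamma> 0) = (\<rho> 0)\<^sup>2 / 2"
    using \<rho>0 by (auto simp: \<gamma>_def te curve_0 Transv_zc Ham_zc)
  moreover have "\<gamma> \<tau> \<in> Transv lam" "Ham lam (\<gamma> \<tau>) = (\<rho> (2 * pi))\<^sup>2 / 2"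
    using \<rho>2pi by (auto simp: \<gamma>_def te curve_2pi Transv_zc Ham_zc)
  moreover have noT: "\<forall>t. 0 < t \<and> t < \<tau> \<longrightarrow> \<gamma> t \<notin> Transv lam"
    using g curve_Transv by (auto simp: \<gamma>_def)
  ultimately show "first_return lam (pert_field lam n a b eps) ((\<rho> 0)\<^sup>2 / 2) ((\<rho> (2 * pi))\<^sup>2 / 2)"
    unfolding first_return_def using te(1) by blast
  fix h' assume "first_return lam (pert_field lam n a b eps) ((\<rho> 0)\<^sup>2 / 2) h'"
  then obtain \<gamma>' \<tau>' where t': "0 < \<tau>'" and sol': "solves_on (pert_field lam n a b eps) \<gamma>' {0..\<tau>'}"
    and st: "\<gamma>' 0 \<in> Transv lam" "Ham lam (\<gamma>' 0) = (\<rho> 0)\<^sup>2 / 2"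
    and no: "\<forall>t. 0 < t \<and> t < \<tau>' \<longrightarrow> \<gamma>' t \<notin> Transv lam"
    and en: "\<gamma>' \<tau>' \<in> Transv lam" "Ham lam (\<gamma>' \<tau>') = h'"
    unfolding first_return_def by blast
  obtain R where R: "R > 0" "zc (\<gamma>' 0) = of_real R" using st Transv_zc by blast
  then have "R\<^sup>2 = (\<rho> 0)\<^sup>2" using st(2) by (simp add: Ham_zc)
  then have "R = \<rho> 0" using R \<rho>0 by (simp add: power2_eq_iff_nonneg)
  then have z0: "zc (\<gamma>' 0) = curve (g 0)" using R by (simp add: te curve_0)
  have eq: "\<gamma>' t = \<gamma> t" if t: "0 \<le> t" "t \<le> \<tau>" "t \<le> \<tau>'" for t
  proof -
    have "(\<lambda>t. zc (\<gamma>' t)) t = (\<lambda>t. curve (g t)) t"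
    proof (rule ode_unique[OF lip_bounded_zfield, of 0 "min \<tau> \<tau>'" _ eps _ 0 t])
      fix s assume s: "s \<in> {0..min \<tau> \<tau>'}"
      show "((\<lambda>t. zc (\<gamma>' t)) has_vector_derivative zfield eps (zc (\<gamma>' s))) (at s within {0..min \<tau> \<tau>'})"
        by (rule has_vector_derivative_within_subset[OF bspec[OF sol'[unfolded solves_on_zc]]]) (use s in auto)
      show "((\<lambda>t. curve (g t)) has_vector_derivative zfield eps (curve (g s))) (at s within {0..min \<tau> \<tau>'})"
        by (rule has_vector_derivative_within_subset[OF dw]) (use s in auto)
    qed (use t te t' z0 in auto)
    then show ?thesis by (metis \<gamma>_def unz_zc)
  qed
  have "\<tau> = \<tau>'"
  proof (rule ccontr)
    assume "\<tau> \<noteq> \<tau>'"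
    then consider "\<tau> < \<tau>'" | "\<tau>' < \<tau>" by linarith
    then show False
    proof cases
      case 1
      then show False using no eq[of \<tau>] \<open>\<gamma> \<tau> \<in> Transv lam\<close> te by auto
    next
      case 2
      then show False using noT eq[of \<tau>'] en t' by auto
    qed
  qed
  then show "h' = (\<rho> (2 * pi))\<^sup>2 / 2"
    using eq[of \<tau>] en te \<open>Ham lam (\<gamma> \<tau>) = (\<rho> (2 * pi))\<^sup>2 / 2\<close> by auto
qed

text \<open>
  If \<open>\<rho>\<close> did not close up, the spiral arc together with the segment of the positive axis between
  \<open>\<rho> 0\<close> and \<open>\<rho> (2 pi)\<close> would be a curve that the orbit crosses in one direction only.
\<close>

lemma periodic_orbit_closes:
  assumes z: "\<And>t. (z has_vector_derivative zfield eps (z t)) (at t)"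
    and z0: "z 0 = of_real (\<rho> 0)" and P: "0 < P" "\<And>t. z (t + P) = z t"
  shows "\<rho> (2 * pi) = \<rho> 0"
proof (rule ccontr)
  define \<sigma> where "\<sigma> = \<rho> (2 * pi) - \<rho> 0"
  assume "\<rho> (2 * pi) \<noteq> \<rho> 0"
  then have \<sigma>: "\<sigma> \<noteq> 0" by (simp add: \<sigma>_def)
  \<comment> \<open>The signed radial distance from the spiral, with the cut on the positive axis,
    where the comparison is with \<open>\<rho> 0\<close>. The predicate \<open>Q\<close> says that
    the orbit is on the side towards which the spiral drifts; it will be shown never to be left
    again.\<close>
  define \<Phi> where "\<Phi> w = norm w - \<rho> (Arg2pi w)" for w
  define Q where "Q t \<longleftrightarrow> \<sigma> * \<Phi> (z t) > 0" for t
  have zc: "isCont z t" for t using z[of t] has_vector_derivative_continuous by blast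
  have Ain: "Arg2pi w \<in> {-10<..<10}" for w
    using two_pi_in(2)[of "Arg2pi w"] Arg2pi_ge_0[of w] Arg2pi_lt_2pi[of w] by auto
  have off_axis: "isCont (\<lambda>t. \<Phi> (z t)) t" if "z t \<notin> \<real>\<^sub>\<ge>\<^sub>0" for t
  proof -
    have "isCont (\<lambda>t. Arg2pi (z t)) t" by (rule isCont_o2[OF zc continuous_at_Arg2pi[OF that]])
    then have "isCont (\<lambda>t. \<rho> (Arg2pi (z t))) t" by (rule isCont_o2) (rule \<rho>_cont[OF Ain])
    then show ?thesis unfolding \<Phi>_def by (intro continuous_intros zc)
  qed
  have at_0: "\<forall>\<^sub>F s in at t. \<Phi> (z s) < 0" if "z t = 0" for t
  proof -
    have "isCont (\<lambda>s. norm (z s)) t" by (intro continuous_intros zc)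
    then have "((\<lambda>s. norm (z s)) \<longlongrightarrow> 0) (at t)" using that by (simp add: isCont_def)
    then have "\<forall>\<^sub>F s in at t. norm (z s) < r1" using r1 by (rule order_tendstoD(2))
    then show ?thesis
    proof (rule eventually_mono)
      fix s assume "norm (z s) < r1"
      then show "\<Phi> (z s) < 0" using \<rho>_in[OF Ain[of "z s"]] by (auto simp: \<Phi>_def)
    qed
  qed
  \<comment> \<open>The two branches of \<open>\<Phi>\<close> at the positive axis: just above it
    the comparison is with the start of the spiral, just below it with the end.\<close>
  define fp where "fp s = norm (z s) - \<rho> (Arg (z s))" for s
  define fm where "fm s = norm (z s) - \<rho> (Arg (z s) + 2 * pi)" for s
  have axis: "isCont fp t \<and> isCont fm t \<and> fp t = r - \<rho> 0 \<and> fm t = r - \<rho> (2 * pi) \<and> \<Phi> (z t) = r - \<rho> 0 \<and>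
      (\<forall>\<^sub>F s in at t. \<Phi> (z s) = (if 0 \<le> Im (z s) then fp s else fm s))"
    if r: "r > 0" "z t = of_real r" for t r
  proof -
    have A0: "Arg (z t) = 0" using r by (simp add: Arg_of_real)
    have "isCont (\<lambda>s. Arg (z s)) t" using r by (intro isCont_o2[OF zc continuous_at_Arg]) auto
    then have 1: "isCont (\<lambda>s. \<rho> (Arg (z s))) t" "isCont (\<lambda>s. \<rho> (Arg (z s) + 2 * pi)) t"
      using A0 two_pi_in by (auto intro!: isCont_o2[of t _ \<rho>] continuous_intros \<rho>_cont)
    have "((\<lambda>s. norm (z s)) \<longlongrightarrow> norm (z t)) (at t)" using zc[of t] by (auto simp: isCont_def intro: tendsto_norm)
    then have "\<forall>\<^sub>F s in at t. 0 < norm (z s)" using r by (intro order_tendstoD(1)) auto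
    then have "\<forall>\<^sub>F s in at t. \<Phi> (z s) = (if 0 \<le> Im (z s) then fp s else fm s)"
      by (rule eventually_mono) (simp add: \<Phi>_def fp_def fm_def Arg2pi_conv_Arg)
    then show ?thesis
      unfolding fp_def fm_def using 1 zc r A0 by (auto simp: \<Phi>_def Arg2pi_of_real intro!: continuous_intros)
  qed
  have Im_deriv: "((\<lambda>s. Im (z s)) has_real_derivative Dn eps r 0) (at t)" if "z t = of_real r" for t r
  proof -
    have "Im (zfield eps (z t)) = Dn eps r 0" using zfield_polar[of eps r 0] that by simp
    then show ?thesis using z[of t] unfolding has_vector_derivative_complex_iff by simp
  qed
  have sgn_ev: "\<forall>\<^sub>F s in at t. \<sigma> * f s > 0" if "isCont f t" "\<sigma> * f t > 0" for f t
    using that by (intro order_tendstoD(1)[of _ "\<sigma> * f t"]) (auto simp: isCont_def intro!: tendsto_intros)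
  have sgn_ev': "\<forall>\<^sub>F s in at t. \<sigma> * f s < 0" if "isCont f t" "\<sigma> * f t < 0" for f t
    using that by (intro order_tendstoD(2)[of _ "\<sigma> * f t"]) (auto simp: isCont_def intro!: tendsto_intros)
  obtain g \<tau> e where te: "0 < \<tau>" "0 < e" "g 0 = 0" "g \<tau> = 2 * pi"
    and gd: "\<forall>t\<in>{-e<..<\<tau> + e}. ((\<lambda>t. curve (g t)) has_vector_derivative zfield eps (curve (g t))) (at t)"
    and g: "\<forall>t\<in>{0<..<\<tau>}. g t \<in> {0<..<2 * pi}" "\<forall>\<theta>\<in>{0<..<2 * pi}. \<exists>t\<in>{0<..<\<tau>}. g t = \<theta>"
    using orbit_exists by metis
  have zg: "z t = curve (g t)" if "t \<in> {0..\<tau>}" for t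
  proof (rule ode_unique[OF lip_bounded_zfield, of 0 \<tau> z eps "\<lambda>t. curve (g t)" 0 t])
    fix s assume s: "s \<in> {0..\<tau>}"
    show "((\<lambda>t. curve (g t)) has_vector_derivative zfield eps (curve (g s))) (at s within {0..\<tau>})"
      by (rule has_vector_derivative_at_within[OF bspec[OF gd]]) (use te s in auto)
    show "(z has_vector_derivative zfield eps (z s)) (at s within {0..\<tau>})"
      by (rule has_vector_derivative_at_within[OF z])
  qed (use that te z0 curve_0 in auto)
  \<comment> \<open>After one turn the orbit sits at the end of the spiral, where
    \<open>\<Phi>\<close> equals \<open>\<sigma>\<close>.\<close>
  have "Q (\<tau>)"
    using axis[of "\<rho> (2 * pi)" \<tau>] zg[of \<tau>] te \<rho>2pi \<sigma>
    by (auto simp: Q_def curve_2pi \<sigma>_def[symmetric] zero_less_mult_iff)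
  have right: "eventually Q (at_right t)" if "Q t" for t
  proof -
    consider "z t \<notin> \<real>\<^sub>\<ge>\<^sub>0" | "z t = 0" | r where "r > 0" "z t = of_real r"
      by (cases "z t \<in> \<real>\<^sub>\<ge>\<^sub>0") (auto elim!: nonneg_Reals_cases simp: le_less)
    then show ?thesis
    proof cases
      case 1
      then have "eventually Q (at t)" unfolding Q_def using that by (intro sgn_ev off_axis) (auto simp: Q_def)
      then show ?thesis by (simp add: eventually_at_split)
    next
      case 2
      then have "\<sigma> < 0" using that \<rho>0 by (simp add: Q_def \<Phi>_def mult_less_0_iff)
      then have "eventually Q (at t)" using at_0[OF 2] unfolding Q_def by (auto elim!: eventually_mono simp: mult_neg_neg)
      then show ?thesis by (simp add: eventually_at_split)
    next
      case (3 r)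
      note ax = axis[OF 3]
      have pos: "\<sigma> * fp t > 0" using that ax by (simp add: Q_def)
      have evp: "\<forall>\<^sub>F s in at_right t. \<sigma> * fp s > 0" "\<forall>\<^sub>F s in at_right t. \<Phi> (z s) = (if 0 \<le> Im (z s) then fp s else fm s)"
        using sgn_ev[of t fp] pos ax by (auto simp: eventually_at_split)
      show ?thesis
      proof (cases "\<sigma> * fm t > 0")
        case True
        then have "\<forall>\<^sub>F s in at_right t. \<sigma> * fm s > 0" using sgn_ev[of t fm] ax by (auto simp: eventually_at_split)
        with evp show ?thesis unfolding Q_def by eventually_elim auto
      next
        case False
        \<comment> \<open>The two signs place \<open>r\<close> between \<open>\<rho> 0\<close> and
          \<open>\<rho> (2 * pi)\<close>. On this segment the angular speed is positive, so the
          orbit enters the upper half plane, where \<open>fp\<close> decides.\<close>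
        have "r \<in> {r1..r2}"
          using False pos ax \<rho>_in[of 0] \<rho>_in[OF two_pi_in(1)] by (auto simp: \<sigma>_def zero_less_mult_iff not_less mult_le_0_iff)
        then have "Dn eps r 0 > 0" by (intro Dn_pos) auto
        then obtain d where "d > 0" and inc: "\<forall>h>0. h < d \<longrightarrow> Im (z t) < Im (z (t + h))"
          using DERIV_pos_inc_right[OF Im_deriv[OF 3(2)]] by blast
        have "0 < Im (z y)" if "y > t" "y < t + d" for y
          using inc[rule_format, of "y - t"] that 3 by simp
        then have "\<forall>\<^sub>F s in at_right t. 0 < Im (z s)" using \<open>d > 0\<close> by (auto simp: eventually_at_right[of t "t + d"] intro!: exI[of _ "t + d"])
        with evp show ?thesis unfolding Q_def by eventually_elim auto
      qed
    qed
  qed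
  have left: "Q t" if ev: "eventually Q (at_left t)" for t
  proof -
    have contra: False if "\<forall>\<^sub>F s in at_left t. \<not> Q s"
    proof -
      have "\<forall>\<^sub>F s in at_left t. False" using ev that by eventually_elim auto
      then show False by simp
    qed
    consider "z t \<notin> \<real>\<^sub>\<ge>\<^sub>0" | "z t = 0" | r where "r > 0" "z t = of_real r"
      by (cases "z t \<in> \<real>\<^sub>\<ge>\<^sub>0") (auto elim!: nonneg_Reals_cases simp: le_less)
    then show ?thesis
    proof cases
      case 1
      show ?thesis
      proof (rule ccontr)
        assume nQ: "\<not> Q t"
        have "\<not> \<sigma> * \<Phi> (z t) < 0"
        proof
          assume "\<sigma> * \<Phi> (z t) < 0"
          then have "\<forall>\<^sub>F s in at_left t. \<sigma> * \<Phi> (z s) < 0"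
            using sgn_ev'[OF off_axis[OF 1]] by (simp add: eventually_at_split)
          then have "\<forall>\<^sub>F s in at_left t. \<not> Q s" unfolding Q_def by eventually_elim auto
          then show False by (rule contra)
        qed
        then have "\<Phi> (z t) = 0" using nQ \<sigma> by (auto simp: Q_def not_less zero_less_mult_iff mult_less_0_iff)
        then have nz: "norm (z t) = \<rho> (Arg2pi (z t))" by (simp add: \<Phi>_def)
        \<comment> \<open>The orbit is on the spiral arc off the axis. By uniqueness it came there
          along the arc, so \<open>\<Phi>\<close> was 0 just before, and \<open>Q\<close>
          failed.\<close>
        have "Arg2pi (z t) \<in> {0<..<2 * pi}" using Arg2pi_gt_0[OF 1] Arg2pi_lt_2pi by simp
        then obtain t1 where t1: "t1 \<in> {0<..<\<tau>}" "g t1 = Arg2pi (z t)" using g(2) by blast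
        have "z t = curve (g t1)"
          using Arg2pi_eq[of "z t"] nz t1 by (simp add: curve_def cis_conv_exp)
        then have "z t = z t1" using zg[of t1] t1 by simp
        have shift: "z (s + (t - t1)) = z s" for s
        proof (rule ode_unique_UNIV[OF lip_bounded_zfield])
          show "((\<lambda>s. z (s + (t - t1))) has_vector_derivative zfield eps (z (s + (t - t1)))) (at s)" for s
            by (rule has_vector_derivative_translate) (rule z)
          show "z (t1 + (t - t1)) = z t1" using \<open>z t = z t1\<close> by simp
        qed (rule z)
        have "\<not> Q s" if "t - t1 < s" "s < t" for s
        proof -
          define s' where "s' = s - (t - t1)"
          have s': "s' \<in> {0<..<\<tau>}" using that t1 by (auto simp: s'_def)
          have "z s = curve (g s')" using shift[of s'] zg[of s'] s' by (simp add: s'_def)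
          moreover have "g s' \<in> {0<..<2 * pi}" using g(1) s' by blast
          ultimately have "\<Phi> (z s) = 0"
            using Arg2pi_curve[of "g s'"] norm_curve[of "g s'"] two_pi_in(2)[of "g s'"] by (auto simp: \<Phi>_def)
          then show ?thesis by (simp add: Q_def)
        qed
        then have "\<forall>\<^sub>F s in at_left t. \<not> Q s" using t1 by (auto simp: eventually_at_left[of "t - t1" t] intro!: exI[of _ "t - t1"])
        then show False by (rule contra)
      qed
    next
      case 2
      have "\<not> \<sigma> > 0"
      proof
        assume "\<sigma> > 0"
        have "\<forall>\<^sub>F s in at_left t. \<Phi> (z s) < 0" using at_0[OF 2] by (simp add: eventually_at_split)
        then have "\<forall>\<^sub>F s in at_left t. \<not> Q s" unfolding Q_def
          using \<open>\<sigma> > 0\<close> by (auto elim!: eventually_mono simp: zero_less_mult_iff)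
        then show False by (rule contra)
      qed
      then show ?thesis using \<sigma> \<rho>0 2 by (auto simp: Q_def \<Phi>_def mult_less_0_iff)
    next
      case (3 r)
      note ax = axis[OF 3]
      show ?thesis
      proof (rule ccontr)
        assume "\<not> Q t"
        then have le: "\<sigma> * fp t \<le> 0" using ax by (simp add: Q_def)
        have "fm t = fp t - \<sigma>" using ax by (simp add: \<sigma>_def)
        then have "\<sigma> * fm t = \<sigma> * fp t - \<sigma>\<^sup>2" by (simp add: power2_eq_square right_diff_distrib)
        moreover have "\<sigma>\<^sup>2 > 0" using \<sigma> by simp
        \<comment> \<open>The wrong side of \<open>\<rho> 0\<close> is strictly on the wrong side of
          \<open>\<rho> (2 * pi)\<close>, since the latter lies further in the direction of
          \<open>\<sigma>\<close>.\<close>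
        ultimately have neg: "\<sigma> * fm t < 0" using le by linarith
        have evm: "\<forall>\<^sub>F s in at_left t. \<sigma> * fm s < 0" "\<forall>\<^sub>F s in at_left t. \<Phi> (z s) = (if 0 \<le> Im (z s) then fp s else fm s)"
          using sgn_ev'[of t fm] neg ax by (auto simp: eventually_at_split)
        show False
        proof (cases "\<sigma> * fp t < 0")
          case True
          then have "\<forall>\<^sub>F s in at_left t. \<sigma> * fp s < 0" using sgn_ev'[of t fp] ax by (auto simp: eventually_at_split)
          with evm have "\<forall>\<^sub>F s in at_left t. \<not> Q s" unfolding Q_def by eventually_elim auto
          then show False by (rule contra)
        next
          case False
          \<comment> \<open>Only the start of the spiral remains; it is reached from the lower half
            plane, where \<open>fm\<close> decides, and \<open>fm\<close> has the wrong
            sign.\<close>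
          then have "r = \<rho> 0" using le \<sigma> ax by (auto simp: not_less mult_le_0_iff zero_le_mult_iff)
          then have "Dn eps r 0 > 0" using \<rho>_in[of 0] by (intro Dn_pos) auto
          then obtain d where "d > 0" and inc: "\<forall>h>0. h < d \<longrightarrow> Im (z (t - h)) < Im (z t)"
            using DERIV_pos_inc_left[OF Im_deriv[OF 3(2)]] by blast
          have "Im (z y) < 0" if "t - d < y" "y < t" for y
            using inc[rule_format, of "t - y"] that 3 by simp
          then have "\<forall>\<^sub>F s in at_left t. Im (z s) < 0" using \<open>d > 0\<close> by (auto simp: eventually_at_left[of "t - d" t] intro!: exI[of _ "t - d"])
          with evm have "\<forall>\<^sub>F s in at_left t. \<not> Q s" unfolding Q_def by eventually_elim auto
          then show False by (rule contra)
        qed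
      qed
    qed
  qed
  have zk: "z (of_nat k * P) = z 0" for k
  proof (induction k)
    case (Suc k)
    then show ?case using P(2)[of "of_nat k * P"] by (simp add: algebra_simps)
  qed simp
  \<comment> \<open>The orbit is back at its starting point after time \<open>\<tau>\<close>, but
    there \<open>\<Phi>\<close> is 0 and \<open>Q\<close> fails.\<close>
  obtain k :: nat where "\<tau> < of_nat k * P" using reals_Archimedean3[OF P(1)] by blast
  then have "Q (of_nat k * P)" using real_interval_induct[of Q \<tau>] \<open>Q \<tau>\<close> right left by auto
  then show False unfolding Q_def zk z0 using \<rho>0 by (simp add: \<Phi>_def Arg2pi_of_real)
qed

end

section \<open>Closed orbits in the complex coordinate\<close>

context perturbed_oscillator
begin

lemma closed_orbit_zc:
  "closed_orbit (pert_field lam n a b eps) C \<longleftrightarrow>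
    (\<exists>z P. 0 < P \<and> (\<forall>t. (z has_vector_derivative zfield eps (z t)) (at t)) \<and> (\<forall>t. z (t + P) = z t) \<and>
      (\<exists>t. z t \<noteq> z 0) \<and> C = unz ` range z)" (is "?L \<longleftrightarrow> ?R")
proof
  assume ?L
  then obtain \<gamma> p where "0 < p" "solves_on (pert_field lam n a b eps) \<gamma> UNIV" "\<forall>t. \<gamma> (t + p) = \<gamma> t"
    "\<exists>t. \<gamma> t \<noteq> \<gamma> 0" "C = range \<gamma>" unfolding closed_orbit_def by blast
  then show ?R
    by (intro exI[of _ "\<lambda>t. zc (\<gamma> t)"] exI[of _ p]) (auto simp: solves_on_zc zc_eq_iff image_image)
next
  assume ?R
  then obtain z P where "0 < P" "\<forall>t. (z has_vector_derivative zfield eps (z t)) (at t)" "\<forall>t. z (t + P) = z t"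
      "\<exists>t. z t \<noteq> z 0" "C = unz ` range z" by blast
  then show ?L unfolding closed_orbit_def solves_on_zc
    by (intro exI[of _ "\<lambda>t. unz (z t)"] exI[of _ P]) (auto simp: image_image, metis zc_unz)
qed

lemma continuous_zc: "continuous_on UNIV zc"
proof -
  have "zc = (\<lambda>q. of_real (al * fst q) + \<i> * of_real ((snd q + lam * fst q + lam * (fst q)\<^sup>2) / be))"
    by (auto simp: zc_def complex_eq_iff)
  then show ?thesis using be(1) by (auto intro!: continuous_intros)
qed

text \<open>An orbit that avoids the positive axis has a continuous angle with values in an interval
  of length \<open>2 * pi\<close>, while the angle grows at least at the rate
  \<open>c / s2\<close>.\<close>

lemma orbit_in_annulus_crosses_axis:
  assumes z: "\<And>t. (z has_vector_derivative zfield eps (z t)) (at t)"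
    and ann: "\<And>t. norm (z t) \<in> {s1..s2}" and "0 < s1" "0 < c"
    and Dn: "\<And>R \<theta>. R \<in> {s1..s2} \<Longrightarrow> \<theta> \<in> {-10<..<10} \<Longrightarrow> c \<le> Dn eps R \<theta>"
  shows "\<exists>t r. 0 < r \<and> z t = of_real r"
proof (rule ccontr)
  assume no: "\<not> ?thesis"
  have s2: "s2 > 0" using ann[of 0] \<open>0 < s1\<close> by auto
  have nz: "z t \<noteq> 0" for t using ann[of t] \<open>0 < s1\<close> by auto
  have off: "- z t \<notin> \<real>\<^sub>\<le>\<^sub>0" for t
  proof
    assume "- z t \<in> \<real>\<^sub>\<le>\<^sub>0"
    then obtain r where r: "- z t = of_real r" "r \<le> 0" by (elim nonpos_Reals_cases)
    from r(1) have "z t = of_real (- r)" by (metis minus_minus of_real_minus)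
    moreover from this have "r \<noteq> 0" using nz[of t] by auto
    then have "0 < - r" using r(2) by simp
    ultimately show False using no by blast
  qed
  \<comment> \<open>The minus sign moves the branch cut of \<open>Ln\<close> to the positive axis,
    which the orbit is assumed to avoid.\<close>
  define \<psi> where "\<psi> t = Im (Ln (- z t))" for t
  have d: "\<exists>y. (\<psi> has_real_derivative y) (at t) \<and> c / s2 \<le> y" for t
  proof -
    have "((\<lambda>w. Ln (- w)) has_field_derivative inverse (z t)) (at (z t))"
      using off[of t] by (auto intro!: derivative_eq_intros simp: field_simps)
    from field_vector_diff_chain_at[OF z this]
    have "((\<lambda>t. Ln (- z t)) has_vector_derivative zfield eps (z t) * inverse (z t)) (at t)" by (simp add: o_def)
    then have 1: "(\<psi> has_real_derivative Im (zfield eps (z t) * inverse (z t))) (at t)"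
      unfolding has_vector_derivative_complex_iff \<psi>_def[abs_def] by blast
    define R \<theta> where "R = norm (z t)" and "\<theta> = Arg (z t)"
    have R: "R \<in> {s1..s2}" "R > 0" using ann[of t] \<open>0 < s1\<close> by (auto simp: R_def)
    have th: "\<theta> \<in> {-10<..<10}" using Arg_bounded[of "z t"] pi_less_4 by (auto simp: \<theta>_def)
    have zt: "z t = of_real R * cis \<theta>" using rcis_cmod_Arg[of "z t"] by (simp add: rcis_def R_def \<theta>_def)
    have "zfield eps (z t) * inverse (z t) = Complex (eps * poly (pp \<theta>) R) (Dn eps R \<theta>) / of_real R"
      unfolding zt zfield_polar using R by (simp add: field_simps)
    then have "Im (zfield eps (z t) * inverse (z t)) = Dn eps R \<theta> / R" by (simp add: Im_divide_of_real)
    moreover have "c / s2 \<le> Dn eps R \<theta> / R"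
      using Dn[OF R(1) th] R \<open>0 < c\<close> by (intro frac_le) auto
    ultimately show ?thesis using 1 by auto
  qed
  \<comment> \<open>Long enough for the angle to grow by \<open>2 * pi + 1\<close>, more than the
    range of \<open>\<psi>\<close> allows.\<close>
  define T where "T = (2 * pi + 1) * s2 / c"
  have T: "T > 0" using s2 \<open>0 < c\<close> pi_gt_zero by (simp add: T_def add_pos_pos)
  define k where "k t = \<psi> t - c / s2 * t" for t
  have "k 0 \<le> k T"
  proof (rule DERIV_nonneg_imp_nondecreasing[where f = k and a = 0 and b = T])
    show "0 \<le> T" using T by simp
    fix t :: real
    obtain y where y: "(\<psi> has_real_derivative y) (at t)" "c / s2 \<le> y" using d by blast
    have "(k has_real_derivative y - c / s2) (at t)"
      unfolding k_def using s2 by (auto intro!: derivative_eq_intros y)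
    then show "\<exists>y. (k has_real_derivative y) (at t) \<and> 0 \<le> y" using y by auto
  qed
  moreover have "c / s2 * T = 2 * pi + 1" using s2 \<open>0 < c\<close> by (simp add: T_def)
  moreover have "- pi < \<psi> 0" "\<psi> T \<le> pi"
    using mpi_less_Im_Ln[of "- z 0"] Im_Ln_le_pi[of "- z T"] nz by (auto simp: \<psi>_def)
  ultimately show False by (simp add: k_def)
qed

end

section \<open>Orbits that close up and their isolation\<close>

context polar_orbit
begin

definition Orb :: "(real \<times> real) set" where "Orb = unz ` curve ` {0..<2 * pi}"

lemma Orb_Transv: "Orb \<inter> Transv lam = {unz (of_real (\<rho> 0))}"
proof -
  have "unz (curve \<theta>) \<in> Transv lam \<longleftrightarrow> \<theta> = 0" if "\<theta> \<in> {0..<2 * pi}" for \<theta>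
    using curve_Transv[of \<theta>] that \<rho>0 by (cases "\<theta> = 0") (auto simp: curve_0 Transv_zc)
  moreover have "0 \<in> {0..<2 * pi}" by simp
  ultimately show ?thesis unfolding Orb_def using curve_0 by force
qed

lemma periodic_solution:
  assumes "\<rho> (2 * pi) = \<rho> 0"
  shows "\<exists>z P. 0 < P \<and> (\<forall>t. (z has_vector_derivative zfield eps (z t)) (at t)) \<and> (\<forall>t. z (t + P) = z t) \<and>
    z 0 = of_real (\<rho> 0) \<and> range z = curve ` {0..<2 * pi}"
proof -
  obtain g \<tau> e where te: "0 < \<tau>" "0 < e" "g 0 = 0" "g \<tau> = 2 * pi"
    and gd: "\<forall>t\<in>{-e<..<\<tau> + e}. ((\<lambda>t. curve (g t)) has_vector_derivative zfield eps (curve (g t))) (at t)"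
    and g: "\<forall>t\<in>{0<..<\<tau>}. g t \<in> {0<..<2 * pi}" "\<forall>\<theta>\<in>{0<..<2 * pi}. \<exists>t\<in>{0<..<\<tau>}. g t = \<theta>"
    using orbit_exists by metis
  define d where "d = min e \<tau>"
  have d: "0 < d" "d \<le> e" "d \<le> \<tau>" using te by (auto simp: d_def)
  \<comment> \<open>At \<open>s = 0\<close> both curves pass through the same point, because
    \<open>\<rho>\<close> closes up; uniqueness then makes them agree on both sides of it.\<close>
  have per: "curve (g (s + \<tau>)) = curve (g s)" if "s \<in> {-d<..<d}" for s
  proof (rule ode_unique[OF lip_bounded_zfield, of "- \<bar>s\<bar>" "\<bar>s\<bar>" "\<lambda>s. curve (g (s + \<tau>))" eps "\<lambda>s. curve (g s)" 0 s])
    fix u assume u: "u \<in> {-\<bar>s\<bar>..\<bar>s\<bar>}"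
    have "u + \<tau> \<in> {-e<..<\<tau> + e}" "u \<in> {-e<..<\<tau> + e}" using u that d te by auto
    note gu = bspec[OF gd this(1)] bspec[OF gd this(2)]
    show "((\<lambda>s. curve (g (s + \<tau>))) has_vector_derivative zfield eps (curve (g (u + \<tau>)))) (at u within {-\<bar>s\<bar>..\<bar>s\<bar>})"
      by (rule has_vector_derivative_at_within[OF has_vector_derivative_translate[OF gu(1)]])
    show "((\<lambda>s. curve (g s)) has_vector_derivative zfield eps (curve (g u))) (at u within {-\<bar>s\<bar>..\<bar>s\<bar>})"
      by (rule has_vector_derivative_at_within[OF gu(2)])
  qed (use assms te in \<open>auto simp: curve_0 curve_2pi\<close>)
  have dd: "((\<lambda>t. curve (g t)) has_vector_derivative zfield eps (curve (g t))) (at t)" if "t \<in> {-d<..<\<tau> + d}" for t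
    using bspec[OF gd, of t] that d by auto
  obtain z where z: "\<forall>t. (z has_vector_derivative zfield eps (z t)) (at t)" "\<forall>t. z (t + \<tau>) = z t"
    "\<forall>t\<in>{0..<\<tau>}. z t = curve (g t)" "range z = (\<lambda>t. curve (g t)) ` {0..<\<tau>}"
    using periodic_extension[of \<tau> d "\<lambda>t. curve (g t)" "zfield eps", OF te(1) d(1) dd per] by blast
  have "g ` {0..<\<tau>} = {0..<2 * pi}"
  proof -
    have i: "{0..<\<tau>} = insert 0 {0<..<\<tau>}" "{0..<2 * pi} = insert 0 {0<..<2 * pi}" using te by auto
    have "g ` {0<..<\<tau>} = {0<..<2 * pi}" using g by force
    then show ?thesis unfolding i using te by auto
  qed
  then have "range z = curve ` {0..<2 * pi}" using z(4) by (metis image_image)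
  moreover have "z 0 = of_real (\<rho> 0)" using z(3) te by (auto simp: curve_0)
  ultimately show ?thesis using z te(1) by blast
qed

lemma closed_orbit_Orb:
  assumes "\<rho> (2 * pi) = \<rho> 0"
  shows "closed_orbit (pert_field lam n a b eps) Orb"
proof -
  obtain z P where z: "0 < P" "\<forall>t. (z has_vector_derivative zfield eps (z t)) (at t)" "\<forall>t. z (t + P) = z t"
    "z 0 = of_real (\<rho> 0)" "range z = curve ` {0..<2 * pi}" using periodic_solution[OF assms] by blast
  have "curve pi \<in> range z" unfolding z(5) by simp
  then obtain t where t: "z t = curve pi" by auto
  have "curve pi \<noteq> of_real (\<rho> 0)"
    using \<rho>_pos[of pi] \<rho>0 pi_less_4 pi_gt_zero by (auto simp: curve_def complex_eq_iff)
  then have "z t \<noteq> z 0" using t z(4) by simp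
  then show ?thesis unfolding closed_orbit_zc Orb_def using z by metis
qed

lemma closed_orbit_through:
  assumes "closed_orbit (pert_field lam n a b eps) C" "unz (of_real (\<rho> 0)) \<in> C"
  shows "\<rho> (2 * pi) = \<rho> 0 \<and> C = Orb"
proof -
  obtain z P where z: "0 < P" "\<forall>t. (z has_vector_derivative zfield eps (z t)) (at t)" "\<forall>t. z (t + P) = z t"
    "C = unz ` range z" using assms(1) unfolding closed_orbit_zc by blast
  obtain t0 where t0: "z t0 = of_real (\<rho> 0)" using assms(2) unfolding z(4) by (metis zc_unz imageE)
  define y where "y t = z (t + t0)" for t
  have y: "(y has_vector_derivative zfield eps (y t)) (at t)" for t
    unfolding y_def by (rule has_vector_derivative_translate) (use z(2) in blast)
  have "\<rho> (2 * pi) = \<rho> 0"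
  proof (rule periodic_orbit_closes[OF y])
    show "y 0 = of_real (\<rho> 0)" using t0 by (simp add: y_def)
    show "y (t + P) = y t" for t using z(3)[rule_format, of "t + t0"] by (simp add: y_def ac_simps)
  qed (rule z(1))
  moreover obtain y' where y': "\<forall>t. (y' has_vector_derivative zfield eps (y' t)) (at t)"
    "y' 0 = of_real (\<rho> 0)" "range y' = curve ` {0..<2 * pi}" using periodic_solution[OF \<open>\<rho> (2 * pi) = \<rho> 0\<close>] by blast
  have "y t = y' t" for t
    by (rule ode_unique_UNIV[OF lip_bounded_zfield y, of y' 0]) (use y' t0 in \<open>auto simp: y_def\<close>)
  then have "range y = curve ` {0..<2 * pi}" using y'(3) by simp
  moreover have "range y = range z"
  proof -
    have "z t = y (t - t0)" for t by (simp add: y_def)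
    then have "range z \<subseteq> range y" by blast
    moreover have "range y \<subseteq> range z" by (auto simp: y_def)
    ultimately show ?thesis by blast
  qed
  ultimately show ?thesis using z(4) by (simp add: Orb_def)
qed

text \<open>The isolating neighbourhood is an open annulus slit along the positive axis, with a gate
  of half-width \<open>\<delta>\<close> around \<open>\<rho> 0\<close>. A closed orbit inside must
  cross the axis, hence passes through the gate, where \<open>iso\<close> identifies its crossing
  point.\<close>

lemma limit_cycle_Orb:
  assumes closes: "\<rho> (2 * pi) = \<rho> 0" and "0 < s1" "0 < c" "0 < \<delta>"
    and in_ann: "\<And>\<theta>. \<theta> \<in> {-10<..<10} \<Longrightarrow> \<rho> \<theta> \<in> {s1<..<s2}"
    and Dn: "\<And>R \<theta>. R \<in> {s1..s2} \<Longrightarrow> \<theta> \<in> {-10<..<10} \<Longrightarrow> c \<le> Dn eps R \<theta>"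
    and iso: "\<And>r C. \<bar>r - \<rho> 0\<bar> < \<delta> \<Longrightarrow> closed_orbit (pert_field lam n a b eps) C \<Longrightarrow>
        unz (of_real r) \<in> C \<Longrightarrow> r = \<rho> 0"
  shows "limit_cycle (pert_field lam n a b eps) Orb"
  unfolding limit_cycle_def
proof (intro conjI closed_orbit_Orb[OF closes])
  define U where "U = {q. s1 < norm (zc q)} \<inter> {q. norm (zc q) < s2} -
      ({q. Im (zc q) = 0} \<inter> {q. 0 \<le> Re (zc q)} \<inter> {q. \<delta> \<le> \<bar>Re (zc q) - \<rho> 0\<bar>})"
  have cz: "continuous_on UNIV (\<lambda>q. zc q)" using continuous_zc by simp
  have "open U" unfolding U_def
    by (intro open_Diff open_Int closed_Int open_Collect_less closed_Collect_le closed_Collect_eq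
        continuous_intros cz)
  moreover have "Orb \<subseteq> U"
  proof
    fix q assume "q \<in> Orb"
    then obtain \<theta> where th: "\<theta> \<in> {0..<2 * pi}" "q = unz (curve \<theta>)" by (auto simp: Orb_def)
    then have t10: "\<theta> \<in> {-10<..<10}" using two_pi_in(2)[of \<theta>] by auto
    have "norm (zc q) \<in> {s1<..<s2}" using in_ann[OF t10] norm_curve[OF t10] th by simp
    moreover have "\<not> (Im (zc q) = 0 \<and> 0 \<le> Re (zc q) \<and> \<delta> \<le> \<bar>Re (zc q) - \<rho> 0\<bar>)"
    proof
      assume *: "Im (zc q) = 0 \<and> 0 \<le> Re (zc q) \<and> \<delta> \<le> \<bar>Re (zc q) - \<rho> 0\<bar>"
      then have "Arg2pi (curve \<theta>) = 0" using th by (simp add: Arg2pi_eq_0 complex_is_Real_iff)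
      then have "\<theta> = 0" using Arg2pi_curve[OF th(1)] by simp
      then show False using * th \<open>0 < \<delta>\<close> by (simp add: curve_0)
    qed
    ultimately show "q \<in> U" by (simp add: U_def)
  qed
  moreover have "C' = Orb" if C': "closed_orbit (pert_field lam n a b eps) C'" "C' \<subseteq> U" for C'
  proof -
    obtain z P where z: "\<forall>t. (z has_vector_derivative zfield eps (z t)) (at t)" "C' = unz ` range z"
      using C'(1) unfolding closed_orbit_zc by blast
    have inU: "unz (z t) \<in> U" for t using C'(2) z(2) by auto
    have "norm (z t) \<in> {s1..s2}" for t using inU[of t] by (auto simp: U_def)
    then obtain t r where r: "0 < r" "z t = of_real r"
      using orbit_in_annulus_crosses_axis[of z eps s1 s2 c] z(1) Dn \<open>0 < s1\<close> \<open>0 < c\<close> by blast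
    then have "\<bar>r - \<rho> 0\<bar> < \<delta>" using inU[of t] by (auto simp: U_def)
    moreover have "unz (of_real r) \<in> C'" unfolding z(2) r(2)[symmetric] by blast
    ultimately have "r = \<rho> 0" "unz (of_real (\<rho> 0)) \<in> C'" using iso[of r C'] C'(1) by auto
    then show ?thesis using closed_orbit_through[OF C'(1)] by blast
  qed
  ultimately show "\<exists>U. open U \<and> Orb \<subseteq> U \<and>
      (\<forall>C'. closed_orbit (pert_field lam n a b eps) C' \<and> C' \<subseteq> U \<longrightarrow> C' = Orb)" by blast
qed

end

section \<open>The displacement function\<close>

text \<open>The radius becomes complex while the angle stays real. The companion
  \<open>cpoly'\<close> is the derivative in the radius.\<close>

definition cpoly :: "nat \<Rightarrow> (real \<Rightarrow> real poly) \<Rightarrow> complex \<Rightarrow> real \<Rightarrow> complex" where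
  "cpoly N p R \<theta> = (\<Sum>k\<le>N. of_real (coeff (p \<theta>) k) * R ^ k)"

definition cpoly' :: "nat \<Rightarrow> (real \<Rightarrow> real poly) \<Rightarrow> complex \<Rightarrow> real \<Rightarrow> complex" where
  "cpoly' N p R \<theta> = (\<Sum>k\<le>N. of_real (coeff (p \<theta>) k) * (of_nat k * R ^ (k - 1)))"

lemma cpoly_of_real: "poly_family N p \<Longrightarrow> cpoly N p (of_real R) \<theta> = of_real (poly (p \<theta>) R)"
  by (simp add: cpoly_def poly_eq_sum_coeff[OF poly_familyD(1)])

lemma continuous_on_coeff:
  assumes "poly_family N p" "continuous_on S g"
  shows "continuous_on S (\<lambda>x. coeff (p (g x)) k)"
  by (rule continuous_on_compose2[OF poly_familyD(2)[OF assms(1), of UNIV k] assms(2)]) simp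

lemma continuous_on_cpoly:
  assumes "poly_family N p" "continuous_on S f" "continuous_on S g"
  shows "continuous_on S (\<lambda>x. cpoly N p (f x) (g x))" "continuous_on S (\<lambda>x. cpoly' N p (f x) (g x))"
  unfolding cpoly_def cpoly'_def
  by (intro continuous_intros continuous_on_coeff[OF assms(1)] assms)+

lemma cpoly_has_field_derivative: "((\<lambda>R. cpoly N p R \<theta>) has_field_derivative cpoly' N p R \<theta>) (at R within S)"
  unfolding cpoly_def cpoly'_def
  by (rule DERIV_sum) (auto intro!: derivative_eq_intros)

lemma compact_bound:
  fixes f :: "'a::topological_space \<Rightarrow> 'b::real_normed_vector"
  assumes "compact S" "continuous_on S f"
  shows "\<exists>M>0. \<forall>x\<in>S. norm (f x) \<le> M"
  using compact_imp_bounded[OF compact_continuous_image[OF assms(2,1)]] unfolding bounded_pos by auto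

section \<open>The polar equation with complex radius\<close>

context perturbed_oscillator
begin

abbreviation "pc \<equiv> cpoly (2 * n + 1) pp"
abbreviation "qc \<equiv> cpoly (2 * n + 1) qp"
abbreviation "pc' \<equiv> cpoly' (2 * n + 1) pp"
abbreviation "qc' \<equiv> cpoly' (2 * n + 1) qp"

definition Dc :: "real \<Rightarrow> complex \<Rightarrow> real \<Rightarrow> complex" where
  "Dc eps R \<theta> = of_real om * R + of_real eps * qc R \<theta>"

text \<open>The right side of the equation for \<open>dR/d\<theta>\<close>, without the factor
  \<open>eps\<close>.\<close>

definition K :: "real \<Rightarrow> complex \<Rightarrow> real \<Rightarrow> complex" where
  "K eps R \<theta> = pc R \<theta> * R / Dc eps R \<theta>"

definition K' :: "real \<Rightarrow> complex \<Rightarrow> real \<Rightarrow> complex" where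
  "K' eps R \<theta> = ((pc' R \<theta> * R + pc R \<theta>) * Dc eps R \<theta> - pc R \<theta> * R * (of_real om + of_real eps * qc' R \<theta>)) / (Dc eps R \<theta> * Dc eps R \<theta>)"

text \<open>The Melnikov term: the change of radius in one turn to first order in
  \<open>eps\<close>, since \<open>K\<close> reduces to \<open>pc R \<theta> / om\<close> at
  \<open>eps = 0\<close>.\<close>

definition M1 :: "complex \<Rightarrow> complex" where
  "M1 R = (\<Sum>k\<le>2 * n + 1. of_real (mom k) * R ^ k) / of_real om"

lemma has_integral_pc: "((\<lambda>\<theta>. pc R \<theta> / of_real om) has_integral M1 R) {0..2 * pi}"
proof -
  have "((\<lambda>\<theta>. of_real (coeff (pp \<theta>) k) * R ^ k) has_integral of_real (mom k) * R ^ k) {0..2 * pi}" for k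
  proof -
    have "((\<lambda>\<theta>. coeff (pp \<theta>) k) has_integral mom k) {0..2 * pi}"
      unfolding mom_def by (intro integrable_integral integrable_continuous_interval poly_familyD(2)[OF poly_family_p])
    from has_integral_linear[OF this bounded_linear_of_real[where 'a = complex]]
    have "((\<lambda>\<theta>. complex_of_real (coeff (pp \<theta>) k)) has_integral of_real (mom k)) {0..2 * pi}" by (simp add: o_def)
    then show ?thesis by (rule has_integral_mult_left)
  qed
  then have "((\<lambda>\<theta>. pc R \<theta>) has_integral (\<Sum>k\<le>2 * n + 1. of_real (mom k) * R ^ k)) {0..2 * pi}"
    unfolding cpoly_def by (intro has_integral_sum) auto
  then show ?thesis unfolding M1_def by (rule has_integral_divide)
qed

lemma Dc_of_real: "Dc eps (of_real R) \<theta> = of_real (Dn eps R \<theta>)"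
  unfolding Dc_def Dn_def cpoly_of_real[OF poly_family_q] by simp

lemma K_of_real: "K eps (of_real R) \<theta> = of_real (poly (pp \<theta>) R * R / Dn eps R \<theta>)"
  unfolding K_def Dc_of_real cpoly_of_real[OF poly_family_p] by simp

lemma K_has_field_derivative:
  "Dc eps R \<theta> \<noteq> 0 \<Longrightarrow> ((\<lambda>R. K eps R \<theta>) has_field_derivative K' eps R \<theta>) (at R within S)"
  unfolding K_def K'_def Dc_def
  by (auto intro!: derivative_eq_intros cpoly_has_field_derivative)

lemma continuous_on_Dc:
  assumes "continuous_on S e" "continuous_on S f" "continuous_on S g"
  shows "continuous_on S (\<lambda>x. Dc (e x) (f x) (g x))"
  unfolding Dc_def by (intro continuous_intros continuous_on_cpoly[OF poly_family_q] assms)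

lemma continuous_on_K:
  assumes "continuous_on S e" "continuous_on S f" "continuous_on S g" "\<And>x. x \<in> S \<Longrightarrow> Dc (e x) (f x) (g x) \<noteq> 0"
  shows "continuous_on S (\<lambda>x. K (e x) (f x) (g x))" "continuous_on S (\<lambda>x. K' (e x) (f x) (g x))"
  unfolding K_def K'_def
  by (intro continuous_intros continuous_on_cpoly[OF poly_family_q] continuous_on_cpoly[OF poly_family_p]
      continuous_on_Dc assms; use assms(4) in simp)+

definition cx_box :: "real \<Rightarrow> real \<Rightarrow> real \<Rightarrow> complex set" where
  "cx_box ra rb d = box (Complex (ra - d) (- d)) (Complex (rb + d) d)"

lemma cx_box_iff: "z \<in> cx_box ra rb d \<longleftrightarrow> ra - d < Re z \<and> Re z < rb + d \<and> - d < Im z \<and> Im z < d"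
  by (auto simp: cx_box_def in_box_complex_iff)

text \<open>Compactness is used jointly in \<open>eps\<close>, radius and angle, so that
  \<open>M\<close> does not depend on \<open>eps\<close>. The last bound rests on the identity that
  \<open>K\<close> differs from its value at \<open>eps = 0\<close> by
  \<open>- eps * pc * qc / (om * Dc)\<close>.\<close>

lemma uniform_bounds:
  assumes "0 < ra" "ra \<le> rb"
  shows "\<exists>e1>0. \<exists>M>0. \<forall>eps R \<theta>. \<bar>eps\<bar> \<le> e1 \<longrightarrow> R \<in> cbox (Complex (ra / 2) (- (ra / 2))) (Complex (rb + ra / 2) (ra / 2)) \<longrightarrow>
     \<theta> \<in> {-10..10} \<longrightarrow> om * ra / 4 \<le> norm (Dc eps R \<theta>) \<and> om * ra / 4 \<le> Re (Dc eps (of_real (Re R)) \<theta>) \<and>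
     norm (K eps R \<theta>) \<le> M \<and> norm (K' eps R \<theta>) \<le> M \<and> norm (K eps R \<theta> - pc R \<theta> / of_real om) \<le> M * \<bar>eps\<bar>"
proof -
  define S where "S = cbox (Complex (ra / 2) (- (ra / 2))) (Complex (rb + ra / 2) (ra / 2))"
  have S: "compact S" by (simp add: S_def)
  have SRe: "ra / 2 \<le> Re R" "complex_of_real (Re R) \<in> S" if "R \<in> S" for R
    using that \<open>0 < ra\<close> by (auto simp: S_def in_cbox_complex_iff)
  have c2: "compact (S \<times> {-10..10::real})" by (intro compact_Times S) auto
  obtain Mq where Mq: "Mq > 0" "\<And>R \<theta>. R \<in> S \<Longrightarrow> \<theta> \<in> {-10..10} \<Longrightarrow> norm (qc R \<theta>) \<le> Mq"
    using compact_bound[OF c2 continuous_on_cpoly(1)[OF poly_family_q continuous_on_fst[OF continuous_on_id] continuous_on_snd[OF continuous_on_id]]]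
    by auto
  \<comment> \<open>Then \<open>eps * qc\<close> takes away at most half of
    \<open>om * ra / 2\<close>, the lower bound of \<open>om * Re R\<close> on the box.\<close>
  define e1 where "e1 = om * ra / (4 * Mq)"
  have e1: "e1 > 0" using om \<open>0 < ra\<close> Mq by (simp add: e1_def)
  have eq: "\<bar>eps\<bar> * norm (qc R \<theta>) \<le> om * ra / 4" if "\<bar>eps\<bar> \<le> e1" "R \<in> S" "\<theta> \<in> {-10..10}" for eps R \<theta>
  proof -
    have "\<bar>eps\<bar> * norm (qc R \<theta>) \<le> e1 * Mq" using that Mq e1 by (intro mult_mono) auto
    then show ?thesis using Mq by (simp add: e1_def)
  qed
  have D: "om * ra / 4 \<le> norm (Dc eps R \<theta>)" if *: "\<bar>eps\<bar> \<le> e1" "R \<in> S" "\<theta> \<in> {-10..10}" for eps R \<theta>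
  proof -
    have "om * ra / 2 \<le> om * Re R" using SRe[OF *(2)] om by simp
    also have "\<dots> \<le> om * norm R" using om complex_Re_le_cmod by (intro mult_left_mono) auto
    finally have "om * ra / 2 \<le> norm (of_real om * R)" using om by (simp add: norm_mult)
    moreover have "norm (of_real om * R) \<le> norm (Dc eps R \<theta>) + norm (of_real eps * qc R \<theta>)"
      unfolding Dc_def by (metis add_diff_cancel norm_triangle_ineq4)
    moreover have "norm (of_real eps * qc R \<theta>) \<le> om * ra / 4" using eq[OF *] by (simp add: norm_mult)
    ultimately show ?thesis by linarith
  qed
  have D2: "om * ra / 4 \<le> Re (Dc eps (of_real (Re R)) \<theta>)" if *: "\<bar>eps\<bar> \<le> e1" "R \<in> S" "\<theta> \<in> {-10..10}" for eps R \<theta>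
  proof -
    have "om * ra / 2 \<le> om * Re R" using SRe[OF *(2)] om by simp
    moreover have "\<bar>Re (of_real eps * qc (of_real (Re R)) \<theta>)\<bar> \<le> norm (of_real eps * qc (of_real (Re R)) \<theta>)"
      by (rule abs_Re_le_cmod)
    moreover have "norm (of_real eps * qc (of_real (Re R)) \<theta>) \<le> om * ra / 4"
      using eq[OF *(1) SRe(2)[OF *(2)] *(3)] by (simp add: norm_mult)
    ultimately show ?thesis unfolding Dc_def by simp
  qed
  have pos: "om * ra / 4 > 0" using om \<open>0 < ra\<close> by simp
  define X where "X = {-e1..e1} \<times> S \<times> {-10..10::real}"
  have cX: "compact X" unfolding X_def by (intro compact_Times S) auto
  have cont: "continuous_on X (\<lambda>x. fst x)" "continuous_on X (\<lambda>x. fst (snd x))" "continuous_on X (\<lambda>x. snd (snd x))"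
    by (intro continuous_intros)+
  have D0: "Dc (fst x) (fst (snd x)) (snd (snd x)) \<noteq> 0" if "x \<in> X" for x
  proof -
    have "\<bar>fst x\<bar> \<le> e1" "fst (snd x) \<in> S" "snd (snd x) \<in> {-10..10}" using that by (auto simp: X_def)
    from D[OF this] pos show ?thesis by auto
  qed
  obtain MK where MK: "MK > 0" "\<forall>x\<in>X. norm (K (fst x) (fst (snd x)) (snd (snd x))) \<le> MK"
    using compact_bound[OF cX continuous_on_K(1)[OF cont D0]] by blast
  obtain Md where Md: "Md > 0" "\<forall>x\<in>X. norm (K' (fst x) (fst (snd x)) (snd (snd x))) \<le> Md"
    using compact_bound[OF cX continuous_on_K(2)[OF cont D0]] by blast
  have "continuous_on X (\<lambda>x. pc (fst (snd x)) (snd (snd x)) * qc (fst (snd x)) (snd (snd x)) /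
      (of_real om * Dc (fst x) (fst (snd x)) (snd (snd x))))"
    by (intro continuous_intros continuous_on_cpoly[OF poly_family_q] continuous_on_cpoly[OF poly_family_p] continuous_on_Dc)
      (use D0 om in auto)
  from compact_bound[OF cX this] obtain ME where ME: "ME > 0" "\<forall>x\<in>X. norm (pc (fst (snd x)) (snd (snd x)) * qc (fst (snd x)) (snd (snd x)) /
      (of_real om * Dc (fst x) (fst (snd x)) (snd (snd x)))) \<le> ME" by blast
  define M where "M = max MK (max Md ME)"
  have M: "M > 0" "MK \<le> M" "Md \<le> M" "ME \<le> M" using MK by (auto simp: M_def)
  show ?thesis
  proof (rule exI[of _ e1], rule conjI, fact, rule exI[of _ M], rule conjI, fact, intro conjI allI impI)
    fix eps R \<theta> assume *: "\<bar>eps\<bar> \<le> e1"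
      "R \<in> cbox (Complex (ra / 2) (- (ra / 2))) (Complex (rb + ra / 2) (ra / 2))" "\<theta> \<in> {-10..10::real}"
    then have R: "R \<in> S" by (simp add: S_def)
    have x: "(eps, R, \<theta>) \<in> X" using * R by (auto simp: X_def)
    show "om * ra / 4 \<le> norm (Dc eps R \<theta>)" by (rule D[OF *(1) R *(3)])
    show "om * ra / 4 \<le> Re (Dc eps (of_real (Re R)) \<theta>)" by (rule D2[OF *(1) R *(3)])
    show "norm (K eps R \<theta>) \<le> M" using MK(2) x M by (force intro: order_trans)
    show "norm (K' eps R \<theta>) \<le> M" using Md(2) x M by (force intro: order_trans)
    have "K eps R \<theta> - pc R \<theta> / of_real om = - of_real eps * (pc R \<theta> * qc R \<theta> / (of_real om * Dc eps R \<theta>))"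
    proof -
      have "Dc eps R \<theta> \<noteq> 0" using D0[OF x] by simp
      then have "K eps R \<theta> - pc R \<theta> / of_real om = (pc R \<theta> * (of_real om * R) - pc R \<theta> * Dc eps R \<theta>) / (of_real om * Dc eps R \<theta>)"
        using om by (simp add: K_def field_simps)
      also have "pc R \<theta> * (of_real om * R) - pc R \<theta> * Dc eps R \<theta> = - of_real eps * (pc R \<theta> * qc R \<theta>)"
        by (simp add: Dc_def algebra_simps)
      finally show ?thesis by simp
    qed
    then have "norm (K eps R \<theta> - pc R \<theta> / of_real om) = \<bar>eps\<bar> * norm (pc R \<theta> * qc R \<theta> / (of_real om * Dc eps R \<theta>))"
      by (simp add: norm_mult norm_divide)
    also have "\<dots> \<le> \<bar>eps\<bar> * M" using ME(2) x M by (intro mult_left_mono) (force intro: order_trans)+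
    finally show "norm (K eps R \<theta> - pc R \<theta> / of_real om) \<le> M * \<bar>eps\<bar>" by (simp add: mult.commute)
  qed
qed

text \<open>Picard iteration from the box \<open>V\<close> with margin \<open>ra / 4\<close> inside
  the box \<open>W\<close> with margin \<open>ra / 2\<close>. The same complex solution supplies
  both the holomorphic map over one turn and, restricted to real initial values, the real
  orbits.\<close>

theorem polar_flow:
  assumes ra: "0 < ra" "ra \<le> rb"
  shows "\<exists>e1>0. \<exists>C>0. \<forall>eps. \<bar>eps\<bar> < e1 \<longrightarrow>
    (\<forall>R\<in>{ra / 2..rb + ra / 2}. \<forall>\<theta>\<in>{-10<..<10}. om * ra / 4 \<le> Dn eps R \<theta>) \<and>
    (\<exists>\<Psi>. \<Psi> holomorphic_on cx_box ra rb (ra / 4) \<and>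
      (\<forall>R\<in>cx_box ra rb (ra / 4). norm (\<Psi> R - R - of_real eps * M1 R) \<le> C * eps\<^sup>2 \<and> norm (\<Psi> R - R) \<le> C * \<bar>eps\<bar>) \<and>
      (\<forall>r. of_real r \<in> cx_box ra rb (ra / 4) \<longrightarrow> (\<exists>\<rho>. polar_orbit lam n a b eps (ra / 2) (rb + ra / 2) \<rho> \<and> \<rho> 0 = r \<and>
        of_real (\<rho> (2 * pi)) = \<Psi> (of_real r) \<and> (\<forall>\<theta>\<in>{-10<..<10}. \<rho> \<theta> \<in> {ra / 2<..<rb + ra / 2}))))"
proof -
  define W where "W = cx_box ra rb (ra / 2)"
  define V where "V = cx_box ra rb (ra / 4)"
  define S where "S = cbox (Complex (ra / 2) (- (ra / 2))) (Complex (rb + ra / 2) (ra / 2))"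
  have WS: "R \<in> S" if "R \<in> W" for R
    using that by (auto simp: W_def S_def cx_box_iff in_cbox_complex_iff)
  obtain e0 M where e0: "e0 > 0" and M: "M > 0"
    and bd: "\<And>eps R \<theta>. \<bar>eps\<bar> \<le> e0 \<Longrightarrow> R \<in> S \<Longrightarrow> \<theta> \<in> {-10..10} \<Longrightarrow>
      om * ra / 4 \<le> norm (Dc eps R \<theta>) \<and> om * ra / 4 \<le> Re (Dc eps (of_real (Re R)) \<theta>) \<and>
     norm (K eps R \<theta>) \<le> M \<and> norm (K' eps R \<theta>) \<le> M \<and> norm (K eps R \<theta> - pc R \<theta> / of_real om) \<le> M * \<bar>eps\<bar>"
    using uniform_bounds[OF ra] unfolding S_def by blast
  have c0: "om * ra / 4 > 0" using om ra by simp
  \<comment> \<open>The first bound keeps the path length \<open>10 * \<bar>eps\<bar> * M\<close>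
    below the gap \<open>ra / 4\<close> between the boxes; the second makes it at most
    \<open>1 / 2\<close>, as the contraction requires.\<close>
  define e1 where "e1 = min e0 (min (ra / (40 * M)) (1 / (20 * M)))"
  have e1: "e1 > 0" "e1 \<le> e0" "e1 \<le> ra / (40 * M)" "e1 \<le> 1 / (20 * M)" using e0 ra M by (auto simp: e1_def)
  \<comment> \<open>One constant for two estimates: the first summand is the quadratic error of the
    integrand times 8, a bound for \<open>2 * pi\<close>; the second bounds the change of the
    solution over angle 10.\<close>
  define C where "C = 8 * (10 * M * M + M) + 10 * M"
  have C: "C > 0" "8 * (10 * M * M + M) \<le> C" "10 * M \<le> C" using M by (auto simp: C_def intro!: add_pos_pos)
  show ?thesis
  proof (rule exI[of _ e1], rule conjI, fact, rule exI[of _ C], rule conjI, fact, intro conjI allI impI)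
    fix eps :: real assume eps: "\<bar>eps\<bar> < e1"
    have le0: "\<bar>eps\<bar> \<le> e0" using eps e1 by simp
    show Dn: "\<forall>R\<in>{ra / 2..rb + ra / 2}. \<forall>\<theta>\<in>{-10<..<10}. om * ra / 4 \<le> Dn eps R \<theta>"
    proof (intro ballI)
      fix R \<theta> :: real assume R: "R \<in> {ra / 2..rb + ra / 2}" "\<theta> \<in> {-10<..<10}"
      then have "of_real R \<in> S" using ra by (auto simp: S_def in_cbox_complex_iff)
      from bd[OF le0 this, of \<theta>] R show "om * ra / 4 \<le> Dn eps R \<theta>" by (simp add: Dc_of_real)
    qed
    define \<kappa> where "\<kappa> R \<theta> = of_real eps * K eps R \<theta>" for R \<theta>
    define \<kappa>' where "\<kappa>' R \<theta> = of_real eps * K' eps R \<theta>" for R \<theta>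
    have D0: "Dc eps R \<theta> \<noteq> 0" if "R \<in> W" "\<theta> \<in> {-10..10}" for R \<theta>
      using bd[OF le0 WS[OF that(1)] that(2)] c0 by auto
    have bK: "norm (\<kappa> R \<theta>) \<le> \<bar>eps\<bar> * M" "norm (\<kappa>' R \<theta>) \<le> \<bar>eps\<bar> * M" if "R \<in> W" "\<theta> \<in> {-10..10}" for R \<theta>
      using bd[OF le0 WS[OF that(1)] that(2)] by (auto simp: \<kappa>_def \<kappa>'_def norm_mult intro!: mult_left_mono)
    have dK: "((\<lambda>R. \<kappa> R \<theta>) has_field_derivative \<kappa>' R \<theta>) (at R within S)" if "R \<in> W" "\<theta> \<in> {-10..10}" for R \<theta> S
      unfolding \<kappa>_def \<kappa>'_def by (intro DERIV_cmult K_has_field_derivative D0 that)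
    have small: "10 * (\<bar>eps\<bar> * M) \<le> ra / 4" "10 * (\<bar>eps\<bar> * M) \<le> 1 / 2"
    proof -
      have "\<bar>eps\<bar> \<le> ra / (40 * M)" "\<bar>eps\<bar> \<le> 1 / (20 * M)" using eps e1 by linarith+
      then show "10 * (\<bar>eps\<bar> * M) \<le> ra / 4" "10 * (\<bar>eps\<bar> * M) \<le> 1 / 2" using M by (simp_all add: field_simps)
    qed
    interpret P: picard \<kappa> \<kappa>' W V 10 "\<bar>eps\<bar> * M" "\<bar>eps\<bar> * M"
    proof
      show "open V" "convex V" by (simp_all add: V_def cx_box_def open_box convex_box)
      fix R R' :: complex and \<theta> :: real
      show "R' \<in> W" if "R \<in> V" "norm (R' - R) \<le> 10 * (\<bar>eps\<bar> * M)"
        using that small(1) abs_Re_le_cmod[of "R' - R"] abs_Im_le_cmod[of "R' - R"]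
        unfolding V_def W_def cx_box_iff minus_complex.simps by linarith
      show "((\<lambda>R. \<kappa> R \<theta>) has_field_derivative \<kappa>' R \<theta>) (at R)" if "R \<in> W" "\<theta> \<in> {-10..10}"
        using that by (rule dK)
      show "norm (\<kappa> R \<theta>) \<le> \<bar>eps\<bar> * M" if "R \<in> W" "\<theta> \<in> {-10..10}" using that by (rule bK)
      show "norm (\<kappa> R \<theta> - \<kappa> R' \<theta>) \<le> \<bar>eps\<bar> * M * norm (R - R')" if "R \<in> W" "R' \<in> W" "\<theta> \<in> {-10..10}"
        by (rule field_differentiable_bound[of W "\<lambda>R. \<kappa> R \<theta>" "\<lambda>R. \<kappa>' R \<theta>"])
          (use that dK bK in \<open>auto simp: W_def cx_box_def\<close>)
      show "\<kappa> R \<theta> \<in> \<real>" if "R \<in> W" "\<theta> \<in> {-10..10}" "R \<in> \<real>"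
        using that(3) by (auto elim!: Reals_cases simp: \<kappa>_def K_of_real simp del: of_real_divide of_real_mult)
    next
      show "continuous_on (W \<times> {-10..10}) (\<lambda>(R, \<theta>). \<kappa> R \<theta>)"
        unfolding \<kappa>_def case_prod_unfold
        by (intro continuous_intros continuous_on_K) (use D0 in auto)
      show "continuous_on (W \<times> {-10..10}) (\<lambda>(R, \<theta>). \<kappa>' R \<theta>)"
        unfolding \<kappa>'_def case_prod_unfold
        by (intro continuous_intros continuous_on_K) (use D0 in auto)
    qed (use M small in auto)
    have pi10: "2 * pi \<in> {-10..10}" "2 * pi < 8" "0 < pi"
      using pi_less_4 pi_gt_zero unfolding atLeastAtMost_iff by linarith+
    show "\<exists>\<Psi>. \<Psi> holomorphic_on cx_box ra rb (ra / 4) \<and>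
      (\<forall>R\<in>cx_box ra rb (ra / 4). norm (\<Psi> R - R - of_real eps * M1 R) \<le> C * eps\<^sup>2 \<and> norm (\<Psi> R - R) \<le> C * \<bar>eps\<bar>) \<and>
      (\<forall>r. of_real r \<in> cx_box ra rb (ra / 4) \<longrightarrow> (\<exists>\<rho>. polar_orbit lam n a b eps (ra / 2) (rb + ra / 2) \<rho> \<and> \<rho> 0 = r \<and>
        of_real (\<rho> (2 * pi)) = \<Psi> (of_real r) \<and> (\<forall>\<theta>\<in>{-10<..<10}. \<rho> \<theta> \<in> {ra / 2<..<rb + ra / 2})))"
      unfolding V_def[symmetric]
    proof (intro exI[of _ "P.sol (2 * pi)"] conjI ballI allI impI)
      show "P.sol (2 * pi) holomorphic_on V" by (rule P.holomorphic_sol[OF pi10(1)])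
    next
      fix R assume R: "R \<in> V"
      have "norm (P.sol (2 * pi) R - R) \<le> 10 * (\<bar>eps\<bar> * M)" by (rule P.norm_sol_diff[OF pi10(1) R])
      also have "\<dots> = 10 * M * \<bar>eps\<bar>" by simp
      also have "\<dots> \<le> C * \<bar>eps\<bar>" using C by (intro mult_right_mono) auto
      finally show "norm (P.sol (2 * pi) R - R) \<le> C * \<bar>eps\<bar>" .
      have RW: "R \<in> W" using P.near[OF R, of R] M by simp
      have i1: "((\<lambda>s. \<kappa> (P.sol s R) s) has_integral (P.sol (2 * pi) R - P.sol 0 R)) {0..2 * pi}"
      proof (rule fundamental_theorem_of_calculus)
        fix s assume s: "s \<in> {0..2 * pi}"
        show "((\<lambda>s. P.sol s R) has_vector_derivative \<kappa> (P.sol s R) s) (at s within {0..2 * pi})"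
          by (rule has_vector_derivative_within_subset[OF P.sol_ode[OF _ R]]) (use s pi10 in auto)
      qed (use pi10 in simp)
      have i2: "((\<lambda>s. of_real eps * (pc R s / of_real om)) has_integral (of_real eps * M1 R)) {0..2 * pi}"
        by (rule has_integral_mult_right[OF has_integral_pc])
      have "norm (P.sol (2 * pi) R - P.sol 0 R - of_real eps * M1 R) \<le> (10 * M * M + M) * eps\<^sup>2 * measure lborel {0..2 * pi}"
      proof (rule has_integral_bound_real[where S = "{}", OF _ _ has_integral_diff[OF i1 i2]])
        show "0 \<le> (10 * M * M + M) * eps\<^sup>2" using M by (intro mult_nonneg_nonneg add_nonneg_nonneg) auto
        show "norm (\<kappa> (P.sol s R) s - of_real eps * (pc R s / of_real om)) \<le> (10 * M * M + M) * eps\<^sup>2"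
          if "s \<in> {0..2 * pi} - {}" for s
        proof -
          from that
          have s: "s \<in> {-10..10}" using pi10 by auto
          \<comment> \<open>Two errors of order \<open>eps\<^sup>2\<close>: freezing the radius at
            its initial value, and replacing \<open>K\<close> by its value at
            \<open>eps = 0\<close>.\<close>
          have "norm (\<kappa> (P.sol s R) s - \<kappa> R s) \<le> \<bar>eps\<bar> * M * norm (P.sol s R - R)"
            using P.sol_in s R by (intro P.lip RW s) auto
          also have "\<dots> \<le> \<bar>eps\<bar> * M * (10 * (\<bar>eps\<bar> * M))"
            using M by (intro mult_left_mono P.norm_sol_diff s R) auto
          also have "\<dots> = 10 * M * M * eps\<^sup>2" by (simp add: power2_eq_square)
          finally have n1: "norm (\<kappa> (P.sol s R) s - \<kappa> R s) \<le> 10 * M * M * eps\<^sup>2" .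
          have "norm (\<kappa> R s - of_real eps * (pc R s / of_real om)) = \<bar>eps\<bar> * norm (K eps R s - pc R s / of_real om)"
            unfolding \<kappa>_def right_diff_distrib[symmetric] by (simp add: norm_mult)
          also have "\<dots> \<le> \<bar>eps\<bar> * (M * \<bar>eps\<bar>)" using bd[OF le0 WS[OF RW] s] by (intro mult_left_mono) auto
          also have "\<dots> = M * eps\<^sup>2" by (simp add: power2_eq_square)
          finally have n2: "norm (\<kappa> R s - of_real eps * (pc R s / of_real om)) \<le> M * eps\<^sup>2" .
          show "norm (\<kappa> (P.sol s R) s - of_real eps * (pc R s / of_real om)) \<le> (10 * M * M + M) * eps\<^sup>2"
            using norm_triangle_ineq[of "\<kappa> (P.sol s R) s - \<kappa> R s" "\<kappa> R s - of_real eps * (pc R s / of_real om)"] n1 n2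
            by (simp add: distrib_right)
        qed
      qed simp
      also have "\<dots> = (10 * M * M + M) * eps\<^sup>2 * (2 * pi)" using pi10 by simp
      also have "\<dots> \<le> (10 * M * M + M) * eps\<^sup>2 * 8"
        using pi10 M by (intro mult_left_mono mult_nonneg_nonneg add_nonneg_nonneg) auto
      also have "\<dots> = 8 * (10 * M * M + M) * eps\<^sup>2" by simp
      also have "\<dots> \<le> C * eps\<^sup>2" using C by (intro mult_right_mono) auto
      finally show "norm (P.sol (2 * pi) R - R - of_real eps * M1 R) \<le> C * eps\<^sup>2"
        using P.sol_0[OF R] by simp
    next
      fix r assume r: "complex_of_real r \<in> V"
      define \<rho> where "\<rho> \<theta> = Re (P.sol \<theta> (of_real r))" for \<theta>
      have re: "of_real (\<rho> \<theta>) = P.sol \<theta> (of_real r)" if "\<theta> \<in> {-10..10}" for \<theta>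
        unfolding \<rho>_def by (rule of_real_Re, rule P.sol_real[OF that r]) simp
      have inW: "P.sol \<theta> (of_real r) \<in> W" if "\<theta> \<in> {-10..10}" for \<theta> using P.sol_in that r by blast
      have \<rho>_in: "\<rho> \<theta> \<in> {ra / 2<..<rb + ra / 2}" if "\<theta> \<in> {-10..10}" for \<theta>
        using inW[OF that] by (simp add: W_def cx_box_iff \<rho>_def)
      have "polar_orbit lam n a b eps (ra / 2) (rb + ra / 2) \<rho>"
      proof
        fix \<theta> :: real assume th: "\<theta> \<in> {-10<..<10}"
        then have th': "\<theta> \<in> {-10..10}" by auto
        show "\<rho> \<theta> \<in> {ra / 2..rb + ra / 2}" using \<rho>_in[OF th'] by auto
        have "((\<lambda>\<theta>. P.sol \<theta> (of_real r)) has_vector_derivative \<kappa> (P.sol \<theta> (of_real r)) \<theta>) (at \<theta>)"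
          using P.sol_ode[OF th' r] at_within_Icc_at[of "-10" \<theta> 10] th by simp
        then have "(\<rho> has_real_derivative Re (\<kappa> (P.sol \<theta> (of_real r)) \<theta>)) (at \<theta>)"
          unfolding has_vector_derivative_complex_iff \<rho>_def[abs_def] by blast
        also have "Re (\<kappa> (P.sol \<theta> (of_real r)) \<theta>) = eps * poly (pp \<theta>) (\<rho> \<theta>) * \<rho> \<theta> / Dn eps (\<rho> \<theta>) \<theta>"
          unfolding re[OF th', symmetric] \<kappa>_def K_of_real by simp
        finally show "(\<rho> has_real_derivative eps * poly (pp \<theta>) (\<rho> \<theta>) * \<rho> \<theta> / Dn eps (\<rho> \<theta>) \<theta>) (at \<theta>)" .
      next
        fix R \<theta> :: real assume "R \<in> {ra / 2..rb + ra / 2}" "\<theta> \<in> {-10<..<10}"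
        then have "om * ra / 4 \<le> Dn eps R \<theta>" using Dn by blast
        then show "Dn eps R \<theta> > 0" using c0 by linarith
      qed (use ra in simp)
      moreover have "\<rho> 0 = r" using P.sol_0[OF r] by (simp add: \<rho>_def)
      moreover have "of_real (\<rho> (2 * pi)) = P.sol (2 * pi) (of_real r)" by (rule re[OF pi10(1)])
      ultimately show "\<exists>\<rho>. polar_orbit lam n a b eps (ra / 2) (rb + ra / 2) \<rho> \<and> \<rho> 0 = r \<and>
        of_real (\<rho> (2 * pi)) = P.sol (2 * pi) (of_real r) \<and> (\<forall>\<theta>\<in>{-10<..<10}. \<rho> \<theta> \<in> {ra / 2<..<rb + ra / 2})"
        using \<rho>_in by (intro exI[of _ \<rho>]) auto
    qed
  qed
qed

end

definition nbhd :: "real \<Rightarrow> real \<Rightarrow> real \<Rightarrow> complex set" where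
  "nbhd A B r = (\<Union>x\<in>{A..B}. ball (complex_of_real x) r)"

lemma of_real_in_nbhd: "x \<in> {A..B} \<Longrightarrow> 0 < r \<Longrightarrow> of_real x \<in> nbhd A B r"
  by (auto simp: nbhd_def intro!: bexI[of _ x])

lemma poly_map_of_real: "poly (map_poly of_real p) (of_real x) = (of_real (poly p x) :: 'a::{real_algebra_1,field})"
  by (induction p) (simp_all add: map_poly_pCons)

section \<open>From the radius to the energy\<close>

context perturbed_oscillator
begin

text \<open>The substitution \<open>R = sqrt (2 * h)\<close> continues holomorphically to the right
  half plane. The preimage of the box is open and contains the compact interval, so one radius
  \<open>r\<close> works for all its points.\<close>

lemma csqrt_nbhd:
  assumes "0 < A" "A \<le> B"
  shows "\<exists>r>0. r < A \<and> (\<forall>z\<in>nbhd A B r. 0 < Re z \<and> csqrt (2 * z) \<in> cx_box (sqrt (2 * A)) (sqrt (2 * B)) (sqrt (2 * A) / 4))"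
proof -
  define V where "V = cx_box (sqrt (2 * A)) (sqrt (2 * B)) (sqrt (2 * A) / 4)"
  have "continuous_on {z. 0 < Re z} (\<lambda>z. csqrt (2 * z))"
    by (intro continuous_on_compose2[OF holomorphic_on_imp_continuous_on[OF holomorphic_on_csqrt]] continuous_intros)
      (auto simp: complex_nonpos_Reals_iff)
  moreover have "open {z. 0 < Re z}" by (simp add: open_halfspace_Re_gt)
  moreover have "open V" by (simp add: V_def cx_box_def open_box)
  ultimately have op: "open ({z. 0 < Re z} \<inter> (\<lambda>z. csqrt (2 * z)) -` V)"
    by (rule continuous_open_preimage)
  have sub: "complex_of_real ` {A..B} \<subseteq> {z. 0 < Re z} \<inter> (\<lambda>z. csqrt (2 * z)) -` V"
  proof (rule image_subsetI)
    fix x assume x: "x \<in> {A..B}"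
    have "csqrt (2 * of_real x) = csqrt (of_real (2 * x))" by simp
    also have "\<dots> = of_real (sqrt (2 * x))" using x assms by (intro csqrt_of_real) auto
    finally have cs: "csqrt (2 * of_real x) = of_real (sqrt (2 * x))" .
    have "sqrt (2 * A) \<le> sqrt (2 * x)" "sqrt (2 * x) \<le> sqrt (2 * B)" "0 < sqrt (2 * A)" using x assms by auto
    then have "csqrt (2 * of_real x) \<in> V"
      unfolding cs V_def cx_box_iff Re_complex_of_real Im_complex_of_real by linarith
    then show "complex_of_real x \<in> {z. 0 < Re z} \<inter> (\<lambda>z. csqrt (2 * z)) -` V" using x assms by auto
  qed
  have "compact (complex_of_real ` {A..B})" by (intro compact_continuous_image continuous_intros) auto
  from compact_subset_open_imp_ball_epsilon_subset[OF this op sub]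
  obtain e where e: "e > 0" "(\<Union>x\<in>complex_of_real ` {A..B}. ball x e) \<subseteq> {z. 0 < Re z} \<inter> (\<lambda>z. csqrt (2 * z)) -` V" by blast
  define r where "r = min e (A / 2)"
  have "nbhd A B r \<subseteq> (\<Union>x\<in>complex_of_real ` {A..B}. ball x e)" by (auto simp: nbhd_def r_def)
  then have "\<forall>z\<in>nbhd A B r. 0 < Re z \<and> csqrt (2 * z) \<in> V" using e(2) by blast
  then show ?thesis using e assms unfolding V_def by (intro exI[of _ r]) (auto simp: r_def)
qed

theorem displacement_expansion:
  assumes AB: "0 < A" "A \<le> B"
  shows "\<exists>e1>0. \<exists>C>0. \<exists>r>0. \<exists>s1>0. \<exists>s2. \<exists>c>0. r < A \<and> (\<forall>eps. \<bar>eps\<bar> < e1 \<longrightarrow>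
    (\<forall>R\<in>{s1..s2}. \<forall>\<theta>\<in>{-10<..<10}. c \<le> Dn eps R \<theta>) \<and>
    (\<exists>f. f holomorphic_on nbhd A B r \<and>
      (\<forall>x. of_real x \<in> nbhd A B r \<longrightarrow> of_real (displacement lam (pert_field lam n a b eps) x) = f (of_real x)) \<and>
      (\<forall>z\<in>nbhd A B r. norm (f z + of_real eps * (z * poly (map_poly of_real Q) z)) \<le> C * eps\<^sup>2)) \<and>
    (\<forall>x\<in>{A..B}. \<exists>\<rho>. polar_orbit lam n a b eps s1 s2 \<rho> \<and> \<rho> 0 = sqrt (2 * x) \<and>
      (\<forall>\<theta>\<in>{-10<..<10}. \<rho> \<theta> \<in> {s1<..<s2}) \<and>
      displacement lam (pert_field lam n a b eps) x = (\<rho> (2 * pi))\<^sup>2 / 2 - x))"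
proof -
  define ra rb where "ra = sqrt (2 * A)" and "rb = sqrt (2 * B)"
  have ra: "0 < ra" "ra \<le> rb" using AB by (auto simp: ra_def rb_def)
  define V where "V = cx_box ra rb (ra / 4)"
  obtain r where r: "r > 0" "r < A" and rV: "\<And>z. z \<in> nbhd A B r \<Longrightarrow> 0 < Re z \<and> csqrt (2 * z) \<in> V"
    using csqrt_nbhd[OF AB] unfolding V_def ra_def rb_def by blast
  obtain e1 C where e1: "e1 > 0" and C: "C > 0" and
    flow: "\<And>eps. \<bar>eps\<bar> < e1 \<Longrightarrow>
    (\<forall>R\<in>{ra / 2..rb + ra / 2}. \<forall>\<theta>\<in>{-10<..<10}. om * ra / 4 \<le> Dn eps R \<theta>) \<and>
    (\<exists>\<Psi>. \<Psi> holomorphic_on V \<and>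
      (\<forall>R\<in>V. norm (\<Psi> R - R - of_real eps * M1 R) \<le> C * eps\<^sup>2 \<and> norm (\<Psi> R - R) \<le> C * \<bar>eps\<bar>) \<and>
      (\<forall>r. of_real r \<in> V \<longrightarrow> (\<exists>\<rho>. polar_orbit lam n a b eps (ra / 2) (rb + ra / 2) \<rho> \<and> \<rho> 0 = r \<and>
        of_real (\<rho> (2 * pi)) = \<Psi> (of_real r) \<and> (\<forall>\<theta>\<in>{-10<..<10}. \<rho> \<theta> \<in> {ra / 2<..<rb + ra / 2}))))"
    using polar_flow[OF ra] unfolding V_def[symmetric] by blast
  define B1 where "B1 = rb + ra"
  have nV: "norm R \<le> B1" if "R \<in> V" for R
    using that cmod_le[of R] ra unfolding V_def cx_box_iff B1_def by (simp add: abs_le_iff) linarith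
  \<comment> \<open>\<open>C * B1\<close> is the error of the Melnikov term multiplied by the
    radius, and \<open>C\<^sup>2 / 2\<close> comes from the square of the change of radius.\<close>
  define C2 where "C2 = C * B1 + C\<^sup>2 / 2"
  have C2: "C2 > 0" using C ra by (auto simp: C2_def B1_def intro!: add_pos_pos)
  have main: "(\<forall>R\<in>{ra / 2..rb + ra / 2}. \<forall>\<theta>\<in>{-10<..<10}. om * ra / 4 \<le> Dn eps R \<theta>) \<and>
    (\<exists>f. f holomorphic_on nbhd A B r \<and>
      (\<forall>x. of_real x \<in> nbhd A B r \<longrightarrow> of_real (displacement lam (pert_field lam n a b eps) x) = f (of_real x)) \<and>
      (\<forall>z\<in>nbhd A B r. norm (f z + of_real eps * (z * poly (map_poly of_real Q) z)) \<le> C2 * eps\<^sup>2)) \<and>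
    (\<forall>x\<in>{A..B}. \<exists>\<rho>. polar_orbit lam n a b eps (ra / 2) (rb + ra / 2) \<rho> \<and> \<rho> 0 = sqrt (2 * x) \<and>
      (\<forall>\<theta>\<in>{-10<..<10}. \<rho> \<theta> \<in> {ra / 2<..<rb + ra / 2}) \<and>
      displacement lam (pert_field lam n a b eps) x = (\<rho> (2 * pi))\<^sup>2 / 2 - x)" if eps: "\<bar>eps\<bar> < e1" for eps
  proof -
    from flow[OF eps] obtain \<Psi> where Dn: "\<forall>R\<in>{ra / 2..rb + ra / 2}. \<forall>\<theta>\<in>{-10<..<10}. om * ra / 4 \<le> Dn eps R \<theta>"
      and hol: "\<Psi> holomorphic_on V"
      and est: "\<And>R. R \<in> V \<Longrightarrow> norm (\<Psi> R - R - of_real eps * M1 R) \<le> C * eps\<^sup>2 \<and> norm (\<Psi> R - R) \<le> C * \<bar>eps\<bar>"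
      and orb: "\<And>r. of_real r \<in> V \<Longrightarrow> \<exists>\<rho>. polar_orbit lam n a b eps (ra / 2) (rb + ra / 2) \<rho> \<and> \<rho> 0 = r \<and>
        of_real (\<rho> (2 * pi)) = \<Psi> (of_real r) \<and> (\<forall>\<theta>\<in>{-10<..<10}. \<rho> \<theta> \<in> {ra / 2<..<rb + ra / 2})" by blast
    define f where "f z = (\<Psi> (csqrt (2 * z)))\<^sup>2 / 2 - z" for z
    have real: "\<exists>\<rho>. polar_orbit lam n a b eps (ra / 2) (rb + ra / 2) \<rho> \<and> \<rho> 0 = sqrt (2 * x) \<and>
      (\<forall>\<theta>\<in>{-10<..<10}. \<rho> \<theta> \<in> {ra / 2<..<rb + ra / 2}) \<and>
      displacement lam (pert_field lam n a b eps) x = (\<rho> (2 * pi))\<^sup>2 / 2 - x \<and>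
      of_real (displacement lam (pert_field lam n a b eps) x) = f (of_real x)"
      if x: "complex_of_real x \<in> nbhd A B r" for x
    proof -
      have x0: "x > 0" using rV[OF x] by simp
      have cs: "csqrt (2 * of_real x) = of_real (sqrt (2 * x))"
        using csqrt_of_real[of "2 * x"] x0 by simp
      then have "of_real (sqrt (2 * x)) \<in> V" using rV[OF x] by simp
      from orb[OF this] obtain \<rho> where \<rho>: "polar_orbit lam n a b eps (ra / 2) (rb + ra / 2) \<rho>" "\<rho> 0 = sqrt (2 * x)"
        "of_real (\<rho> (2 * pi)) = \<Psi> (of_real (sqrt (2 * x)))" "\<forall>\<theta>\<in>{-10<..<10}. \<rho> \<theta> \<in> {ra / 2<..<rb + ra / 2}" by blast
      have "displacement lam (pert_field lam n a b eps) x = (\<rho> (2 * pi))\<^sup>2 / 2 - x"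
        using polar_orbit.return_map_polar[OF \<rho>(1)] \<rho>(2) x0 by (simp add: displacement_def)
      moreover have "f (of_real x) = of_real ((\<rho> (2 * pi))\<^sup>2 / 2 - x)"
        unfolding f_def cs \<rho>(3)[symmetric] by simp
      ultimately show ?thesis using \<rho> by auto
    qed
    have "f holomorphic_on nbhd A B r"
    proof -
      have "(\<lambda>z. csqrt (2 * z)) holomorphic_on nbhd A B r"
        by (intro holomorphic_on_compose_gen[OF _ holomorphic_on_csqrt, unfolded o_def] holomorphic_intros)
          (auto dest!: rV simp: complex_nonpos_Reals_iff)
      then have "(\<lambda>z. \<Psi> (csqrt (2 * z))) holomorphic_on nbhd A B r"
        by (rule holomorphic_on_compose_gen[OF _ hol, unfolded o_def]) (use rV in auto)
      then show ?thesis unfolding f_def by (intro holomorphic_intros) auto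
    qed
    moreover have "norm (f z + of_real eps * (z * poly (map_poly of_real Q) z)) \<le> C2 * eps\<^sup>2" if z: "z \<in> nbhd A B r" for z
    proof -
      define s where "s = csqrt (2 * z)"
      have s: "s \<in> V" "s\<^sup>2 / 2 = z" using rV[OF z] by (auto simp: s_def)
      \<comment> \<open>With \<open>\<Psi> s = s + y\<close> the energies differ by
        \<open>y * s + y\<^sup>2 / 2\<close>, and only the first summand has a part of first order
        in \<open>eps\<close>.\<close>
      define y where "y = \<Psi> s - s"
      have "M1 s * s = - (z * poly (map_poly of_real Q) z)"
        using sum_mom_eq_Q[of s] s(2) by (simp add: M1_def)
      then have "f z + of_real eps * (z * poly (map_poly of_real Q) z) = (\<Psi> s)\<^sup>2 / 2 - s\<^sup>2 / 2 - of_real eps * (M1 s * s)"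
        unfolding f_def s_def[symmetric] s(2) by simp
      also have "\<dots> = (y - of_real eps * M1 s) * s + y\<^sup>2 / 2"
        by (simp add: y_def power2_eq_square field_simps)
      also have "norm \<dots> \<le> norm (y - of_real eps * M1 s) * norm s + (norm y)\<^sup>2 / 2"
        by (intro order_trans[OF norm_triangle_ineq]) (simp add: norm_mult norm_divide norm_power)
      also have "\<dots> \<le> (C * eps\<^sup>2) * B1 + (C * \<bar>eps\<bar>)\<^sup>2 / 2"
        using est[OF s(1)] nV[OF s(1)] C ra by (intro add_mono mult_mono divide_right_mono power_mono) (auto simp: y_def)
      also have "\<dots> = C2 * eps\<^sup>2" by (simp add: C2_def power_mult_distrib algebra_simps)
      finally show ?thesis .
    qed
    moreover have "\<exists>\<rho>. polar_orbit lam n a b eps (ra / 2) (rb + ra / 2) \<rho> \<and> \<rho> 0 = sqrt (2 * x) \<and>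
      (\<forall>\<theta>\<in>{-10<..<10}. \<rho> \<theta> \<in> {ra / 2<..<rb + ra / 2}) \<and>
      displacement lam (pert_field lam n a b eps) x = (\<rho> (2 * pi))\<^sup>2 / 2 - x" if "x \<in> {A..B}" for x
      using real[OF of_real_in_nbhd[OF that r(1)]] by blast
    moreover have "of_real (displacement lam (pert_field lam n a b eps) x) = f (of_real x)"
      if "of_real x \<in> nbhd A B r" for x using real[OF that] by blast
    ultimately show ?thesis using Dn by blast
  qed
  have "om * ra / 4 > 0" "ra / 2 > 0" using om ra by auto
  then show ?thesis using e1 C2 r main by blast
qed

text \<open>What both bounds need for a single \<open>eps\<close>: the weighted count of zeros,
  closeness of \<open>- D x / eps\<close> to the Abelian integral, and the orbits behind the values
  of \<open>D\<close>. The constants are parameters in order to be chosen before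
  \<open>eps\<close>.\<close>

definition displacement_controlled :: "real \<Rightarrow> real \<Rightarrow> real \<Rightarrow> real \<Rightarrow> real \<Rightarrow> real \<Rightarrow> real \<Rightarrow> (real \<Rightarrow> real) \<Rightarrow> bool" where
  "displacement_controlled A B C s1 s2 c eps D \<longleftrightarrow>
    finite {x \<in> {A..B}. D x = 0} \<and> (\<Sum>x\<in>{x \<in> {A..B}. D x = 0}. zero_mult D x) \<le> enat (degree Q) \<and>
    (\<forall>x\<in>{A..B}. isCont D x \<and> \<bar>- D x / eps - x * poly Q x\<bar> \<le> C * \<bar>eps\<bar>) \<and>
    (\<forall>R\<in>{s1..s2}. \<forall>\<theta>\<in>{-10<..<10}. c \<le> Dn eps R \<theta>) \<and>
    (\<forall>x\<in>{A..B}. \<exists>\<rho>. polar_orbit lam n a b eps s1 s2 \<rho> \<and> \<rho> 0 = sqrt (2 * x) \<and>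
      (\<forall>\<theta>\<in>{-10<..<10}. \<rho> \<theta> \<in> {s1<..<s2}) \<and> D x = (\<rho> (2 * pi))\<^sup>2 / 2 - x)"

theorem displacement_zeros:
  assumes AB: "0 < A" "A \<le> B" and Q0: "Q \<noteq> 0"
  shows "\<exists>e0>0. \<exists>C>0. \<exists>s1>0. \<exists>s2. \<exists>c>0. \<forall>eps. 0 < \<bar>eps\<bar> \<longrightarrow> \<bar>eps\<bar> < e0 \<longrightarrow>
    displacement_controlled A B C s1 s2 c eps (displacement lam (pert_field lam n a b eps))"
proof -
  let ?Qc = "map_poly complex_of_real Q"
  obtain e1 C r s1 s2 c where pos: "e1 > 0" "C > 0" "s1 > 0" "c > 0" and r: "r > 0" "r < A" and
    pk: "\<And>eps. \<bar>eps\<bar> < e1 \<Longrightarrow> (\<forall>R\<in>{s1..s2}. \<forall>\<theta>\<in>{-10<..<10}. c \<le> Dn eps R \<theta>) \<and>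
     (\<exists>f. f holomorphic_on nbhd A B r \<and>
      (\<forall>x. of_real x \<in> nbhd A B r \<longrightarrow> of_real (displacement lam (pert_field lam n a b eps) x) = f (of_real x)) \<and>
      (\<forall>z\<in>nbhd A B r. norm (f z + of_real eps * (z * poly ?Qc z)) \<le> C * eps\<^sup>2)) \<and>
    (\<forall>x\<in>{A..B}. \<exists>\<rho>. polar_orbit lam n a b eps s1 s2 \<rho> \<and> \<rho> 0 = sqrt (2 * x) \<and>
      (\<forall>\<theta>\<in>{-10<..<10}. \<rho> \<theta> \<in> {s1<..<s2}) \<and>
      displacement lam (pert_field lam n a b eps) x = (\<rho> (2 * pi))\<^sup>2 / 2 - x)"
    using displacement_expansion[OF AB] by metis
  obtain \<eta> where \<eta>: "\<eta> > 0" and count: "\<And>\<phi> f c. c \<noteq> 0 \<Longrightarrow> f holomorphic_on nbhd A B r \<Longrightarrow>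
     (\<forall>x. complex_of_real x \<in> nbhd A B r \<longrightarrow> of_real (\<phi> x) = f (of_real x)) \<Longrightarrow>
     (\<forall>z\<in>nbhd A B r. norm (of_real c * f z - z * poly ?Qc z) < \<eta>) \<Longrightarrow>
     finite {x \<in> {A..B}. \<phi> x = 0} \<and>
     (\<Sum>x\<in>{x \<in> {A..B}. \<phi> x = 0}. zero_mult \<phi> x) \<le> enat (degree Q)"
    using sum_zero_mult_le_degree[OF r Q0, of B] unfolding nbhd_def[symmetric] by blast
  \<comment> \<open>After division by \<open>- eps\<close> the error is
    \<open>C * \<bar>eps\<bar>\<close>, which this keeps below the tolerance \<open>\<eta>\<close>
    of the counting theorem.\<close>
  define e0 where "e0 = min e1 (\<eta> / C)"
  have e0: "e0 > 0" using pos \<eta> by (simp add: e0_def)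
  have "displacement_controlled A B C s1 s2 c eps (displacement lam (pert_field lam n a b eps))"
    if eps: "0 < \<bar>eps\<bar>" "\<bar>eps\<bar> < e0" for eps
  proof -
    define D where "D = displacement lam (pert_field lam n a b eps)"
    have "\<bar>eps\<bar> < e1" using eps by (simp add: e0_def)
    note pk = pk[OF this, folded D_def]
    then obtain f where f: "f holomorphic_on nbhd A B r"
      "\<forall>x. of_real x \<in> nbhd A B r \<longrightarrow> of_real (D x) = f (of_real x)"
      "\<forall>z\<in>nbhd A B r. norm (f z + of_real eps * (z * poly ?Qc z)) \<le> C * eps\<^sup>2" by blast
    have close: "norm (of_real (- 1 / eps) * f z - z * poly ?Qc z) \<le> C * \<bar>eps\<bar>" if z: "z \<in> nbhd A B r" for z
    proof -
      have "of_real (- 1 / eps) * f z - z * poly ?Qc z =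
          of_real (- 1 / eps) * (f z + of_real eps * (z * poly ?Qc z))"
        using eps by (simp add: field_simps)
      then have "norm (of_real (- 1 / eps) * f z - z * poly ?Qc z) =
          norm (f z + of_real eps * (z * poly ?Qc z)) / \<bar>eps\<bar>"
        by (simp add: norm_mult norm_divide)
      also have "\<dots> \<le> C * eps\<^sup>2 / \<bar>eps\<bar>" using f(3) z by (intro divide_right_mono) auto
      also have "\<dots> = C * \<bar>eps\<bar>" using eps by (simp add: power2_eq_square field_simps abs_mult_self_eq)
      finally show ?thesis .
    qed
    have Ce: "C * \<bar>eps\<bar> < \<eta>" using eps pos by (simp add: e0_def field_simps)
    have "finite {x \<in> {A..B}. D x = 0} \<and> (\<Sum>x\<in>{x \<in> {A..B}. D x = 0}. zero_mult D x) \<le> enat (degree Q)"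
      by (rule count[of "- 1 / eps" f]) (use eps f close Ce in \<open>auto intro: le_less_trans\<close>)
    moreover have "isCont D x \<and> \<bar>- D x / eps - x * poly Q x\<bar> \<le> C * \<bar>eps\<bar>" if "x \<in> {A..B}" for x
    proof
      have oN: "open (nbhd A B r)" by (auto simp: nbhd_def)
      have inN: "complex_of_real x \<in> nbhd A B r" by (rule of_real_in_nbhd[OF that r(1)])
      show "isCont D x"
        using deriv_of_real_restriction[OF f(1) oN f(2)[rule_format] inN] DERIV_isCont by blast
      have "of_real (- D x / eps - x * poly Q x) = of_real (- 1 / eps) * f (of_real x) - of_real x * poly ?Qc (of_real x)"
        using f(2)[rule_format, OF inN, symmetric] by (simp add: poly_map_of_real)
      then show "\<bar>- D x / eps - x * poly Q x\<bar> \<le> C * \<bar>eps\<bar>"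
        using close[OF inN] by (metis norm_of_real)
    qed
    ultimately show ?thesis unfolding displacement_controlled_def D_def[symmetric] using pk by blast
  qed
  then show ?thesis using e0 pos by blast
qed

text \<open>A closed orbit through the controlled part of the transversal meets the transversal only
  once and is determined by the meeting point. This makes the energy in \<open>cycle_mult\<close>
  well defined and the map from cycles to zeros injective.\<close>

lemma closed_orbit_displacement_zero:
  assumes \<rho>: "polar_orbit lam n a b eps s1 s2 \<rho>" "\<rho> 0 = sqrt (2 * h)"
      "displacement lam (pert_field lam n a b eps) h = (\<rho> (2 * pi))\<^sup>2 / 2 - h" and h: "0 < h"
    and C: "closed_orbit (pert_field lam n a b eps) C" "unz (of_real (sqrt (2 * h))) \<in> C"
  shows "displacement lam (pert_field lam n a b eps) h = 0 \<and> C \<inter> Transv lam = {unz (of_real (sqrt (2 * h)))} \<and>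
    C = polar_orbit.Orb lam \<rho>"
proof -
  interpret O: polar_orbit lam n a b eps s1 s2 \<rho> by (rule \<rho>)
  have "\<rho> (2 * pi) = \<rho> 0 \<and> C = O.Orb" using C \<rho>(2) by (intro O.closed_orbit_through) auto
  then show ?thesis using O.Orb_Transv \<rho>(2,3) h by auto
qed

theorem upper_bound:
  assumes Q0: "Q \<noteq> 0"
  shows "at_most_bifurcate lam n a b (n - 1)"
  unfolding at_most_bifurcate_def Let_def
proof (intro allI impI, elim conjE)
  fix A B :: real assume AB: "0 < A" "A \<le> B"
  obtain e0 C s1 s2 c where e0: "e0 > 0" and
    pk: "\<And>eps. 0 < \<bar>eps\<bar> \<Longrightarrow> \<bar>eps\<bar> < e0 \<Longrightarrow>
      displacement_controlled A B C s1 s2 c eps (displacement lam (pert_field lam n a b eps))"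
    using displacement_zeros[OF AB Q0] by blast
  show "\<exists>eps0>0. \<forall>eps. 0 < \<bar>eps\<bar> \<and> \<bar>eps\<bar> < eps0 \<longrightarrow>
      finite (cycles_meeting lam (pert_field lam n a b eps) A B) \<and>
      (\<forall>Ca\<in>cycles_meeting lam (pert_field lam n a b eps) A B. 1 \<le> cycle_mult lam (pert_field lam n a b eps) Ca) \<and>
      sum (cycle_mult lam (pert_field lam n a b eps)) (cycles_meeting lam (pert_field lam n a b eps) A B) \<le> enat (n - 1)"
  proof (intro exI[of _ e0] conjI allI impI)
    show "e0 > 0" by (rule e0)
    fix eps assume eps: "0 < \<bar>eps\<bar> \<and> \<bar>eps\<bar> < e0"
    define X where "X = pert_field lam n a b eps"
    define S where "S = cycles_meeting lam X A B"
    define Z where "Z = {x \<in> {A..B}. displacement lam X x = 0}"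
    have Z: "finite Z" "(\<Sum>x\<in>Z. zero_mult (displacement lam X) x) \<le> enat (degree Q)"
      and po: "\<And>x. x \<in> {A..B} \<Longrightarrow> \<exists>\<rho>. polar_orbit lam n a b eps s1 s2 \<rho> \<and> \<rho> 0 = sqrt (2 * x) \<and>
      displacement lam X x = (\<rho> (2 * pi))\<^sup>2 / 2 - x"
      using pk[of eps] eps unfolding displacement_controlled_def Z_def X_def by blast+
    define F where "F C = (THE h. \<exists>z\<in>C \<inter> Transv lam. Ham lam z = h)" for C
    have SC: "F C \<in> Z \<and> closed_orbit X C \<and> unz (of_real (sqrt (2 * F C))) \<in> C" if CS: "C \<in> S" for C
    proof -
      obtain z where C: "closed_orbit X C" and z: "z \<in> C" "z \<in> Transv lam" "Ham lam z \<in> {A..B}"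
        using CS unfolding S_def cycles_meeting_def limit_cycle_def by blast
      define h where "h = Ham lam z"
      have h: "h \<in> {A..B}" "h > 0" using z AB by (auto simp: h_def)
      obtain R where R: "R > 0" "zc z = of_real R" using z(2) Transv_zc by blast
      then have "R\<^sup>2 = 2 * h" by (simp add: h_def Ham_zc)
      then have "R = sqrt (2 * h)" using R by (simp add: real_sqrt_unique)
      then have zu: "z = unz (of_real (sqrt (2 * h)))" using R by (metis unz_zc)
      obtain \<rho> where \<rho>: "polar_orbit lam n a b eps s1 s2 \<rho>" "\<rho> 0 = sqrt (2 * h)"
        "displacement lam X h = (\<rho> (2 * pi))\<^sup>2 / 2 - h" using po[OF h(1)] by blast
      have d: "displacement lam X h = 0" "C \<inter> Transv lam = {z}"
        using closed_orbit_displacement_zero[OF \<rho>(1,2) _ h(2)] \<rho>(3) C z(1) zu unfolding X_def by blast+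
      have "F C = h" unfolding F_def d(2) by (auto simp: h_def)
      then show ?thesis using d h C z(1) zu by (simp add: Z_def)
    qed
    have inj: "inj_on F S"
    proof (rule inj_onI)
      fix C1 C2 assume S: "C1 \<in> S" "C2 \<in> S" "F C1 = F C2"
      define h where "h = F C1"
      have h: "h \<in> {A..B}" "h > 0" using SC[OF S(1)] AB by (auto simp: h_def Z_def)
      obtain \<rho> where \<rho>: "polar_orbit lam n a b eps s1 s2 \<rho>" "\<rho> 0 = sqrt (2 * h)"
        "displacement lam X h = (\<rho> (2 * pi))\<^sup>2 / 2 - h" using po[OF h(1)] by blast
      have "C1 = polar_orbit.Orb lam \<rho>" "C2 = polar_orbit.Orb lam \<rho>"
        using closed_orbit_displacement_zero[OF \<rho>(1,2) _ h(2)] \<rho>(3) SC[OF S(1)] SC[OF S(2)] S(3)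
        unfolding X_def h_def by auto
      then show "C1 = C2" by simp
    qed
    have FZ: "F ` S \<subseteq> Z" using SC by blast
    then have fin: "finite S" using Z(1) inj by (meson finite_imageD finite_subset)
    have cm: "cycle_mult lam X C = zero_mult (displacement lam X) (F C)" for C
      by (simp add: cycle_mult_def F_def)
    have "sum (cycle_mult lam X) S = (\<Sum>h\<in>F ` S. zero_mult (displacement lam X) h)"
      by (simp add: sum.reindex[OF inj] cm)
    also have "\<dots> \<le> (\<Sum>h\<in>Z. zero_mult (displacement lam X) h)" using Z(1) FZ by (intro sum_mono2) auto
    also have "\<dots> \<le> enat (degree Q)" by (rule Z(2))
    also have "\<dots> \<le> enat (n - 1)" using degree_Q by simp
    finally show "sum (cycle_mult lam (pert_field lam n a b eps)) (cycles_meeting lam (pert_field lam n a b eps) A B) \<le> enat (n - 1)"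
      by (simp add: S_def X_def)
    show "finite (cycles_meeting lam (pert_field lam n a b eps) A B)" using fin by (simp add: S_def X_def)
    have "1 \<le> cycle_mult lam X C" if "C \<in> S" for C
      unfolding cm using SC[OF that] by (intro zero_mult_pos) (simp add: Z_def)
    then show "\<forall>Ca\<in>cycles_meeting lam (pert_field lam n a b eps) A B. 1 \<le> cycle_mult lam (pert_field lam n a b eps) Ca"
      by (simp add: S_def X_def)
  qed
qed

text \<open>The counting theorem for the displacement function applies again, with the integral
  itself as holomorphic function and with error 0.\<close>

theorem abelian_zeros:
  assumes Q0: "Q \<noteq> 0"
  defines "Z \<equiv> {h. h > 0 \<and> abelian_integral lam n a b h = 0}"
  shows "finite Z \<and> (\<Sum>h\<in>Z. zero_mult (abelian_integral lam n a b) h) \<le> enat (n - 1)"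
proof -
  have "Z \<subseteq> {h. poly Q h = 0}" by (auto simp: Z_def abelian_integral_poly)
  then have fin: "finite Z" using poly_roots_finite[OF Q0] finite_subset by blast
  \<comment> \<open>The element 1 provides a minimum and a maximum even when there are no
    zeros.\<close>
  define A B where "A = Min (insert 1 Z)" and "B = Max (insert 1 Z)"
  have A: "0 < A" using fin by (auto simp: A_def Z_def)
  have Zeq: "Z = {x \<in> {A..B}. abelian_integral lam n a b x = 0}"
  proof -
    have "x \<in> {A..B}" if "x \<in> Z" for x using fin that by (auto simp: A_def B_def)
    moreover have "x > 0" if "x \<in> {A..B}" for x using that A by auto
    ultimately show ?thesis unfolding Z_def by blast
  qed
  \<comment> \<open>All real points of the neighbourhood stay positive, which is where the formula
    for the integral is known.\<close>
  define r where "r = A / 2"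
  have r: "0 < r" "r < A" using A by (auto simp: r_def)
  have N: "x > 0" if xN: "complex_of_real x \<in> nbhd A B r" for x
  proof -
    obtain y where "y \<in> {A..B}" "dist (complex_of_real y) (of_real x) < r"
      using xN unfolding nbhd_def UN_iff mem_ball by blast
    then have "\<bar>y - x\<bar> < r" "A \<le> y" by (auto simp: dist_real_def)
    then show ?thesis using r by auto
  qed
  obtain \<eta> where \<eta>: "\<eta> > 0" and count: "\<And>\<phi> f c. c \<noteq> 0 \<Longrightarrow> f holomorphic_on nbhd A B r \<Longrightarrow>
     (\<forall>x. complex_of_real x \<in> nbhd A B r \<longrightarrow> of_real (\<phi> x) = f (of_real x)) \<Longrightarrow>
     (\<forall>z\<in>nbhd A B r. norm (of_real c * f z - z * poly (map_poly of_real Q) z) < \<eta>) \<Longrightarrow>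
     finite {x \<in> {A..B}. \<phi> x = 0} \<and>
     (\<Sum>x\<in>{x \<in> {A..B}. \<phi> x = 0}. zero_mult \<phi> x) \<le> enat (degree Q)"
    using sum_zero_mult_le_degree[OF r Q0, of B] unfolding nbhd_def[symmetric] by blast
  have "finite Z \<and> (\<Sum>h\<in>Z. zero_mult (abelian_integral lam n a b) h) \<le> enat (degree Q)"
    unfolding Zeq
  proof (rule count[of 1 "\<lambda>z. z * poly (map_poly of_real Q) z"])
    show "\<forall>x. complex_of_real x \<in> nbhd A B r \<longrightarrow>
        of_real (abelian_integral lam n a b x) = of_real x * poly (map_poly of_real Q) (of_real x :: complex)"
      using N by (auto simp: abelian_integral_poly poly_map_of_real)
  qed (use \<eta> in \<open>auto intro!: holomorphic_intros\<close>)
  then show ?thesis using degree_Q by (auto intro: order_trans)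
qed

end

section \<open>Sharpness\<close>

context perturbed_oscillator
begin

text \<open>Every sign change of \<open>Q\<close> persists in the displacement function and yields a limit cycle.\<close>

theorem lower_bound:
  assumes "0 < m" and Q0: "Q \<noteq> 0" and x: "\<And>i. i \<le> m \<Longrightarrow> 0 < x i" "\<And>i. i < m \<Longrightarrow> x i < x (Suc i)"
    and sign: "\<And>i. i < m \<Longrightarrow> poly Q (x i) * poly Q (x (Suc i)) < 0"
  shows "at_least_bifurcate lam n a b m"
proof -
  define A B where "A = x 0" and "B = x m"
  have mono: "x i < x j" if "i < j" "j \<le> m" for i j
    using that
  proof (induction j)
    case (Suc j)
    then show ?case using x(2)[of j] by (cases "i = j") auto
  qed simp
  have AB: "0 < A" "A < B" using x(1)[of 0] mono[of 0 m] \<open>0 < m\<close> by (auto simp: A_def B_def)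
  have xin: "x i \<in> {A..B}" if "i \<le> m" for i
    using mono[of 0 i] mono[of i m] that by (cases "i = 0"; cases "i = m") (auto simp: A_def B_def less_imp_le)
  have AB': "A \<le> B" using AB by simp
  obtain e1 C s1 s2 c where e1: "e1 > 0" and C: "C > 0" and s1: "s1 > 0" and c: "c > 0" and
    pk: "\<And>eps. 0 < \<bar>eps\<bar> \<Longrightarrow> \<bar>eps\<bar> < e1 \<Longrightarrow>
      displacement_controlled A B C s1 s2 c eps (displacement lam (pert_field lam n a b eps))"
    using displacement_zeros[OF AB(1) AB' Q0] by blast
  \<comment> \<open>The smallest size of the Abelian integral at the nodes; an error below it
    preserves all signs there.\<close>
  define \<mu> where "\<mu> = Min ((\<lambda>i. \<bar>x i * poly Q (x i)\<bar>) ` {..m})"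
  have Qx: "poly Q (x i) \<noteq> 0" if "i \<le> m" for i
    using sign[of i] sign[of "i - 1"] that \<open>0 < m\<close> by (cases "i = m") auto
  have \<mu>: "\<mu> > 0" "\<And>i. i \<le> m \<Longrightarrow> \<mu> \<le> \<bar>x i * poly Q (x i)\<bar>"
  proof -
    have "0 < \<bar>x i * poly Q (x i)\<bar>" if "i \<le> m" for i using Qx[OF that] x(1)[OF that] by simp
    then show "\<mu> > 0" by (auto simp: \<mu>_def)
  qed (auto simp: \<mu>_def)
  define e0 where "e0 = min e1 (\<mu> / C)"
  have e0: "e0 > 0" using e1 C \<mu> by (simp add: e0_def)
  have "\<exists>F\<subseteq>cycles_meeting lam (pert_field lam n a b eps) A B. finite F \<and> card F = m"
    if eps: "0 < \<bar>eps\<bar> \<and> \<bar>eps\<bar> < e0" for eps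
  proof -
    define X where "X = pert_field lam n a b eps"
    define D where "D = displacement lam X"
    define Z where "Z = {x \<in> {A..B}. D x = 0}"
    have "\<bar>eps\<bar> < e1" "0 < \<bar>eps\<bar>" using eps by (auto simp: e0_def)
    note pk = pk[OF this(2,1), folded X_def, folded D_def, unfolded displacement_controlled_def]
    have finZ: "finite Z" and contD: "\<And>y. y \<in> {A..B} \<Longrightarrow> isCont D y"
      and Dn: "\<forall>R\<in>{s1..s2}. \<forall>\<theta>\<in>{-10<..<10}. c \<le> Dn eps R \<theta>"
      and po: "\<And>x. x \<in> {A..B} \<Longrightarrow> \<exists>\<rho>. polar_orbit lam n a b eps s1 s2 \<rho> \<and> \<rho> 0 = sqrt (2 * x) \<and>
      (\<forall>\<theta>\<in>{-10<..<10}. \<rho> \<theta> \<in> {s1<..<s2}) \<and> D x = (\<rho> (2 * pi))\<^sup>2 / 2 - x"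
      using pk unfolding Z_def by blast+
    have Ce: "C * \<bar>eps\<bar> < \<mu>" using eps C by (simp add: e0_def field_simps)
    have Dx: "\<bar>- D (x i) / eps - x i * poly Q (x i)\<bar> < \<bar>x i * poly Q (x i)\<bar>" if i: "i \<le> m" for i
    proof -
      have "\<bar>- D (x i) / eps - x i * poly Q (x i)\<bar> \<le> C * \<bar>eps\<bar>" using pk xin[OF i] by blast
      then show ?thesis using Ce \<mu>(2)[OF i] by linarith
    qed
    have Dsign: "D (x i) * D (x (Suc i)) < 0" if i: "i < m" for i
    proof -
      define u v where "u = - D (x i) / eps" and "v = - D (x (Suc i)) / eps"
      define p q where "p = x i * poly Q (x i)" and "q = x (Suc i) * poly Q (x (Suc i))"
      have pq: "p * q < 0"
      proof -
        have "p * q = (x i * x (Suc i)) * (poly Q (x i) * poly Q (x (Suc i)))" by (simp add: p_def q_def mult_ac)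
        moreover have "x i * x (Suc i) > 0" using x(1) i by simp
        ultimately show ?thesis using sign[OF i] by (simp add: mult_pos_neg)
      qed
      \<comment> \<open>A number closer to \<open>p\<close> than 0 is has the sign of
        \<open>p\<close>.\<close>
      have "\<bar>u - p\<bar> < \<bar>p\<bar>" "\<bar>v - q\<bar> < \<bar>q\<bar>" using Dx[of i] Dx[of "Suc i"] i by (auto simp: u_def v_def p_def q_def)
      then have "u * v < 0" using pq unfolding mult_less_0_iff by linarith
      moreover have "u * v = D (x i) * D (x (Suc i)) / eps\<^sup>2" by (simp add: u_def v_def power2_eq_square)
      ultimately show ?thesis using eps by (simp add: divide_less_0_iff)
    qed
    have "\<exists>h. x i < h \<and> h < x (Suc i) \<and> D h = 0" if i: "i < m" for i
    proof -
      have le: "x i \<le> x (Suc i)" using x(2)[OF i] by simp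
      have ci: "isCont D y" if "x i \<le> y \<and> y \<le> x (Suc i)" for y
        using contD[of y] xin[of i] xin[of "Suc i"] i that by auto
      have "\<exists>h\<ge>x i. h \<le> x (Suc i) \<and> D h = 0"
      proof (cases "D (x i) < 0")
        case True
        then show ?thesis using Dsign[OF i] le ci by (intro IVT) (auto simp: mult_less_0_iff)
      next
        case False
        then show ?thesis using Dsign[OF i] le ci by (intro IVT2) (auto simp: mult_less_0_iff)
      qed
      then obtain h where "x i \<le> h" "h \<le> x (Suc i)" "D h = 0" by blast
      moreover have "D (x i) \<noteq> 0" "D (x (Suc i)) \<noteq> 0" using Dsign[OF i] by auto
      ultimately show ?thesis by (metis less_eq_real_def)
    qed
    then obtain h where h: "\<And>i. i < m \<Longrightarrow> x i < h i \<and> h i < x (Suc i) \<and> D (h i) = 0" by metis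
    have hAB: "A < h i" "h i < B" "h i \<in> {A..B}" if "i < m" for i
      using h[OF that] xin[of i] xin[of "Suc i"] that by auto
    have hmono: "h i < h j" if "i < j" "j < m" for i j
    proof -
      have "x (Suc i) \<le> x j" using mono[of "Suc i" j] that by (cases "Suc i = j") auto
      then show ?thesis using h[of i] h[of j] that by auto
    qed
    have "\<exists>C. limit_cycle X C \<and> C \<inter> Transv lam = {unz (of_real (sqrt (2 * h i)))}" if i: "i < m" for i
    proof -
      define k where "k = h i"
      have k: "A < k" "k < B" "k \<in> {A..B}" "0 < k" "D k = 0" using hAB[OF i] AB h[OF i] by (auto simp: k_def)
      obtain \<rho> where \<rho>: "polar_orbit lam n a b eps s1 s2 \<rho>" "\<rho> 0 = sqrt (2 * k)"
        "\<forall>\<theta>\<in>{-10<..<10}. \<rho> \<theta> \<in> {s1<..<s2}" "D k = (\<rho> (2 * pi))\<^sup>2 / 2 - k" using po[OF k(3)] by blast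
      interpret O: polar_orbit lam n a b eps s1 s2 \<rho> by (rule \<rho>)
      have "(\<rho> (2 * pi))\<^sup>2 = (\<rho> 0)\<^sup>2" using \<rho>(2,4) k by simp
      then have closes: "\<rho> (2 * pi) = \<rho> 0" using O.\<rho>0 O.\<rho>2pi by (simp add: power2_eq_iff_nonneg)
      obtain d where d: "d > 0" "\<forall>y\<in>(\<lambda>h. sqrt (2 * h)) ` Z. y \<noteq> \<rho> 0 \<longrightarrow> d \<le> dist (\<rho> 0) y"
        using finite_set_avoid[of "(\<lambda>h. sqrt (2 * h)) ` Z" "\<rho> 0"] finZ by blast
      \<comment> \<open>The gate must exclude the radii of all other zeros and stay over
        \<open>[A, B]\<close>, where closed orbits are known to be zeros of
        \<open>D\<close>.\<close>
      define \<delta> where "\<delta> = min d (min (\<rho> 0 - sqrt (2 * A)) (sqrt (2 * B) - \<rho> 0))"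
      have \<delta>: "\<delta> > 0" using d k \<rho>(2) by (simp add: \<delta>_def)
      have "limit_cycle X O.Orb"
        unfolding X_def
      proof (rule O.limit_cycle_Orb[OF closes s1 c \<delta>])
        show "\<rho> \<theta> \<in> {s1<..<s2}" if "\<theta> \<in> {-10<..<10}" for \<theta> using \<rho>(3) that by blast
        show "c \<le> Dn eps R \<theta>" if "R \<in> {s1..s2}" "\<theta> \<in> {-10<..<10}" for R \<theta> using Dn that by blast
        fix y C assume y: "\<bar>y - \<rho> 0\<bar> < \<delta>" "closed_orbit (pert_field lam n a b eps) C" "unz (of_real y) \<in> C"
        have yb: "sqrt (2 * A) < y" "y < sqrt (2 * B)" "dist (\<rho> 0) y < d" using y(1) by (auto simp: \<delta>_def dist_real_def abs_less_iff)
        have y0: "0 < y" using yb(1) AB real_sqrt_ge_zero[of "2 * A"] by linarith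
        define l where "l = y\<^sup>2 / 2"
        have yl: "y = sqrt (2 * l)" using y0 by (simp add: l_def)
        have l: "l \<in> {A..B}" "0 < l" using yb(1,2)[unfolded yl] AB by auto
        obtain \<rho>' where \<rho>': "polar_orbit lam n a b eps s1 s2 \<rho>'" "\<rho>' 0 = sqrt (2 * l)"
          "D l = (\<rho>' (2 * pi))\<^sup>2 / 2 - l" using po[OF l(1)] by blast
        have "D l = 0"
          using closed_orbit_displacement_zero[OF \<rho>'(1,2) _ l(2) y(2)] \<rho>'(3) y(3) yl unfolding D_def X_def by simp
        then have "y \<in> (\<lambda>h. sqrt (2 * h)) ` Z" using l yl by (auto simp: Z_def)
        then show "y = \<rho> 0" using d(2) yb(3) by force
      qed
      moreover have "O.Orb \<inter> Transv lam = {unz (of_real (sqrt (2 * h i)))}" using O.Orb_Transv \<rho>(2) by (simp add: k_def)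
      ultimately show ?thesis by blast
    qed
    then obtain Cy where Cy: "\<And>i. i < m \<Longrightarrow> limit_cycle X (Cy i) \<and> Cy i \<inter> Transv lam = {unz (of_real (sqrt (2 * h i)))}" by metis
    have "inj_on Cy {..<m}"
    proof (rule inj_onI)
      fix i j assume ij: "i \<in> {..<m}" "j \<in> {..<m}" "Cy i = Cy j"
      then have "unz (of_real (sqrt (2 * h i))) = unz (of_real (sqrt (2 * h j)))" using Cy[of i] Cy[of j] by auto
      then have "h i = h j" by (metis zc_unz of_real_eq_iff real_sqrt_eq_iff mult_cancel_left zero_neq_numeral)
      then show "i = j" using hmono[of i j] hmono[of j i] ij by (cases i j rule: linorder_cases) auto
    qed
    then have "card (Cy ` {..<m}) = m" by (simp add: card_image)
    moreover have "Cy ` {..<m} \<subseteq> cycles_meeting lam X A B"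
    proof (rule image_subsetI)
      fix i assume "i \<in> {..<m}"
      then have i: "i < m" by simp
      have "Ham lam (unz (of_real (sqrt (2 * h i)))) = h i" using hAB[OF i] AB by (simp add: Ham_zc)
      then show "Cy i \<in> cycles_meeting lam X A B"
        unfolding cycles_meeting_def using Cy[OF i] hAB(3)[OF i] by auto
    qed
    ultimately show ?thesis unfolding X_def by (intro exI[of _ "Cy ` {..<m}"]) simp
  qed
  then show ?thesis unfolding at_least_bifurcate_def using AB e0 by blast
qed

text \<open>The moment \<open>mom k\<close> of the special perturbation with first component 0 and
  second component \<open>y ^ j\<close>.\<close>

definition \<mu> :: "nat \<Rightarrow> nat \<Rightarrow> real" where
  "\<mu> j k = integral {0..2 * pi} (\<lambda>\<theta>. sin \<theta> / be * coeff (Yp \<theta> ^ j) k)"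

text \<open>The polynomial \<open>Q\<close> belonging to the perturbation by
  \<open>y ^ (j + 1)\<close> in the second component alone.\<close>

definition Bp :: "nat \<Rightarrow> real poly" where
  "Bp j = (\<Sum>i<n. monom (- \<mu> (Suc j) (2 * i + 1) * 2 ^ (i + 1) / om) i)"

lemma coeff_Bp: "coeff (Bp j) i = (if i < n then - \<mu> (Suc j) (2 * i + 1) * 2 ^ (i + 1) / om else 0)"
  by (simp add: Bp_def coeff_sum if_distrib[of "\<lambda>x. coeff x _"] coeff_monom)

lemma integral_sin2_cos_pos: "integral {0..2 * pi} (\<lambda>\<theta>. (sin \<theta>)\<^sup>2 * cos \<theta> ^ (2 * j)) > 0"
proof -
  have c: "continuous_on {0..2 * pi} (\<lambda>\<theta>. (sin \<theta>)\<^sup>2 * cos \<theta> ^ (2 * j))" by (intro continuous_intros)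
  have nn: "0 \<le> (sin \<theta>)\<^sup>2 * cos \<theta> ^ (2 * j)" for \<theta> :: real by (simp add: power_mult)
  have "integral {0..2 * pi} (\<lambda>\<theta>. (sin \<theta>)\<^sup>2 * cos \<theta> ^ (2 * j)) \<noteq> 0"
  proof
    assume "integral {0..2 * pi} (\<lambda>\<theta>. (sin \<theta>)\<^sup>2 * cos \<theta> ^ (2 * j)) = 0"
    then have "\<forall>\<theta>\<in>{0..2 * pi}. (sin \<theta>)\<^sup>2 * cos \<theta> ^ (2 * j) = 0"
      using integral_eq_0_iff[OF c] nn by auto
    \<comment> \<open>At \<open>pi / 4\<close> neither sine nor cosine vanishes.\<close>
    then have "(sin (pi / 4))\<^sup>2 * cos (pi / 4) ^ (2 * j) = 0" by (rule bspec) auto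
    then show False by (simp add: sin_45 cos_45)
  qed
  moreover have "integral {0..2 * pi} (\<lambda>\<theta>. (sin \<theta>)\<^sup>2 * cos \<theta> ^ (2 * j)) \<ge> 0"
    by (intro integral_nonneg integrable_continuous_interval c nn)
  ultimately show ?thesis by linarith
qed

text \<open>Along a ray, \<open>y\<close> is \<open>y1 * R + y2 * R\<^sup>2\<close>, and degree
  \<open>2 * j + 1\<close> in its power \<open>j + 1\<close> takes the quadratic term
  \<open>j\<close> times and the linear one once. The cosine in \<open>y1\<close> integrates to 0
  against the rest, while the sine yields the positive integral of
  \<open>sin\<^sup>2 * cos ^ (2 * j)\<close>.\<close>

lemma \<mu>_top: "\<mu> (Suc j) (2 * j + 1) \<noteq> 0"
proof -
  define k where "k = real (Suc j) * (- lam / al\<^sup>2) ^ j"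
  have "sin \<theta> / be * coeff (Yp \<theta> ^ Suc j) (2 * j + 1) =
      k * ((sin \<theta>)\<^sup>2 * cos \<theta> ^ (2 * j)) - k * (lam / (al * be)) * (sin \<theta> * cos \<theta> ^ (2 * j + 1))" for \<theta>
  proof -
    define y1 y2 where "y1 = be * sin \<theta> - lam * (cos \<theta> / al)" and "y2 = - lam * (cos \<theta> / al)\<^sup>2"
    have "Yp \<theta> = monom 1 1 * [:y1, y2:]" by (simp add: Yp_def y1_def y2_def monom_Suc monom_0)
    then have "Yp \<theta> ^ Suc j = monom 1 (Suc j) * [:y1, y2:] ^ Suc j"
      by (simp only: power_mult_distrib monom_power) simp
    then have "coeff (Yp \<theta> ^ Suc j) (2 * j + 1) = coeff ([:y1, y2:] ^ Suc j) j"
      by (simp add: coeff_monom_mult del: power_Suc)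
    also have "\<dots> = real (Suc j) * y2 ^ j * y1"
      by (subst coeff_linear_poly_power) (auto simp del: of_nat_Suc)
    also have "y2 ^ j = (- lam / al\<^sup>2) ^ j * cos \<theta> ^ (2 * j)"
    proof -
      have "y2 = (- lam / al\<^sup>2) * (cos \<theta>)\<^sup>2" by (simp add: y2_def power_divide)
      then show ?thesis by (simp only: power_mult_distrib power_mult)
    qed
    finally have "coeff (Yp \<theta> ^ Suc j) (2 * j + 1) = k * cos \<theta> ^ (2 * j) * y1" by (simp add: k_def)
    then have "sin \<theta> / be * coeff (Yp \<theta> ^ Suc j) (2 * j + 1) = sin \<theta> / be * (k * cos \<theta> ^ (2 * j) * y1)" by simp
    also have "\<dots> = k * ((sin \<theta>)\<^sup>2 * cos \<theta> ^ (2 * j)) - k * (lam / (al * be)) * (sin \<theta> * cos \<theta> ^ (2 * j + 1))"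
      using be(1) al(1) by (simp add: y1_def power2_eq_square field_simps)
    finally show ?thesis .
  qed
  then have "\<mu> (Suc j) (2 * j + 1) = integral {0..2 * pi} (\<lambda>\<theta>. k * ((sin \<theta>)\<^sup>2 * cos \<theta> ^ (2 * j)) -
      k * (lam / (al * be)) * (sin \<theta> * cos \<theta> ^ (2 * j + 1)))"
    unfolding \<mu>_def by simp
  also have "\<dots> = k * integral {0..2 * pi} (\<lambda>\<theta>. (sin \<theta>)\<^sup>2 * cos \<theta> ^ (2 * j)) -
      k * (lam / (al * be)) * integral {0..2 * pi} (\<lambda>\<theta>. sin \<theta> * cos \<theta> ^ (2 * j + 1))"
    using al(1) be(1) by (subst integral_diff) (auto intro!: integrable_continuous_interval continuous_intros)
  also have "\<dots> = k * integral {0..2 * pi} (\<lambda>\<theta>. (sin \<theta>)\<^sup>2 * cos \<theta> ^ (2 * j))"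
    by (simp only: integral_sin_cos_power mult_zero_right diff_0_right)
  finally show ?thesis using integral_sin2_cos_pos[of j] lam al by (simp add: k_def)
qed

text \<open>\<open>y ^ (j + 1)\<close> has degree at most \<open>2 * j + 2\<close> in the radius, so
  the odd moments beyond \<open>2 * j + 1\<close> vanish, and \<open>\<mu>_top\<close> shows that
  this last one does not.\<close>

lemma degree_Bp:
  assumes "j < n" shows "degree (Bp j) = j \<and> Bp j \<noteq> 0"
proof -
  have "\<mu> (Suc j) (2 * i + 1) = 0" if "i > j" for i
  proof -
    have "2 * Suc j < 2 * i + 1" using that by simp
    then have "coeff (Yp \<theta> ^ Suc j) (2 * i + 1) = 0" for \<theta>
      by (intro coeff_eq_0 le_less_trans[OF poly_familyD(1)[OF poly_family_power[OF poly_family_Y]]])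
    then show ?thesis by (simp add: \<mu>_def)
  qed
  then have "degree (Bp j) \<le> j" by (intro degree_le) (auto simp: coeff_Bp)
  moreover have "coeff (Bp j) j \<noteq> 0" using assms \<mu>_top[of j] om by (simp add: coeff_Bp)
  ultimately show ?thesis using le_degree[of "Bp j" j] by auto
qed

lemma Q_eq_sum_Bp:
  assumes a: "a = (\<lambda>i j. 0)" and b: "b = (\<lambda>i j. if i = 0 \<and> 0 < j then c (j - 1) else 0)"
  shows "Q = (\<Sum>j<n. smult (c j) (Bp j))"
proof -
  have bpa: "bp a \<theta> = 0" for \<theta> by (simp add: bp_def a case_prod_unfold)
  have bpb: "bp b \<theta> = (\<Sum>j<n. smult (c j) (Yp \<theta> ^ Suc j))" for \<theta>
  proof -
    have "bp b \<theta> = (\<Sum>(i, j)\<in>(\<lambda>j. (0, Suc j)) ` {..<n}. smult (b i j) (Xp \<theta> ^ i * Yp \<theta> ^ j))"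
      unfolding bp_def
    proof (rule sum.mono_neutral_right[OF finite_index])
      show "\<forall>p\<in>{(i, j). i + j \<le> n} - (\<lambda>j. (0, Suc j)) ` {..<n}.
          (case p of (i, j) \<Rightarrow> smult (b i j) (Xp \<theta> ^ i * Yp \<theta> ^ j)) = 0"
      proof
        fix p assume p: "p \<in> {(i, j). i + j \<le> n} - (\<lambda>j. (0, Suc j)) ` {..<n}"
        obtain i j where ij: "p = (i, j)" by fastforce
        have "b i j = 0"
        proof (rule ccontr)
          assume "b i j \<noteq> 0"
          then have "i = 0" "0 < j" by (auto simp: b split: if_splits)
          then have "p = (\<lambda>j. (0, Suc j)) (j - 1)" "j - 1 < n" using p ij by auto
          then show False using p by blast
        qed
        then show "(case p of (i, j) \<Rightarrow> smult (b i j) (Xp \<theta> ^ i * Yp \<theta> ^ j)) = 0" using ij by simp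
      qed
    qed auto
    also have "\<dots> = (\<Sum>j<n. smult (c j) (Yp \<theta> ^ Suc j))"
      by (subst sum.reindex) (auto simp: inj_on_def b)
    finally show ?thesis .
  qed
  have mom: "mom k = (\<Sum>j<n. c j * \<mu> (Suc j) k)" for k
  proof -
    have "coeff (pp \<theta>) k = (\<Sum>j<n. c j * (sin \<theta> / be * coeff (Yp \<theta> ^ Suc j) k))" for \<theta>
      by (simp add: pp_def Fp_def Gp_def bpa bpb coeff_sum sum_divide_distrib sum_distrib_left mult_ac del: power_Suc)
    then have "mom k = integral {0..2 * pi} (\<lambda>\<theta>. \<Sum>j<n. c j * (sin \<theta> / be * coeff (Yp \<theta> ^ Suc j) k))"
      by (simp add: mom_def)
    also have "\<dots> = (\<Sum>j<n. integral {0..2 * pi} (\<lambda>\<theta>. c j * (sin \<theta> / be * coeff (Yp \<theta> ^ Suc j) k)))"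
      using be(1) by (intro integral_sum integrable_continuous_interval continuous_intros
          poly_familyD(2)[OF poly_family_power[OF poly_family_Y]]) auto
    finally show ?thesis by (simp add: \<mu>_def)
  qed
  show ?thesis
  proof (rule poly_eqI)
    fix i
    show "coeff Q i = coeff (\<Sum>j<n. smult (c j) (Bp j)) i"
    proof (cases "i < n")
      case True
      then have "coeff Q i = (\<Sum>j<n. c j * \<mu> (Suc j) (2 * i + 1)) * (- (2 ^ (i + 1) / om))"
        by (simp add: coeff_Q mom)
      also have "\<dots> = (\<Sum>j<n. c j * coeff (Bp j) i)"
        unfolding sum_distrib_right using True by (intro sum.cong refl) (simp add: coeff_Bp)
      finally show ?thesis by (simp add: coeff_sum)
    qed (simp add: coeff_Q coeff_Bp coeff_sum)
  qed
qed

end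

lemma sharp_coefficients:
  assumes "0 < lam" "lam < 1" and P: "degree P < n"
  shows "\<exists>a b. perturbed_oscillator.Q lam n a b = P"
proof -
  \<comment> \<open>The polynomials \<open>Bp\<close> do not depend on the coefficients, so the zero
    perturbation gives access to them before the coefficients are chosen.\<close>
  interpret z: perturbed_oscillator lam n "\<lambda>i j. 0" "\<lambda>i j. 0" by standard (use assms in auto)
  obtain c where c: "P = (\<Sum>j<n. smult (c j) (z.Bp j))"
    using poly_basis[of n z.Bp P] z.degree_Bp P by blast
  interpret w: perturbed_oscillator lam n "\<lambda>i j. 0" "\<lambda>i j. if (i::nat) = 0 \<and> 0 < j then c (j - 1) else 0"
    by standard (use assms in auto)
  show ?thesis using w.Q_eq_sum_Bp[of c] c by blast
qed

text \<open>The roots are 1, ..., \<open>m\<close> and the nodes are half-integers. Between two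
  neighbouring nodes only the factor with \<open>k = i\<close> changes sign.\<close>

lemma poly_prod_shift_sign:
  fixes m i :: nat
  defines "P \<equiv> (\<Prod>k<m. [:- (real k + 1), 1:])"
  assumes "i < m"
  shows "poly P (real i + 1 / 2) * poly P (real (Suc i) + 1 / 2) < 0"
proof -
  have e: "poly P y = (\<Prod>k<m. (y - (real k + 1)))" for y
    unfolding P_def poly_prod by (intro prod.cong refl) simp
  have "poly P (real i + 1 / 2) * poly P (real (Suc i) + 1 / 2) =
      (\<Prod>k<m. (real i + 1 / 2 - (real k + 1)) * (real (Suc i) + 1 / 2 - (real k + 1)))"
    unfolding e by (simp add: prod.distrib)
  also have "\<dots> = ((real i + 1 / 2 - (real i + 1)) * (real (Suc i) + 1 / 2 - (real i + 1))) *
      (\<Prod>k\<in>{..<m} - {i}. (real i + 1 / 2 - (real k + 1)) * (real (Suc i) + 1 / 2 - (real k + 1)))"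
    using assms by (subst prod.remove[of _ i]) auto
  also have "\<dots> < 0"
  proof (rule mult_neg_pos)
    show "(real i + 1 / 2 - (real i + 1)) * (real (Suc i) + 1 / 2 - (real i + 1)) < 0"
      by (simp add: mult_less_0_iff)
    show "0 < (\<Prod>k\<in>{..<m} - {i}. (real i + 1 / 2 - (real k + 1)) * (real (Suc i) + 1 / 2 - (real k + 1)))"
    proof (rule prod_pos)
      fix k assume k: "k \<in> {..<m} - {i}"
      then consider "k < i" | "i < k" by force
      then show "0 < (real i + 1 / 2 - (real k + 1)) * (real (Suc i) + 1 / 2 - (real k + 1))"
      proof cases
        case 1
        then have "real k + 1 \<le> real i" by linarith
        then show ?thesis by (intro mult_pos_pos) auto
      next
        case 2
        then have "real i + 1 \<le> real k" by linarith
        then show ?thesis by (intro mult_neg_neg) auto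
      qed
    qed
  qed
  finally show ?thesis .
qed

theorem theorem1p2:
  fixes lam :: real and n :: nat
  assumes "0 < lam" and "lam < 1" and "n \<ge> 2"
  shows
    "(\<forall>a b :: nat \<Rightarrow> nat \<Rightarrow> real. (\<exists>h>0. abelian_integral lam n a b h \<noteq> 0) \<longrightarrow>
        (let Z = {h. h > 0 \<and> abelian_integral lam n a b h = 0} in
           finite Z \<and> (\<Sum>h\<in>Z. zero_mult (abelian_integral lam n a b) h) \<le> enat (n - 1)) \<and>
        at_most_bifurcate lam n a b (n - 1)) \<and>
     (\<exists>a b :: nat \<Rightarrow> nat \<Rightarrow> real. (\<exists>h>0. abelian_integral lam n a b h \<noteq> 0) \<and>
        at_least_bifurcate lam n a b (n - 1))"
proof (intro conjI allI impI)
  fix a b :: "nat \<Rightarrow> nat \<Rightarrow> real"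
  assume "\<exists>h>0. abelian_integral lam n a b h \<noteq> 0"
  then obtain h where h: "h > 0" "abelian_integral lam n a b h \<noteq> 0" by blast
  interpret perturbed_oscillator lam n a b by standard (use assms in auto)
  have "Q \<noteq> 0" using h abelian_integral_poly[of h] by auto
  then show "let Z = {h. h > 0 \<and> abelian_integral lam n a b h = 0} in
      finite Z \<and> (\<Sum>h\<in>Z. zero_mult (abelian_integral lam n a b) h) \<le> enat (n - 1)"
    "at_most_bifurcate lam n a b (n - 1)"
    unfolding Let_def by (rule abelian_zeros, rule upper_bound)
next
  define m where "m = n - 1"
  define P where "P = (\<Prod>k<m. [:- (real k + 1), 1:])"
  have m: "0 < m" "m < n" using assms by (auto simp: m_def)
  have "degree P = m" unfolding P_def by (subst degree_prod_eq_sum_degree) auto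
  then obtain a b where ab: "perturbed_oscillator.Q lam n a b = P"
    using sharp_coefficients[OF assms(1,2), of P n] m by auto
  interpret perturbed_oscillator lam n a b by standard (use assms in auto)
  have sign: "poly Q (real i + 1 / 2) * poly Q (real (Suc i) + 1 / 2) < 0" if "i < m" for i
    unfolding ab P_def by (rule poly_prod_shift_sign[OF that])
  have Q0: "poly Q (1 / 2) \<noteq> 0" using sign[OF m(1)] by auto
  have "at_least_bifurcate lam n a b m"
    by (rule lower_bound[of m "\<lambda>i. real i + 1 / 2"]) (use m sign Q0 in auto)
  moreover have "abelian_integral lam n a b (1 / 2) \<noteq> 0" using Q0 by (simp add: abelian_integral_poly)
  ultimately show "\<exists>a b :: nat \<Rightarrow> nat \<Rightarrow> real. (\<exists>h>0. abelian_integral lam n a b h \<noteq> 0) \<and>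
        at_least_bifurcate lam n a b (n - 1)"
    unfolding m_def[symmetric] by (intro exI[of _ a] exI[of _ b] conjI exI[of _ "1 / 2"]) auto
qed

end
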